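(* Let $\mathcal M$ be a graded manifold and $\mathcal E$ a graded vector bundle over $\mathcal M$. The jet prolongation $\mathfrak j^0:\Gamma_{\mathcal E}\to\mathrm{Jet}^0_{\mathcal E}$ is a $\mathcal C^\infty_{\mathcal M}$-linear sheaf isomorphism, which can be viewed as a canonical graded vector bundle isomorphism $\mathfrak j^0:\mathcal E\to\mathfrak J^0_{\mathcal E}$.
   Context: Graded means $\mathbb{Z}$-graded. Graded vector spaces and modules are sequences indexed by $j\in\mathbb Z$; all elements are homogeneous and $|v|$ is the degree. A graded linear map $F$ of degree $|F|$ raises degree by $|F|$; it is linear over a graded commutative algebra if $F(f\cdot v)=(-1)^{|F||f|}f\cdot F(v)$. Graded manifold $\mathcal M$: a second countable Hausdorff space $M$ with a sheaf $\mathcal{C}^\infty_{\mathcal M}$ of graded commutative associative unital real algebras, locally isomorphic to the following model: an open subset of $\mathbb R^{n_0}$ with the sheaf of formal power series in graded commuting variables of nonzero degrees ($n_j$ of degree $j\neq 0$), with smooth coefficients; $\sum_j n_j$ is finite. Each function $f$ has a body $\underline f$ (a smooth function, zero if $|f|\neq0$), and $f(m):=\underline f(m)$. Graded vector bundle $\mathcal E$: a sheaf $\Gamma_{\mathcal E}$ of graded $\mathcal{C}^\infty_{\mathcal M}$-modules locally isomorphic to $\mathcal{C}^\infty_{\mathcal M}\otimes_{\mathbb R}K$ for a fixed finite-dimensional graded vector space $K$. Graded vector bundle maps over the identity are $\mathcal C^\infty_{\mathcal M}$-linear sheaf morphisms of sheaves of sections. Geometrization: for $a\in U$ let $\mathcal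 J^a_{\mathcal M}(U)=\{f\in\mathcal{C}^\infty_{\mathcal M}(U): f(a)=0\}$. For a graded $\mathcal{C}^\infty_{\mathcal M}(U)$-module $P$ let $P^\bullet=\bigcap_{q\in\mathbb N}\bigcap_{a\in U}(\mathcal J^a_{\mathcal M}(U))^q P$. For a presheaf $\mathcal F$ of graded $\mathcal{C}^\infty_{\mathcal M}$-modules, $\mathrm{Geo}(\mathcal F)(U)=\mathcal F(U)/\mathcal F(U)^\bullet$, and $[\psi]^\bullet$ denotes the class of $\psi$. Jets: for open $U\subseteq M$ and $k\in\mathbb N_0$ let $\mathcal X(U)=\mathcal{C}^\infty_{\mathcal M}(U)\otimes_{\mathbb R}\Gamma_{\mathcal E}(U)$ with two actions $f\triangleright(g\otimes\psi)=(fg)\otimes\psi$ and $f\blacktriangleright(g\otimes\psi)=(-1)^{|f||g|}g\otimes(f\cdot\psi)$; let $\delta_f(x)=f\triangleright x-f\blacktriangleright x$. Let $\mathcal V_{(k)}(U)$ be the real span of all $\delta_{f_1}\cdots\delta_{f_{k+1}}(g\otimes\psi)$, $\mathrm{pJet}^k_{\mathcal E}(U)=\mathcal X(U)/\mathcal V_{(k)}(U)$, and let $g\otimes_{(k)}\psi$ be the class of $g\otimes\psi$. Put $\mathrm{gpJet}^k_{\mathcal E}=\mathrm{Geo}(\mathrm{pJet}^k_{\mathcal E})$ (with respect to $\triangleright$), and let $\mathrm{Jet}^k_{\mathcal E}$ be the sheafification of $\mathrm{gpJet}^k_{\mathcal E}$ with canonical presheaf morphism $\mathrm{sff}:\mathrm{gpJet}^k_{\mathcal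 E}\to\mathrm{Jet}^k_{\mathcal E}$. Module structures are with respect to $\triangleright$. $\mathrm{Jet}^k_{\mathcal E}$ is the sheaf of sections of a graded vector bundle $\mathfrak J^k_{\mathcal E}$. The jet prolongation is $\mathfrak j^k:\Gamma_{\mathcal E}\to\mathrm{Jet}^k_{\mathcal E}$, $\mathfrak j^k_U(\psi)=\mathrm{sff}_U([1\otimes_{(k)}\psi]^\bullet)$. *)

theory Defs
  imports
    "HOL-Analysis.Analysis"
    "HOL-Algebra.Module"
    "HOL-Algebra.AbelCoset"
    "HOL-Library.Poly_Mapping"
begin

section \<open>Graded linear algebra over the reals\<close>

text \<open>
  All graded objects are sequences indexed by \<open>int\<close>; only homogeneous elements occur.
  The same raw value may lie in the carriers of several degrees, so every operation takes the
  degrees of its arguments as explicit parameters.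
\<close>

definition real_ring :: "real ring" where
  "real_ring = \<lparr>carrier = UNIV, mult = (*), one = 1, zero = 0, add = (+)\<rparr>"

definition rlinear :: "(real,'a) module \<Rightarrow> (real,'b) module \<Rightarrow> ('a \<Rightarrow> 'b) \<Rightarrow> bool" where
  "rlinear M N f \<longleftrightarrow>
     f \<in> carrier M \<rightarrow> carrier N \<and>
     (\<forall>x\<in>carrier M. \<forall>y\<in>carrier M. f (x \<oplus>\<^bsub>M\<^esub> y) = f x \<oplus>\<^bsub>N\<^esub> f y) \<and>
     (\<forall>r. \<forall>x\<in>carrier M. f (r \<odot>\<^bsub>M\<^esub> x) = r \<odot>\<^bsub>N\<^esub> f x)"

definition rbilinear ::
  "(real,'a) module \<Rightarrow> (real,'b) module \<Rightarrow> (real,'c) module \<Rightarrow> ('a \<Rightarrow> 'b \<Rightarrow> 'c) \<Rightarrow> bool" where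
  "rbilinear M N P b \<longleftrightarrow>
     (\<forall>x\<in>carrier M. rlinear N P (b x)) \<and> (\<forall>y\<in>carrier N. rlinear M P (\<lambda>x. b x y))"

definition rspan :: "(real,'a) module \<Rightarrow> 'a set \<Rightarrow> 'a set" where
  "rspan M S = \<Inter>{N. submodule N real_ring M \<and> S \<subseteq> N}"

text \<open>The map of quotients that \<open>F\<close> induces into the quotient of \<open>N\<close> by \<open>W\<close>; cosets are
  sets, and the union is a single coset whenever \<open>F\<close> respects the submodules divided out.\<close>

definition quot_map :: "(real,'b) module \<Rightarrow> 'b set \<Rightarrow> ('a \<Rightarrow> 'b) \<Rightarrow> 'a set \<Rightarrow> 'b set" where
  "quot_map N W F S = (\<Union>u\<in>S. W +>\<^bsub>N\<^esub> F u)"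

text \<open>The fields \<open>mult\<close> and \<open>one\<close> of a module record carry no meaning.\<close>

definition mquot :: "(real,'a) module \<Rightarrow> 'a set \<Rightarrow> (real,'a set) module" where
  "mquot M W = \<lparr>carrier = a_rcosets\<^bsub>M\<^esub> W, mult = undefined, one = undefined,
     zero = W, add = set_add M, smult = (\<lambda>r. quot_map M W (\<lambda>u. r \<odot>\<^bsub>M\<^esub> u))\<rparr>"

definition free_mod :: "'g set \<Rightarrow> (real, 'g \<Rightarrow>\<^sub>0 real) module" where
  "free_mod G = \<lparr>carrier = {u. Poly_Mapping.keys u \<subseteq> G}, mult = undefined, one = undefined,
     zero = 0, add = (+), smult = (\<lambda>r. Poly_Mapping.map ((*) r))\<rparr>"

definition lin_ext :: "('g \<Rightarrow> ('h \<Rightarrow>\<^sub>0 real)) \<Rightarrow> ('g \<Rightarrow>\<^sub>0 real) \<Rightarrow> ('h \<Rightarrow>\<^sub>0 real)" where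
  "lin_ext F u = (\<Sum>t\<in>Poly_Mapping.keys u. Poly_Mapping.map ((*) (Poly_Mapping.lookup u t)) (F t))"

record 'a gvs =
  grade :: "int \<Rightarrow> (real,'a) module"

record 'a galg = "'a gvs" +
  gmult :: "int \<Rightarrow> int \<Rightarrow> 'a \<Rightarrow> 'a \<Rightarrow> 'a"
  gone :: 'a

record ('a,'b) gmod = "'b gvs" +
  gact :: "int \<Rightarrow> int \<Rightarrow> 'a \<Rightarrow> 'b \<Rightarrow> 'b"

abbreviation gcarrier :: "('a,'z) gvs_scheme \<Rightarrow> int \<Rightarrow> 'a set" where
  "gcarrier P d \<equiv> carrier (grade P d)"

definition koszul :: "int \<Rightarrow> int \<Rightarrow> real" where
  "koszul i j = (-1) powi (i * j)"

definition graded_vector_space :: "('a,'z) gvs_scheme \<Rightarrow> bool" where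
  "graded_vector_space P \<longleftrightarrow> (\<forall>d. Module.module real_ring (grade P d))"

definition finite_dim_gvs :: "('a,'z) gvs_scheme \<Rightarrow> bool" where
  "finite_dim_gvs K \<longleftrightarrow> graded_vector_space K \<and>
     (\<forall>d. \<exists>B. finite B \<and> B \<subseteq> gcarrier K d \<and> rspan (grade K d) B = gcarrier K d) \<and>
     finite {d. gcarrier K d \<noteq> {\<zero>\<^bsub>grade K d\<^esub>}}"

definition graded_comm_algebra :: "'a galg \<Rightarrow> bool" where
  "graded_comm_algebra A \<longleftrightarrow> graded_vector_space A \<and>
     (\<forall>i j. rbilinear (grade A i) (grade A j) (grade A (i + j)) (gmult A i j)) \<and>
     (\<forall>i j k. \<forall>x\<in>gcarrier A i. \<forall>y\<in>gcarrier A j. \<forall>z\<in>gcarrier A k.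
        gmult A (i + j) k (gmult A i j x y) z = gmult A i (j + k) x (gmult A j k y z)) \<and>
     (\<forall>i j. \<forall>x\<in>gcarrier A i. \<forall>y\<in>gcarrier A j.
        gmult A i j x y = koszul i j \<odot>\<^bsub>grade A (i + j)\<^esub> gmult A j i y x) \<and>
     gone A \<in> gcarrier A 0 \<and>
     (\<forall>i. \<forall>x\<in>gcarrier A i. gmult A 0 i (gone A) x = x)"

definition graded_module :: "'a galg \<Rightarrow> ('a,'b) gmod \<Rightarrow> bool" where
  "graded_module A P \<longleftrightarrow> graded_vector_space P \<and>
     (\<forall>i j. rbilinear (grade A i) (grade P j) (grade P (i + j)) (gact P i j)) \<and>
     (\<forall>i j k. \<forall>f\<in>gcarrier A i. \<forall>g\<in>gcarrier A j. \<forall>x\<in>gcarrier P k.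
        gact P (i + j) k (gmult A i j f g) x = gact P i (j + k) f (gact P j k g x)) \<and>
     (\<forall>i. \<forall>x\<in>gcarrier P i. gact P 0 i (gone A) x = x)"

definition gmod_quot :: "('a,'b) gmod \<Rightarrow> (int \<Rightarrow> 'b set) \<Rightarrow> ('a,'b set) gmod" where
  "gmod_quot P W = \<lparr>grade = (\<lambda>d. mquot (grade P d) (W d)),
     gact = (\<lambda>p d f. quot_map (grade P (p + d)) (W (p + d)) (gact P p d f))\<rparr>"


section \<open>Graded tensor product over the reals\<close>

text \<open>A generator \<open>(i, x, y)\<close> in total degree \<open>d\<close> stands for the tensor of \<open>x\<close> of degree \<open>i\<close> and
  \<open>y\<close> of degree \<open>d - i\<close>. Since no relation connects different \<open>i\<close>, degree \<open>d\<close> of the tensor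
  product is the direct sum over \<open>i\<close> of the tensor products of degrees \<open>i\<close> and \<open>d - i\<close>.\<close>

type_synonym ('a,'b) free_tensor = "(int \<times> 'a \<times> 'b) \<Rightarrow>\<^sub>0 real"

definition tens_gens ::
  "('a,'y) gvs_scheme \<Rightarrow> ('b,'z) gvs_scheme \<Rightarrow> int \<Rightarrow> (int \<times> 'a \<times> 'b) set" where
  "tens_gens P Q d = {(i, x, y). x \<in> gcarrier P i \<and> y \<in> gcarrier Q (d - i)}"

definition free_tens ::
  "('a,'y) gvs_scheme \<Rightarrow> ('b,'z) gvs_scheme \<Rightarrow> int \<Rightarrow> (real, ('a,'b) free_tensor) module" where
  "free_tens P Q d = free_mod (tens_gens P Q d)"

definition tens_rels ::
  "('a,'y) gvs_scheme \<Rightarrow> ('b,'z) gvs_scheme \<Rightarrow> int \<Rightarrow> ('a,'b) free_tensor set" where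
  "tens_rels P Q d =
     {Poly_Mapping.single (i, x \<oplus>\<^bsub>grade P i\<^esub> x', y) 1
        - Poly_Mapping.single (i, x, y) 1 - Poly_Mapping.single (i, x', y) 1 | i x x' y.
        x \<in> gcarrier P i \<and> x' \<in> gcarrier P i \<and> y \<in> gcarrier Q (d - i)} \<union>
     {Poly_Mapping.single (i, x, y \<oplus>\<^bsub>grade Q (d - i)\<^esub> y') 1
        - Poly_Mapping.single (i, x, y) 1 - Poly_Mapping.single (i, x, y') 1 | i x y y'.
        x \<in> gcarrier P i \<and> y \<in> gcarrier Q (d - i) \<and> y' \<in> gcarrier Q (d - i)} \<union>
     {Poly_Mapping.single (i, r \<odot>\<^bsub>grade P i\<^esub> x, y) 1 - Poly_Mapping.single (i, x, y) r | i r x y.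
        x \<in> gcarrier P i \<and> y \<in> gcarrier Q (d - i)} \<union>
     {Poly_Mapping.single (i, x, r \<odot>\<^bsub>grade Q (d - i)\<^esub> y) 1 - Poly_Mapping.single (i, x, y) r | i r x y.
        x \<in> gcarrier P i \<and> y \<in> gcarrier Q (d - i)}"

definition tens_ker ::
  "('a,'y) gvs_scheme \<Rightarrow> ('b,'z) gvs_scheme \<Rightarrow> int \<Rightarrow> ('a,'b) free_tensor set" where
  "tens_ker P Q d = rspan (free_tens P Q d) (tens_rels P Q d)"

definition gtensor ::
  "('a,'y) gvs_scheme \<Rightarrow> ('b,'z) gvs_scheme \<Rightarrow> int \<Rightarrow> (real, ('a,'b) free_tensor set) module" where
  "gtensor P Q d = mquot (free_tens P Q d) (tens_ker P Q d)"

text \<open>\<open>tens P Q d i x y\<close> is the pure tensor of \<open>x\<close> of degree \<open>i\<close> and \<open>y\<close> of degree \<open>d - i\<close>.\<close>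

definition tens ::
  "('a,'y) gvs_scheme \<Rightarrow> ('b,'z) gvs_scheme \<Rightarrow> int \<Rightarrow> int \<Rightarrow> 'a \<Rightarrow> 'b \<Rightarrow> ('a,'b) free_tensor set" where
  "tens P Q d i x y = tens_ker P Q d +>\<^bsub>free_tens P Q d\<^esub> Poly_Mapping.single (i, x, y) 1"

text \<open>The action \<open>f \<triangleright> (g \<otimes> y) = (f g) \<otimes> y\<close> of \<open>f\<close> of degree \<open>p\<close> in degree \<open>d\<close>.\<close>

definition left_act ::
  "'a galg \<Rightarrow> ('b,'z) gvs_scheme \<Rightarrow> int \<Rightarrow> int \<Rightarrow> 'a
     \<Rightarrow> ('a,'b) free_tensor set \<Rightarrow> ('a,'b) free_tensor set" where
  "left_act A Q p d f = quot_map (free_tens A Q (p + d)) (tens_ker A Q (p + d))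
     (lin_ext (\<lambda>(i, g, y). Poly_Mapping.single (p + i, gmult A p i f g, y) 1))"

text \<open>The action \<open>f \<blacktriangleright> (g \<otimes> y) = (-1)\<^bsup>|f||g|\<^esup> g \<otimes> (f \<cdot> y)\<close>.\<close>

definition right_act ::
  "'a galg \<Rightarrow> ('a,'b) gmod \<Rightarrow> int \<Rightarrow> int \<Rightarrow> 'a
     \<Rightarrow> ('a,'b) free_tensor set \<Rightarrow> ('a,'b) free_tensor set" where
  "right_act A Q p d f = quot_map (free_tens A Q (p + d)) (tens_ker A Q (p + d))
     (lin_ext (\<lambda>(i, g, y). Poly_Mapping.single (i, g, gact Q p (d - i) f y) (koszul p i)))"

definition tensor_module ::
  "'a galg \<Rightarrow> ('b,'z) gvs_scheme \<Rightarrow> ('a, ('a,'b) free_tensor set) gmod" where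
  "tensor_module A Q = \<lparr>grade = gtensor A Q, gact = left_act A Q\<rparr>"

text \<open>\<open>tens_map P Q d \<rho> \<sigma>\<close> is the map \<open>\<rho> \<otimes> \<sigma>\<close> in degree \<open>d\<close>, with values in \<open>P \<otimes> Q\<close>.\<close>

definition tens_map ::
  "('c,'y) gvs_scheme \<Rightarrow> ('e,'z) gvs_scheme \<Rightarrow> int \<Rightarrow> (int \<Rightarrow> 'a \<Rightarrow> 'c) \<Rightarrow> (int \<Rightarrow> 'b \<Rightarrow> 'e)
     \<Rightarrow> ('a,'b) free_tensor set \<Rightarrow> ('c,'e) free_tensor set" where
  "tens_map P Q d \<rho> \<sigma> = quot_map (free_tens P Q d) (tens_ker P Q d)
     (lin_ext (\<lambda>(i, x, y). Poly_Mapping.single (i, \<rho> i x, \<sigma> (d - i) y) 1))"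


section \<open>Presheaves and sheaves of graded objects\<close>

text \<open>\<open>res F U V d\<close> restricts elements of degree \<open>d\<close> from \<open>U\<close> to \<open>V\<close>; it is meaningful only
  for open \<open>V \<subseteq> U\<close>.\<close>

record ('p,'a,'o) psh =
  sec :: "'p set \<Rightarrow> 'o"
  res :: "'p set \<Rightarrow> 'p set \<Rightarrow> int \<Rightarrow> 'a \<Rightarrow> 'a"

type_synonym ('p,'a) alg_psh = "('p, 'a, 'a galg) psh"
type_synonym ('p,'a,'b) mod_psh = "('p, 'b, ('a,'b) gmod) psh"

definition presheaf :: "'p topology \<Rightarrow> ('p,'a,('a,'z) gvs_scheme) psh \<Rightarrow> bool" where
  "presheaf X F \<longleftrightarrow>
     (\<forall>U. openin X U \<longrightarrow> graded_vector_space (sec F U)) \<and>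
     (\<forall>U V d. openin X U \<and> openin X V \<and> V \<subseteq> U \<longrightarrow>
        rlinear (grade (sec F U) d) (grade (sec F V) d) (res F U V d)) \<and>
     (\<forall>U d. openin X U \<longrightarrow> (\<forall>x\<in>gcarrier (sec F U) d. res F U U d x = x)) \<and>
     (\<forall>U V W d. openin X U \<and> openin X V \<and> openin X W \<and> W \<subseteq> V \<and> V \<subseteq> U \<longrightarrow>
        (\<forall>x\<in>gcarrier (sec F U) d. res F V W d (res F U V d x) = res F U W d x))"

definition sheaf :: "'p topology \<Rightarrow> ('p,'a,('a,'z) gvs_scheme) psh \<Rightarrow> bool" where
  "sheaf X F \<longleftrightarrow> presheaf X F \<and>
     (\<forall>\<U> d. (\<forall>V\<in>\<U>. openin X V) \<longrightarrow>
        (\<forall>x\<in>gcarrier (sec F (\<Union>\<U>)) d. \<forall>y\<in>gcarrier (sec F (\<Union>\<U>)) d.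
           (\<forall>V\<in>\<U>. res F (\<Union>\<U>) V d x = res F (\<Union>\<U>) V d y) \<longrightarrow> x = y) \<and>
        (\<forall>s. (\<forall>V\<in>\<U>. s V \<in> gcarrier (sec F V) d) \<and>
             (\<forall>V\<in>\<U>. \<forall>W\<in>\<U>. res F V (V \<inter> W) d (s V) = res F W (V \<inter> W) d (s W)) \<longrightarrow>
             (\<exists>x\<in>gcarrier (sec F (\<Union>\<U>)) d. \<forall>V\<in>\<U>. res F (\<Union>\<U>) V d x = s V)))"

definition algebra_sheaf :: "'p topology \<Rightarrow> ('p,'a) alg_psh \<Rightarrow> bool" where
  "algebra_sheaf X C \<longleftrightarrow> sheaf X C \<and>
     (\<forall>U. openin X U \<longrightarrow> graded_comm_algebra (sec C U)) \<and>
     (\<forall>U V. openin X U \<and> openin X V \<and> V \<subseteq> U \<longrightarrow>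
        res C U V 0 (gone (sec C U)) = gone (sec C V) \<and>
        (\<forall>i j. \<forall>f\<in>gcarrier (sec C U) i. \<forall>g\<in>gcarrier (sec C U) j.
           res C U V (i + j) (gmult (sec C U) i j f g)
             = gmult (sec C V) i j (res C U V i f) (res C U V j g)))"

definition module_sheaf :: "'p topology \<Rightarrow> ('p,'a) alg_psh \<Rightarrow> ('p,'a,'b) mod_psh \<Rightarrow> bool" where
  "module_sheaf X C F \<longleftrightarrow> sheaf X F \<and>
     (\<forall>U. openin X U \<longrightarrow> graded_module (sec C U) (sec F U)) \<and>
     (\<forall>U V. openin X U \<and> openin X V \<and> V \<subseteq> U \<longrightarrow>
        (\<forall>i j. \<forall>f\<in>gcarrier (sec C U) i. \<forall>x\<in>gcarrier (sec F U) j.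
           res F U V (i + j) (gact (sec F U) i j f x)
             = gact (sec F V) i j (res C U V i f) (res F U V j x)))"

text \<open>All morphisms have degree 0, so linearity over the functions involves no sign.\<close>

definition psh_hom ::
  "'p topology \<Rightarrow> ('p,'a,('a,'y) gvs_scheme) psh \<Rightarrow> ('p,'b,('b,'z) gvs_scheme) psh
     \<Rightarrow> ('p set \<Rightarrow> int \<Rightarrow> 'a \<Rightarrow> 'b) \<Rightarrow> bool" where
  "psh_hom X F G \<alpha> \<longleftrightarrow>
     (\<forall>U d. openin X U \<longrightarrow> rlinear (grade (sec F U) d) (grade (sec G U) d) (\<alpha> U d)) \<and>
     (\<forall>U V d. openin X U \<and> openin X V \<and> V \<subseteq> U \<longrightarrow>
        (\<forall>x\<in>gcarrier (sec F U) d. res G U V d (\<alpha> U d x) = \<alpha> V d (res F U V d x)))"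

definition alg_hom ::
  "'p topology \<Rightarrow> ('p,'a) alg_psh \<Rightarrow> ('p,'b) alg_psh \<Rightarrow> ('p set \<Rightarrow> int \<Rightarrow> 'a \<Rightarrow> 'b) \<Rightarrow> bool" where
  "alg_hom X F G \<alpha> \<longleftrightarrow> psh_hom X F G \<alpha> \<and>
     (\<forall>U. openin X U \<longrightarrow> \<alpha> U 0 (gone (sec F U)) = gone (sec G U) \<and>
        (\<forall>i j. \<forall>f\<in>gcarrier (sec F U) i. \<forall>g\<in>gcarrier (sec F U) j.
           \<alpha> U (i + j) (gmult (sec F U) i j f g) = gmult (sec G U) i j (\<alpha> U i f) (\<alpha> U j g)))"

definition mod_hom ::
  "'p topology \<Rightarrow> ('p,'a) alg_psh \<Rightarrow> ('p,'a,'b) mod_psh \<Rightarrow> ('p,'a,'c) mod_psh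
     \<Rightarrow> ('p set \<Rightarrow> int \<Rightarrow> 'b \<Rightarrow> 'c) \<Rightarrow> bool" where
  "mod_hom X C F G \<alpha> \<longleftrightarrow> psh_hom X F G \<alpha> \<and>
     (\<forall>U. openin X U \<longrightarrow>
        (\<forall>i j. \<forall>f\<in>gcarrier (sec C U) i. \<forall>x\<in>gcarrier (sec F U) j.
           \<alpha> U (i + j) (gact (sec F U) i j f x) = gact (sec G U) i j f (\<alpha> U j x)))"

definition mutually_inverse ::
  "'p topology \<Rightarrow> ('p,'a,('a,'y) gvs_scheme) psh \<Rightarrow> ('p,'b,('b,'z) gvs_scheme) psh
     \<Rightarrow> ('p set \<Rightarrow> int \<Rightarrow> 'a \<Rightarrow> 'b) \<Rightarrow> ('p set \<Rightarrow> int \<Rightarrow> 'b \<Rightarrow> 'a) \<Rightarrow> bool" where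
  "mutually_inverse X F G \<alpha> \<beta> \<longleftrightarrow>
     (\<forall>U d. openin X U \<longrightarrow> (\<forall>x\<in>gcarrier (sec F U) d. \<beta> U d (\<alpha> U d x) = x) \<and>
                          (\<forall>y\<in>gcarrier (sec G U) d. \<alpha> U d (\<beta> U d y) = y))"

definition alg_iso ::
  "'p topology \<Rightarrow> ('p,'a) alg_psh \<Rightarrow> ('p,'b) alg_psh \<Rightarrow> ('p set \<Rightarrow> int \<Rightarrow> 'a \<Rightarrow> 'b) \<Rightarrow> bool" where
  "alg_iso X F G \<alpha> \<longleftrightarrow> alg_hom X F G \<alpha> \<and> (\<exists>\<beta>. alg_hom X G F \<beta> \<and> mutually_inverse X F G \<alpha> \<beta>)"

definition mod_iso ::
  "'p topology \<Rightarrow> ('p,'a) alg_psh \<Rightarrow> ('p,'a,'b) mod_psh \<Rightarrow> ('p,'a,'c) mod_psh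
     \<Rightarrow> ('p set \<Rightarrow> int \<Rightarrow> 'b \<Rightarrow> 'c) \<Rightarrow> bool" where
  "mod_iso X C F G \<alpha> \<longleftrightarrow>
     mod_hom X C F G \<alpha> \<and> (\<exists>\<beta>. mod_hom X C G F \<beta> \<and> mutually_inverse X F G \<alpha> \<beta>)"

definition module_sheaf_iso ::
  "'p topology \<Rightarrow> ('p,'a) alg_psh \<Rightarrow> ('p,'a,'b) mod_psh \<Rightarrow> ('p,'a,'c) mod_psh
     \<Rightarrow> ('p set \<Rightarrow> int \<Rightarrow> 'b \<Rightarrow> 'c) \<Rightarrow> bool" where
  "module_sheaf_iso X C F G \<alpha> \<longleftrightarrow> module_sheaf X C F \<and> module_sheaf X C G \<and> mod_iso X C F G \<alpha>"


section \<open>Graded manifolds\<close>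

text \<open>Points of \<open>\<real>\<^sup>m\<close> are the points of \<^term>\<open>Euclidean_space m\<close>, i.e. functions \<open>nat \<Rightarrow> real\<close>
  vanishing from index \<open>m\<close> on; this includes \<open>m = 0\<close>.\<close>

type_synonym point = "nat \<Rightarrow> real"

definition partial_deriv :: "nat \<Rightarrow> (point \<Rightarrow> real) \<Rightarrow> point \<Rightarrow> real" where
  "partial_deriv i f x = deriv (\<lambda>t. f (x(i := t))) (x i)"

primrec times_cont_diff :: "nat \<Rightarrow> nat \<Rightarrow> point set \<Rightarrow> (point \<Rightarrow> real) \<Rightarrow> bool" where
  "times_cont_diff m 0 U f \<longleftrightarrow> continuous_map (subtopology (Euclidean_space m) U) euclideanreal f"
| "times_cont_diff m (Suc k) U f \<longleftrightarrow>
     continuous_map (subtopology (Euclidean_space m) U) euclideanreal f \<and>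
     (\<forall>i<m. (\<forall>x\<in>U. (\<lambda>t. f (x(i := t))) differentiable (at (x i))) \<and>
            times_cont_diff m k U (partial_deriv i f))"

definition smooth_on :: "nat \<Rightarrow> point set \<Rightarrow> (point \<Rightarrow> real) \<Rightarrow> bool" where
  "smooth_on m U f \<longleftrightarrow> (\<forall>k. times_cont_diff m k U f)"

text \<open>For a graded dimension \<open>n :: int \<Rightarrow> nat\<close>, the formal variables of degree \<open>j \<noteq> 0\<close> are the
  pairs \<open>(j, i)\<close> with \<open>i < n j\<close>. They are ordered lexicographically, and a monomial is the product
  of its variables in increasing order. Odd variables square to zero.\<close>

type_synonym multi_index = "int \<times> nat \<Rightarrow> nat"

definition gvars :: "(int \<Rightarrow> nat) \<Rightarrow> (int \<times> nat) set" where
  "gvars n = {(j, i). j \<noteq> 0 \<and> i < n j}"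

definition var_less :: "int \<times> nat \<Rightarrow> int \<times> nat \<Rightarrow> bool" where
  "var_less v w \<longleftrightarrow> fst v < fst w \<or> (fst v = fst w \<and> snd v < snd w)"

definition multi_indices :: "(int \<Rightarrow> nat) \<Rightarrow> int \<Rightarrow> multi_index set" where
  "multi_indices n d = {p. (\<forall>v. v \<notin> gvars n \<longrightarrow> p v = 0) \<and> (\<forall>v. odd (fst v) \<longrightarrow> p v \<le> 1) \<and>
     (\<Sum>v\<in>gvars n. int (p v) * fst v) = d}"

text \<open>The sign that reorders the product of the monomials with exponents \<open>p\<close> and \<open>q\<close>: every
  variable of the second factor passes the larger variables of the first.\<close>

definition mono_sign :: "(int \<Rightarrow> nat) \<Rightarrow> multi_index \<Rightarrow> multi_index \<Rightarrow> real" where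
  "mono_sign n p q = (\<Prod>(v, w)\<in>{(v, w). v \<in> gvars n \<and> w \<in> gvars n \<and> var_less w v}.
     koszul (int (p v) * fst v) (int (q w) * fst w))"

text \<open>A section \<open>f\<close> over \<open>U\<close> is the formal power series whose coefficient at the monomial with
  exponent \<open>p\<close> is the smooth function \<open>f p\<close>, set to 0 outside \<open>U\<close>.\<close>

type_synonym power_series = "multi_index \<Rightarrow> point \<Rightarrow> real"

definition model_alg :: "(int \<Rightarrow> nat) \<Rightarrow> point set \<Rightarrow> power_series galg" where
  "model_alg n U = \<lparr>
     grade = (\<lambda>d. \<lparr>carrier = {f. (\<forall>p\<in>multi_indices n d. smooth_on (n 0) U (f p) \<and> (\<forall>x. x \<notin> U \<longrightarrow> f p x = 0)) \<and>
                               (\<forall>p. p \<notin> multi_indices n d \<longrightarrow> f p = (\<lambda>x. 0))},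
        mult = undefined, one = undefined,
        zero = (\<lambda>p x. 0),
        add = (\<lambda>f g p x. f p x + g p x),
        smult = (\<lambda>r f p x. r * f p x)\<rparr>),
     gmult = (\<lambda>i j f g r x. if r \<in> multi_indices n (i + j)
        then \<Sum>(p, q)\<in>{(p, q). \<forall>v. p v + q v = r v}. mono_sign n p q * f p x * g q x else 0),
     gone = (\<lambda>p x. if p = (\<lambda>v. 0) \<and> x \<in> U then 1 else 0)\<rparr>"

definition model :: "(int \<Rightarrow> nat) \<Rightarrow> (point, power_series) alg_psh" where
  "model n = \<lparr>sec = model_alg n, res = (\<lambda>U V d f p x. if x \<in> V then f p x else 0)\<rparr>"

text \<open>Transport along a homeomorphism \<open>\<phi>\<close>: the value on \<open>W\<close> is that on the image of \<open>W\<close>.\<close>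

definition psh_transport :: "('p \<Rightarrow> 'q) \<Rightarrow> ('q,'a,'o) psh \<Rightarrow> ('p,'a,'o) psh" where
  "psh_transport \<phi> F = \<lparr>sec = (\<lambda>W. sec F (\<phi> ` W)), res = (\<lambda>W W'. res F (\<phi> ` W) (\<phi> ` W'))\<rparr>"

definition graded_chart ::
  "(int \<Rightarrow> nat) \<Rightarrow> 'p topology \<Rightarrow> ('p,'a) alg_psh \<Rightarrow> 'p set \<Rightarrow> ('p \<Rightarrow> point)
     \<Rightarrow> ('p set \<Rightarrow> int \<Rightarrow> 'a \<Rightarrow> power_series) \<Rightarrow> bool" where
  "graded_chart n X C V \<phi> \<alpha> \<longleftrightarrow> openin X V \<and> openin (Euclidean_space (n 0)) (\<phi> ` V) \<and>
     homeomorphic_map (subtopology X V) (subtopology (Euclidean_space (n 0)) (\<phi> ` V)) \<phi> \<and>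
     alg_iso (subtopology X V) C (psh_transport \<phi> (model n)) \<alpha>"

definition graded_manifold :: "(int \<Rightarrow> nat) \<Rightarrow> 'p topology \<Rightarrow> ('p,'a) alg_psh \<Rightarrow> bool" where
  "graded_manifold n X C \<longleftrightarrow> second_countable X \<and> Hausdorff_space X \<and> algebra_sheaf X C \<and>
     finite {j. n j \<noteq> 0} \<and>
     (\<forall>m\<in>topspace X. \<exists>V \<phi> \<alpha>. m \<in> V \<and> graded_chart n X C V \<phi> \<alpha>)"

text \<open>The value \<open>f(a)\<close> of the body of \<open>f\<close>, a function of degree \<open>d\<close> over \<open>U\<close>: the coefficient of the
  trivial monomial in any chart around \<open>a\<close> (charts all give the same value). It is 0 for \<open>d \<noteq> 0\<close>, as
  the trivial monomial has degree 0.\<close>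

definition body_value ::
  "(int \<Rightarrow> nat) \<Rightarrow> 'p topology \<Rightarrow> ('p,'a) alg_psh \<Rightarrow> 'p set \<Rightarrow> int \<Rightarrow> 'a \<Rightarrow> 'p \<Rightarrow> real" where
  "body_value n X C U d f a = (THE r. \<forall>V \<phi> \<alpha>. graded_chart n X C V \<phi> \<alpha> \<and> a \<in> V \<longrightarrow>
     \<alpha> (U \<inter> V) d (res C U (U \<inter> V) d f) (\<lambda>v. 0) (\<phi> a) = r)"


section \<open>Graded vector bundles\<close>

definition const_tensor ::
  "('p,'a) alg_psh \<Rightarrow> ('k,'z) gvs_scheme \<Rightarrow> ('p, 'a, ('a,'k) free_tensor set) mod_psh" where
  "const_tensor C K = \<lparr>sec = (\<lambda>U. tensor_module (sec C U) K),
     res = (\<lambda>U V d. tens_map (sec C V) K d (res C U V) (\<lambda>j y. y))\<rparr>"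

text \<open>\<open>E\<close> is the sheaf of sections, \<open>K\<close> the typical fibre.\<close>

definition graded_vector_bundle ::
  "'p topology \<Rightarrow> ('p,'a) alg_psh \<Rightarrow> 'k gvs \<Rightarrow> ('p,'a,'b) mod_psh \<Rightarrow> bool" where
  "graded_vector_bundle X C K E \<longleftrightarrow> module_sheaf X C E \<and> finite_dim_gvs K \<and>
     (\<forall>m\<in>topspace X. \<exists>V \<tau>. openin X V \<and> m \<in> V \<and>
        mod_iso (subtopology X V) C E (const_tensor C K) \<tau>)"

text \<open>Isomorphisms over the identity, given by their action on sections.\<close>

definition graded_vector_bundle_iso ::
  "'p topology \<Rightarrow> ('p,'a) alg_psh \<Rightarrow> 'k gvs \<Rightarrow> ('p,'a,'b) mod_psh \<Rightarrow> 'l gvs \<Rightarrow> ('p,'a,'c) mod_psh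
     \<Rightarrow> ('p set \<Rightarrow> int \<Rightarrow> 'b \<Rightarrow> 'c) \<Rightarrow> bool" where
  "graded_vector_bundle_iso X C K E K' E' \<alpha> \<longleftrightarrow>
     graded_vector_bundle X C K E \<and> graded_vector_bundle X C K' E' \<and> mod_iso X C E E' \<alpha>"


section \<open>Geometrization\<close>

definition vanishing_ideal ::
  "(int \<Rightarrow> nat) \<Rightarrow> 'p topology \<Rightarrow> ('p,'a) alg_psh \<Rightarrow> 'p set \<Rightarrow> 'p \<Rightarrow> int \<Rightarrow> 'a set" where
  "vanishing_ideal n X C U a d = {f \<in> gcarrier (sec C U) d. body_value n X C U d f a = 0}"

primrec ideal_power :: "'a galg \<Rightarrow> (int \<Rightarrow> 'a set) \<Rightarrow> nat \<Rightarrow> int \<Rightarrow> 'a set" where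
  "ideal_power A I 0 = gcarrier A"
| "ideal_power A I (Suc q) = (\<lambda>d. rspan (grade A d)
     {gmult A p (d - p) f g | p f g. f \<in> I p \<and> g \<in> ideal_power A I q (d - p)})"

definition ideal_times_module :: "(int \<Rightarrow> 'a set) \<Rightarrow> ('a,'b) gmod \<Rightarrow> int \<Rightarrow> 'b set" where
  "ideal_times_module I P d = rspan (grade P d)
     {gact P p (d - p) f x | p f x. f \<in> I p \<and> x \<in> gcarrier P (d - p)}"

definition invisible ::
  "(int \<Rightarrow> nat) \<Rightarrow> 'p topology \<Rightarrow> ('p,'a) alg_psh \<Rightarrow> 'p set \<Rightarrow> ('a,'b) gmod \<Rightarrow> int \<Rightarrow> 'b set" where
  "invisible n X C U P d = {x \<in> gcarrier P d. \<forall>q. \<forall>a\<in>U.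
     x \<in> ideal_times_module (ideal_power (sec C U) (vanishing_ideal n X C U a) q) P d}"

definition Geo ::
  "(int \<Rightarrow> nat) \<Rightarrow> 'p topology \<Rightarrow> ('p,'a) alg_psh \<Rightarrow> ('p,'a,'b) mod_psh \<Rightarrow> ('p,'a,'b set) mod_psh" where
  "Geo n X C F = \<lparr>sec = (\<lambda>U. gmod_quot (sec F U) (invisible n X C U (sec F U))),
     res = (\<lambda>U V d. quot_map (grade (sec F V) d) (invisible n X C V (sec F V) d) (res F U V d))\<rparr>"

definition geo_class ::
  "(int \<Rightarrow> nat) \<Rightarrow> 'p topology \<Rightarrow> ('p,'a) alg_psh \<Rightarrow> ('p,'a,'b) mod_psh
     \<Rightarrow> 'p set \<Rightarrow> int \<Rightarrow> 'b \<Rightarrow> 'b set" where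
  "geo_class n X C F U d x = invisible n X C U (sec F U) d +>\<^bsub>grade (sec F U) d\<^esub> x"


section \<open>Sheafification\<close>

text \<open>\<open>germ X F d U x m\<close> is the germ at \<open>m\<close> of \<open>x\<close>, a section of degree \<open>d\<close> over \<open>U\<close>, as the set of
  all its representatives.\<close>

definition germ ::
  "'p topology \<Rightarrow> ('p,'a,('a,'z) gvs_scheme) psh \<Rightarrow> int \<Rightarrow> 'p set \<Rightarrow> 'a \<Rightarrow> 'p \<Rightarrow> ('p set \<times> 'a) set" where
  "germ X F d U x m = {(V, y). openin X V \<and> m \<in> V \<and> y \<in> gcarrier (sec F V) d \<and>
     (\<exists>W. openin X W \<and> m \<in> W \<and> W \<subseteq> U \<inter> V \<and> res F U W d x = res F V W d y)}"

text \<open>Sections over \<open>U\<close> are the families of germs at the points of \<open>U\<close> that locally come from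
  sections of \<open>F\<close>; they are set to \<open>{}\<close> outside \<open>U\<close>. The operations on germs are computed on common
  representatives; each union below is a single germ.\<close>

definition sheafify_grade ::
  "'p topology \<Rightarrow> ('p,'a,('a,'z) gvs_scheme) psh \<Rightarrow> 'p set \<Rightarrow> int
     \<Rightarrow> (real, 'p \<Rightarrow> ('p set \<times> 'a) set) module" where
  "sheafify_grade X F U d = \<lparr>
     carrier = {s. (\<forall>m. m \<notin> U \<longrightarrow> s m = {}) \<and>
        (\<forall>m\<in>U. \<exists>V x. openin X V \<and> m \<in> V \<and> V \<subseteq> U \<and> x \<in> gcarrier (sec F V) d \<and>
           (\<forall>m'\<in>V. s m' = germ X F d V x m'))},
     mult = undefined, one = undefined,
     zero = (\<lambda>m. if m \<in> U then germ X F d U \<zero>\<^bsub>grade (sec F U) d\<^esub> m else {}),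
     add = (\<lambda>s t m. \<Union>{germ X F d W (x \<oplus>\<^bsub>grade (sec F W) d\<^esub> y) m | W x y.
        (W, x) \<in> s m \<and> (W, y) \<in> t m}),
     smult = (\<lambda>r s m. \<Union>{germ X F d W (r \<odot>\<^bsub>grade (sec F W) d\<^esub> x) m | W x. (W, x) \<in> s m})\<rparr>"

definition sheafify ::
  "'p topology \<Rightarrow> ('p,'a) alg_psh \<Rightarrow> ('p,'a,'b) mod_psh
     \<Rightarrow> ('p, 'a, 'p \<Rightarrow> ('p set \<times> 'b) set) mod_psh" where
  "sheafify X C F = \<lparr>
     sec = (\<lambda>U. \<lparr>grade = sheafify_grade X F U,
        gact = (\<lambda>p d f s m. \<Union>{germ X F (p + d) W (gact (sec F W) p d (res C U W p f) x) m | W x.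
           W \<subseteq> U \<and> (W, x) \<in> s m})\<rparr>),
     res = (\<lambda>U V d s m. if m \<in> V then s m else {})\<rparr>"

definition sff ::
  "'p topology \<Rightarrow> ('p,'a,('a,'z) gvs_scheme) psh \<Rightarrow> 'p set \<Rightarrow> int \<Rightarrow> 'a \<Rightarrow> 'p \<Rightarrow> ('p set \<times> 'a) set" where
  "sff X F U d x = (\<lambda>m. if m \<in> U then germ X F d U x m else {})"


section \<open>Jets\<close>

definition tensor_psh ::
  "('p,'a) alg_psh \<Rightarrow> ('p,'a,'b) mod_psh \<Rightarrow> ('p, 'a, ('a,'b) free_tensor set) mod_psh" where
  "tensor_psh C E = \<lparr>sec = (\<lambda>U. tensor_module (sec C U) (sec E U)),
     res = (\<lambda>U V d. tens_map (sec C V) (sec E V) d (res C U V) (res E U V))\<rparr>"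

definition jet_delta ::
  "'a galg \<Rightarrow> ('a,'b) gmod \<Rightarrow> int \<Rightarrow> int \<Rightarrow> 'a
     \<Rightarrow> ('a,'b) free_tensor set \<Rightarrow> ('a,'b) free_tensor set" where
  "jet_delta A Q p d f x = left_act A Q p d f x \<ominus>\<^bsub>gtensor A Q (p + d)\<^esub> right_act A Q p d f x"

text \<open>\<open>delta_tensors A Q l d\<close> contains the elements of degree \<open>d\<close> obtained from pure tensors by
  applying \<open>l\<close> operators \<^const>\<open>jet_delta\<close>.\<close>

primrec delta_tensors ::
  "'a galg \<Rightarrow> ('a,'b) gmod \<Rightarrow> nat \<Rightarrow> int \<Rightarrow> ('a,'b) free_tensor set set" where
  "delta_tensors A Q 0 = (\<lambda>d. {tens A Q d i g \<psi> | i g \<psi>. g \<in> gcarrier A i \<and> \<psi> \<in> gcarrier Q (d - i)})"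
| "delta_tensors A Q (Suc l) = (\<lambda>d. {jet_delta A Q p (d - p) f x | p f x.
     f \<in> gcarrier A p \<and> x \<in> delta_tensors A Q l (d - p)})"

definition jet_rels ::
  "'a galg \<Rightarrow> ('a,'b) gmod \<Rightarrow> nat \<Rightarrow> int \<Rightarrow> ('a,'b) free_tensor set set" where
  "jet_rels A Q k d = rspan (gtensor A Q d) (delta_tensors A Q (k + 1) d)"

definition pJet ::
  "('p,'a) alg_psh \<Rightarrow> ('p,'a,'b) mod_psh \<Rightarrow> nat
     \<Rightarrow> ('p, 'a, ('a,'b) free_tensor set set) mod_psh" where
  "pJet C E k = \<lparr>
     sec = (\<lambda>U. gmod_quot (sec (tensor_psh C E) U) (jet_rels (sec C U) (sec E U) k)),
     res = (\<lambda>U V d. quot_map (gtensor (sec C V) (sec E V) d) (jet_rels (sec C V) (sec E V) k d)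
        (res (tensor_psh C E) U V d))\<rparr>"

text \<open>\<open>pjet_class C E k U d i g \<psi>\<close> is the class \<open>g \<otimes>\<^sub>(\<^sub>k\<^sub>) \<psi>\<close> for \<open>|g| = i\<close> and \<open>|\<psi>| = d - i\<close>.\<close>

definition pjet_class ::
  "('p,'a) alg_psh \<Rightarrow> ('p,'a,'b) mod_psh \<Rightarrow> nat \<Rightarrow> 'p set \<Rightarrow> int \<Rightarrow> int \<Rightarrow> 'a \<Rightarrow> 'b
     \<Rightarrow> ('a,'b) free_tensor set set" where
  "pjet_class C E k U d i g \<psi> = jet_rels (sec C U) (sec E U) k d
     +>\<^bsub>gtensor (sec C U) (sec E U) d\<^esub> tens (sec C U) (sec E U) d i g \<psi>"

definition gpJet ::
  "(int \<Rightarrow> nat) \<Rightarrow> 'p topology \<Rightarrow> ('p,'a) alg_psh \<Rightarrow> ('p,'a,'b) mod_psh \<Rightarrow> nat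
     \<Rightarrow> ('p, 'a, ('a,'b) free_tensor set set set) mod_psh" where
  "gpJet n X C E k = Geo n X C (pJet C E k)"

type_synonym ('p,'a,'b) jet = "'p \<Rightarrow> ('p set \<times> ('a,'b) free_tensor set set set) set"

definition Jet ::
  "(int \<Rightarrow> nat) \<Rightarrow> 'p topology \<Rightarrow> ('p,'a) alg_psh \<Rightarrow> ('p,'a,'b) mod_psh \<Rightarrow> nat
     \<Rightarrow> ('p, 'a, ('p,'a,'b) jet) mod_psh" where
  "Jet n X C E k = sheafify X C (gpJet n X C E k)"

definition jet_prolongation ::
  "(int \<Rightarrow> nat) \<Rightarrow> 'p topology \<Rightarrow> ('p,'a) alg_psh \<Rightarrow> ('p,'a,'b) mod_psh \<Rightarrow> nat
     \<Rightarrow> 'p set \<Rightarrow> int \<Rightarrow> 'b \<Rightarrow> ('p,'a,'b) jet" where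
  "jet_prolongation n X C E k U d \<psi> = sff X (gpJet n X C E k) U d
     (geo_class n X C (pJet C E k) U d (pjet_class C E k U d 0 (gone (sec C U)) \<psi>))"

end

theory Submission
  imports Defs
begin

text \<open>
  The jet prolongation of order 0 is a composite of three maps, and each of them is an isomorphism.

  First, the action \<open>g \<otimes> \<psi> \<mapsto> g \<cdot> \<psi>\<close> kills every \<open>\<delta>\<^sub>f (g \<otimes> \<psi>)\<close> by graded commutativity, and
  \<open>g \<otimes> \<psi> - 1 \<otimes> (g \<cdot> \<psi>) = \<delta>\<^sub>g (1 \<otimes> \<psi>)\<close>. The relations imposed on jets of order 0 therefore form the
  kernel of the action (\<open>jet_rels_0\<close>), and mapping \<open>\<psi>\<close> to the class of \<open>1 \<otimes> \<psi>\<close> identifies the sections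
  of the bundle with the presheaf jets (\<open>pJet_0_copy\<close>).

  Secondly, geometrization changes nothing, because a section of a graded vector bundle that lies in
  all products of the module of sections with powers of vanishing ideals is zero
  (\<open>invisible_bundle\<close>). Locally such a section is a tensor of functions and vectors of the fibre. A
  product of \<open>q\<close> functions vanishing at \<open>a\<close> has no terms of order below \<open>q\<close> in the formal variables
  at \<open>a\<close> (\<open>ideal_power_coeff\<close>), so all coefficients of the section vanish at all points; and a tensor
  is zero if its contractions with a separating family of functionals on the first factor are
  (\<open>contractions_separate\<close>). The value of a function at a point is defined by arbitrary charts, and it
  has to be shown that they agree (\<open>body_chart_independent\<close>). They do because the value \<open>s\<close> of a
  function \<open>f\<close> of degree 0 at a point is the only real number for which \<open>f - s\<close> is not invertible near
  that point. This uses that a power series of degree 0 whose body has no zeros is invertible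
  (\<open>series_inverse\<close>).

  Thirdly, a sheaf coincides with its sheafification (\<open>sheafify_copy\<close>).

  In each step the target is known at first only as a family of sets with operations. The source is a
  sheaf of modules, and its axioms are carried over along the bijection (\<open>module_sheaf_transport\<close>).
  Local trivializations of the bundle, composed with the inverse of the jet prolongation, trivialize the
  sheaf of jets.
\<close>

section \<open>Real vector spaces in carrier form\<close>

lemma real_ring_simps [simp]:
  "carrier real_ring = UNIV" "mult real_ring = (*)" "one real_ring = 1"
  "zero real_ring = 0" "add real_ring = (+)"
  by (auto simp: real_ring_def)

lemma real_ring_cring: "cring real_ring"
proof (rule cringI)
  show "abelian_group real_ring"
  proof (rule abelian_groupI)
    fix x assume "x \<in> carrier real_ring"
    show "\<exists>y\<in>carrier real_ring. y \<oplus>\<^bsub>real_ring\<^esub> x = \<zero>\<^bsub>real_ring\<^esub>"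
      by (rule bexI[of _ "- x"]) auto
  qed (auto simp: algebra_simps)
  show "comm_monoid real_ring"
    by (rule comm_monoidI) (auto simp: algebra_simps)
qed (auto simp: algebra_simps)

text \<open>A real vector space given by its carrier and operations.\<close>

abbreviation rmodule :: "(real,'a) module \<Rightarrow> bool" where
  "rmodule M \<equiv> Module.module real_ring M"

lemma rmoduleI:
  assumes "\<And>x y. x \<in> carrier M \<Longrightarrow> y \<in> carrier M \<Longrightarrow> x \<oplus>\<^bsub>M\<^esub> y \<in> carrier M"
    and "\<zero>\<^bsub>M\<^esub> \<in> carrier M"
    and "\<And>r x. x \<in> carrier M \<Longrightarrow> r \<odot>\<^bsub>M\<^esub> x \<in> carrier M"
    and "\<And>x y z. x \<in> carrier M \<Longrightarrow> y \<in> carrier M \<Longrightarrow> z \<in> carrier M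
           \<Longrightarrow> (x \<oplus>\<^bsub>M\<^esub> y) \<oplus>\<^bsub>M\<^esub> z = x \<oplus>\<^bsub>M\<^esub> (y \<oplus>\<^bsub>M\<^esub> z)"
    and "\<And>x y. x \<in> carrier M \<Longrightarrow> y \<in> carrier M \<Longrightarrow> x \<oplus>\<^bsub>M\<^esub> y = y \<oplus>\<^bsub>M\<^esub> x"
    and "\<And>x. x \<in> carrier M \<Longrightarrow> \<zero>\<^bsub>M\<^esub> \<oplus>\<^bsub>M\<^esub> x = x"
    and neg: "\<And>x. x \<in> carrier M \<Longrightarrow> (-1) \<odot>\<^bsub>M\<^esub> x \<oplus>\<^bsub>M\<^esub> x = \<zero>\<^bsub>M\<^esub>"
    and "\<And>r s x. x \<in> carrier M \<Longrightarrow> (r + s) \<odot>\<^bsub>M\<^esub> x = r \<odot>\<^bsub>M\<^esub> x \<oplus>\<^bsub>M\<^esub> s \<odot>\<^bsub>M\<^esub> x"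
    and "\<And>r x y. x \<in> carrier M \<Longrightarrow> y \<in> carrier M
           \<Longrightarrow> r \<odot>\<^bsub>M\<^esub> (x \<oplus>\<^bsub>M\<^esub> y) = r \<odot>\<^bsub>M\<^esub> x \<oplus>\<^bsub>M\<^esub> r \<odot>\<^bsub>M\<^esub> y"
    and "\<And>r s x. x \<in> carrier M \<Longrightarrow> (r * s) \<odot>\<^bsub>M\<^esub> x = r \<odot>\<^bsub>M\<^esub> (s \<odot>\<^bsub>M\<^esub> x)"
    and "\<And>x. x \<in> carrier M \<Longrightarrow> 1 \<odot>\<^bsub>M\<^esub> x = x"
  shows "rmodule M"
proof (rule moduleI[OF real_ring_cring])
  show "abelian_group M"
  proof (rule abelian_groupI)
    show "\<exists>y\<in>carrier M. y \<oplus>\<^bsub>M\<^esub> x = \<zero>\<^bsub>M\<^esub>" if "x \<in> carrier M" for x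
      using neg[OF that] assms(3)[OF that] by blast
  qed (rule assms; assumption)+
qed (use assms in auto)

lemma rmodule_closed [simp]:
  assumes "rmodule M"
  shows "x \<in> carrier M \<Longrightarrow> y \<in> carrier M \<Longrightarrow> x \<oplus>\<^bsub>M\<^esub> y \<in> carrier M"
    and "\<zero>\<^bsub>M\<^esub> \<in> carrier M"
    and "x \<in> carrier M \<Longrightarrow> r \<odot>\<^bsub>M\<^esub> x \<in> carrier M"
    and "x \<in> carrier M \<Longrightarrow> y \<in> carrier M \<Longrightarrow> x \<ominus>\<^bsub>M\<^esub> y \<in> carrier M"
proof -
  interpret M: Module.module real_ring M by fact
  show "x \<in> carrier M \<Longrightarrow> y \<in> carrier M \<Longrightarrow> x \<oplus>\<^bsub>M\<^esub> y \<in> carrier M"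
    and "\<zero>\<^bsub>M\<^esub> \<in> carrier M"
    and "x \<in> carrier M \<Longrightarrow> r \<odot>\<^bsub>M\<^esub> x \<in> carrier M"
    and "x \<in> carrier M \<Longrightarrow> y \<in> carrier M \<Longrightarrow> x \<ominus>\<^bsub>M\<^esub> y \<in> carrier M"
    by auto
qed

lemma rmodule_smult:
  assumes "rmodule M" "x \<in> carrier M"
  shows "(r + s) \<odot>\<^bsub>M\<^esub> x = r \<odot>\<^bsub>M\<^esub> x \<oplus>\<^bsub>M\<^esub> s \<odot>\<^bsub>M\<^esub> x"
    and "(r * s) \<odot>\<^bsub>M\<^esub> x = r \<odot>\<^bsub>M\<^esub> (s \<odot>\<^bsub>M\<^esub> x)"
    and "1 \<odot>\<^bsub>M\<^esub> x = x"
    and "0 \<odot>\<^bsub>M\<^esub> x = \<zero>\<^bsub>M\<^esub>"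
    and "r \<odot>\<^bsub>M\<^esub> \<zero>\<^bsub>M\<^esub> = \<zero>\<^bsub>M\<^esub>"
    and "y \<in> carrier M \<Longrightarrow> r \<odot>\<^bsub>M\<^esub> (x \<oplus>\<^bsub>M\<^esub> y) = r \<odot>\<^bsub>M\<^esub> x \<oplus>\<^bsub>M\<^esub> r \<odot>\<^bsub>M\<^esub> y"
proof -
  interpret M: Module.module real_ring M by fact
  show "(r + s) \<odot>\<^bsub>M\<^esub> x = r \<odot>\<^bsub>M\<^esub> x \<oplus>\<^bsub>M\<^esub> s \<odot>\<^bsub>M\<^esub> x"
    using M.smult_l_distr[of r s x] assms by simp
  show "(r * s) \<odot>\<^bsub>M\<^esub> x = r \<odot>\<^bsub>M\<^esub> (s \<odot>\<^bsub>M\<^esub> x)"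
    using M.smult_assoc1[of r s x] assms by simp
  show "1 \<odot>\<^bsub>M\<^esub> x = x" using M.smult_one[of x] assms by simp
  show "0 \<odot>\<^bsub>M\<^esub> x = \<zero>\<^bsub>M\<^esub>" using M.smult_l_null[of x] assms by simp
  show "r \<odot>\<^bsub>M\<^esub> \<zero>\<^bsub>M\<^esub> = \<zero>\<^bsub>M\<^esub>" using M.smult_r_null[of r] assms by simp
  show "y \<in> carrier M \<Longrightarrow> r \<odot>\<^bsub>M\<^esub> (x \<oplus>\<^bsub>M\<^esub> y) = r \<odot>\<^bsub>M\<^esub> x \<oplus>\<^bsub>M\<^esub> r \<odot>\<^bsub>M\<^esub> y"
    using M.smult_r_distr[of r x y] assms by simp
qed

lemma rmodule_minus_eq:
  assumes "rmodule M" "x \<in> carrier M" "y \<in> carrier M"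
  shows "x \<ominus>\<^bsub>M\<^esub> y = x \<oplus>\<^bsub>M\<^esub> (-1) \<odot>\<^bsub>M\<^esub> y"
proof -
  interpret M: Module.module real_ring M by fact
  have "(-1) \<odot>\<^bsub>M\<^esub> y \<oplus>\<^bsub>M\<^esub> y = \<zero>\<^bsub>M\<^esub>"
    using rmodule_smult(1)[OF assms(1,3), of "-1" 1] assms
    by (simp add: rmodule_smult)
  then have "\<ominus>\<^bsub>M\<^esub> y = (-1) \<odot>\<^bsub>M\<^esub> y"
    by (metis M.minus_equality assms(1,3) rmodule_closed(3))
  then show ?thesis by (simp add: M.minus_eq)
qed

lemma rmodule_diff_eq_zero:
  assumes "rmodule M" "x \<in> carrier M" "y \<in> carrier M"
  shows "x \<ominus>\<^bsub>M\<^esub> y = \<zero>\<^bsub>M\<^esub> \<longleftrightarrow> x = y"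
proof -
  interpret M: Module.module real_ring M by fact
  show ?thesis
    using M.add.inv_equality[of x "\<ominus>\<^bsub>M\<^esub> y"] assms by (auto simp: M.minus_eq M.r_neg)
qed

lemma rmodule_smult_commute:
  assumes "rmodule M" "x \<in> carrier M"
  shows "r \<odot>\<^bsub>M\<^esub> (s \<odot>\<^bsub>M\<^esub> x) = s \<odot>\<^bsub>M\<^esub> (r \<odot>\<^bsub>M\<^esub> x)"
  using assms by (metis mult.commute rmodule_smult(2))

lemma rsubmoduleI:
  assumes M: "rmodule M" and sub: "H \<subseteq> carrier M" and "\<zero>\<^bsub>M\<^esub> \<in> H"
    and "\<And>x y. x \<in> H \<Longrightarrow> y \<in> H \<Longrightarrow> x \<oplus>\<^bsub>M\<^esub> y \<in> H"
    and smult: "\<And>r x. x \<in> H \<Longrightarrow> r \<odot>\<^bsub>M\<^esub> x \<in> H"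
  shows "submodule H real_ring M"
proof -
  interpret M: Module.module real_ring M by fact
  show ?thesis
  proof (rule M.submoduleI)
    fix a assume a: "a \<in> H"
    have "\<ominus>\<^bsub>M\<^esub> a = \<zero>\<^bsub>M\<^esub> \<ominus>\<^bsub>M\<^esub> a" using a sub by (auto simp: M.minus_eq)
    also have "\<dots> = (-1) \<odot>\<^bsub>M\<^esub> a"
      using rmodule_minus_eq[OF M, of "\<zero>\<^bsub>M\<^esub>" a] a sub M by auto
    finally show "\<ominus>\<^bsub>M\<^esub> a \<in> H" using smult a by simp
  qed (use assms in auto)
qed

lemma rsubmodule_simps:
  assumes "rmodule M" "submodule H real_ring M"
  shows "H \<subseteq> carrier M" "\<zero>\<^bsub>M\<^esub> \<in> H"
    and "x \<in> H \<Longrightarrow> y \<in> H \<Longrightarrow> x \<oplus>\<^bsub>M\<^esub> y \<in> H"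
    and "x \<in> H \<Longrightarrow> r \<odot>\<^bsub>M\<^esub> x \<in> H"
    and "x \<in> H \<Longrightarrow> y \<in> H \<Longrightarrow> x \<ominus>\<^bsub>M\<^esub> y \<in> H"
proof -
  interpret M: Module.module real_ring M by fact
  interpret H: submodule H real_ring M by fact
  show "H \<subseteq> carrier M" and z: "\<zero>\<^bsub>M\<^esub> \<in> H"
    using H.subset H.one_closed by auto
  show *: "x \<oplus>\<^bsub>M\<^esub> y \<in> H" if "x \<in> H" "y \<in> H" for x y
    using H.m_closed[OF that] by auto
  show **: "r \<odot>\<^bsub>M\<^esub> x \<in> H" if "x \<in> H" for r x using H.smult_closed[of r x] that by auto
  show "x \<ominus>\<^bsub>M\<^esub> y \<in> H" if "x \<in> H" "y \<in> H" for x y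
    using rmodule_minus_eq[OF assms(1), of x y] *[OF that(1) **[OF that(2), of "-1"]]
      that M.submoduleE(1)[OF assms(2)] by (metis subsetD)
qed

lemma rsubmodule_self: "rmodule M \<Longrightarrow> submodule (carrier M) real_ring M"
  by (rule rsubmoduleI) auto

lemma rsubmodule_zero: "rmodule M \<Longrightarrow> submodule {\<zero>\<^bsub>M\<^esub>} real_ring M"
  using rmodule_smult(5)[of M "\<zero>\<^bsub>M\<^esub>"] rmodule_smult(1)[of M "\<zero>\<^bsub>M\<^esub>" 0 0]
  by (intro rsubmoduleI) auto


subsection \<open>Linear maps\<close>

lemma rlinearI:
  assumes "\<And>x. x \<in> carrier M \<Longrightarrow> f x \<in> carrier N"
    and "\<And>x y. x \<in> carrier M \<Longrightarrow> y \<in> carrier M \<Longrightarrow> f (x \<oplus>\<^bsub>M\<^esub> y) = f x \<oplus>\<^bsub>N\<^esub> f y"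
    and "\<And>r x. x \<in> carrier M \<Longrightarrow> f (r \<odot>\<^bsub>M\<^esub> x) = r \<odot>\<^bsub>N\<^esub> f x"
  shows "rlinear M N f"
  using assms by (auto simp: rlinear_def)

lemma rlinearD:
  assumes "rlinear M N f"
  shows "x \<in> carrier M \<Longrightarrow> f x \<in> carrier N"
    and "x \<in> carrier M \<Longrightarrow> y \<in> carrier M \<Longrightarrow> f (x \<oplus>\<^bsub>M\<^esub> y) = f x \<oplus>\<^bsub>N\<^esub> f y"
    and "x \<in> carrier M \<Longrightarrow> f (r \<odot>\<^bsub>M\<^esub> x) = r \<odot>\<^bsub>N\<^esub> f x"
  using assms by (auto simp: rlinear_def)

lemma rlinear_zero:
  assumes "rmodule M" "rmodule N" "rlinear M N f"
  shows "f \<zero>\<^bsub>M\<^esub> = \<zero>\<^bsub>N\<^esub>"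
proof -
  have "f (0 \<odot>\<^bsub>M\<^esub> \<zero>\<^bsub>M\<^esub>) = 0 \<odot>\<^bsub>N\<^esub> f \<zero>\<^bsub>M\<^esub>"
    using assms by (intro rlinearD(3)[OF assms(3)]) auto
  with assms show ?thesis
    by (simp add: rmodule_smult rlinearD(1))
qed

lemma rlinear_minus:
  assumes "rmodule M" "rmodule N" "rlinear M N f" "x \<in> carrier M" "y \<in> carrier M"
  shows "f (x \<ominus>\<^bsub>M\<^esub> y) = f x \<ominus>\<^bsub>N\<^esub> f y"
  using assms by (simp add: rmodule_minus_eq rlinearD)

lemma rlinear_id: "rlinear M M (\<lambda>x. x)"
  by (auto simp: rlinear_def)

lemma rlinear_comp:
  assumes "rlinear M N f" "rlinear N P g"
  shows "rlinear M P (\<lambda>x. g (f x))"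
  using assms by (intro rlinearI) (auto simp: rlinearD)

lemma rlinear_smult:
  assumes "rmodule N" "rlinear M N f"
  shows "rlinear M N (\<lambda>x. r \<odot>\<^bsub>N\<^esub> f x)"
  using assms by (intro rlinearI) (auto simp: rlinearD rmodule_smult intro: rmodule_smult_commute)

lemma rlinear_diff:
  assumes "rmodule N" "rlinear M N f" "rlinear M N g"
  shows "rlinear M N (\<lambda>x. f x \<ominus>\<^bsub>N\<^esub> g x)"
proof -
  interpret N: Module.module real_ring N by fact
  show ?thesis
  proof (rule rlinearI)
    fix x y assume "x \<in> carrier M" "y \<in> carrier M"
    then show "f (x \<oplus>\<^bsub>M\<^esub> y) \<ominus>\<^bsub>N\<^esub> g (x \<oplus>\<^bsub>M\<^esub> y) = f x \<ominus>\<^bsub>N\<^esub> g x \<oplus>\<^bsub>N\<^esub> (f y \<ominus>\<^bsub>N\<^esub> g y)"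
      using assms by (simp add: rlinearD rmodule_minus_eq rmodule_smult N.add.m_ac)
  next
    fix r x assume "x \<in> carrier M"
    then show "f (r \<odot>\<^bsub>M\<^esub> x) \<ominus>\<^bsub>N\<^esub> g (r \<odot>\<^bsub>M\<^esub> x) = r \<odot>\<^bsub>N\<^esub> (f x \<ominus>\<^bsub>N\<^esub> g x)"
      using assms by (simp add: rlinearD rmodule_minus_eq rmodule_smult rmodule_smult_commute[of N "g x"])
  qed (use assms in \<open>auto simp: rlinearD\<close>)
qed

lemma rlinear_const_zero:
  assumes "rmodule N"
  shows "rlinear M N (\<lambda>x. \<zero>\<^bsub>N\<^esub>)"
proof -
  interpret N: Module.module real_ring N by fact
  show ?thesis
    by (rule rlinearI) (auto simp: rmodule_smult(5)[OF assms])
qed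

lemma rlinear_vimage_submodule:
  assumes "rmodule M" "rmodule N" "rlinear M N f" "submodule H real_ring N"
  shows "submodule {x \<in> carrier M. f x \<in> H} real_ring M"
  using assms
  by (intro rsubmoduleI) (auto simp: rlinearD rlinear_zero rsubmodule_simps)

lemma rlinear_kernel_submodule:
  assumes "rmodule M" "rmodule N" "rlinear M N f"
  shows "submodule {x \<in> carrier M. f x = \<zero>\<^bsub>N\<^esub>} real_ring M"
  using rlinear_vimage_submodule[OF assms rsubmodule_zero[OF assms(2)]] by simp

lemma rlinear_equalizer_submodule:
  assumes "rmodule M" "rmodule N" "rlinear M N f" "rlinear M N g"
  shows "submodule {x \<in> carrier M. f x = g x} real_ring M"
  using assms
  by (intro rsubmoduleI) (auto simp: rlinearD rlinear_zero)


subsection \<open>Linear span\<close>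

lemma rspan_base: "x \<in> S \<Longrightarrow> x \<in> rspan M S"
  by (auto simp: rspan_def)

lemma rspan_least: "submodule N real_ring M \<Longrightarrow> S \<subseteq> N \<Longrightarrow> rspan M S \<subseteq> N"
  by (auto simp: rspan_def)

lemma rspan_subset:
  assumes "rmodule M" "S \<subseteq> carrier M"
  shows "rspan M S \<subseteq> carrier M"
  using rspan_least[OF rsubmodule_self] assms by blast

lemma rspan_submodule:
  assumes "rmodule M" "S \<subseteq> carrier M"
  shows "submodule (rspan M S) real_ring M"
proof (rule rsubmoduleI)
  show "rspan M S \<subseteq> carrier M" using assms by (rule rspan_subset)
qed (use assms in \<open>auto simp: rspan_def rsubmodule_simps\<close>)

lemma rspan_map:
  assumes "rmodule M" "rmodule N" "rlinear M N f" "S \<subseteq> carrier M" "T \<subseteq> carrier N"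
    and "\<And>x. x \<in> S \<Longrightarrow> f x \<in> rspan N T" and "x \<in> rspan M S"
  shows "f x \<in> rspan N T"
  using rspan_least[OF rlinear_vimage_submodule[OF assms(1-3) rspan_submodule[OF assms(2,5)]],
      of S] assms(4,6,7) by auto

lemma rlinear_eq_on_span:
  assumes "rmodule M" "rmodule N" "rlinear M N f" "rlinear M N g" "S \<subseteq> carrier M"
    and "\<And>x. x \<in> S \<Longrightarrow> f x = g x" and "x \<in> rspan M S"
  shows "f x = g x"
  using rspan_least[OF rlinear_equalizer_submodule[OF assms(1-4)], of S] assms(5-7) by auto

lemma rlinear_zero_on_span:
  assumes "rmodule M" "rmodule N" "rlinear M N f" "S \<subseteq> carrier M"
    and "\<And>x. x \<in> S \<Longrightarrow> f x = \<zero>\<^bsub>N\<^esub>" and "x \<in> rspan M S"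
  shows "f x = \<zero>\<^bsub>N\<^esub>"
  by (rule rlinear_eq_on_span[OF assms(1-3) rlinear_const_zero[OF assms(2)] assms(4-6)])


subsection \<open>Quotients\<close>

lemma rmodule_cosets:
  assumes M: "rmodule M" and W: "submodule W real_ring M"
  shows mquot_carrier: "carrier (mquot M W) = {W +>\<^bsub>M\<^esub> x | x. x \<in> carrier M}"
    and mquot_zero: "zero (mquot M W) = W"
    and coset_add: "x \<in> carrier M \<Longrightarrow> y \<in> carrier M \<Longrightarrow>
          (W +>\<^bsub>M\<^esub> x) \<oplus>\<^bsub>mquot M W\<^esub> (W +>\<^bsub>M\<^esub> y) = W +>\<^bsub>M\<^esub> (x \<oplus>\<^bsub>M\<^esub> y)"
    and coset_eq_iff: "x \<in> carrier M \<Longrightarrow> y \<in> carrier M \<Longrightarrow>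
          W +>\<^bsub>M\<^esub> x = W +>\<^bsub>M\<^esub> y \<longleftrightarrow> x \<ominus>\<^bsub>M\<^esub> y \<in> W"
    and coset_zero: "W +>\<^bsub>M\<^esub> \<zero>\<^bsub>M\<^esub> = W"
    and coset_self: "x \<in> carrier M \<Longrightarrow> x \<in> W +>\<^bsub>M\<^esub> x"
    and coset_memD: "x \<in> carrier M \<Longrightarrow> u \<in> W +>\<^bsub>M\<^esub> x \<Longrightarrow> u \<in> carrier M \<and> u \<ominus>\<^bsub>M\<^esub> x \<in> W"
proof -
  interpret M: Module.module real_ring M by fact
  interpret W: submodule W real_ring M by fact
  interpret A: abelian_subgroup W M
    by (rule abelian_subgroupI3)
      (auto intro: additive_subgroupI W.subgroup_axioms M.abelian_group_axioms)
  show "carrier (mquot M W) = {W +>\<^bsub>M\<^esub> x | x. x \<in> carrier M}"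
    by (auto simp: mquot_def A_RCOSETS_def')
  show "zero (mquot M W) = W" by (simp add: mquot_def)
  show "x \<in> carrier M \<Longrightarrow> y \<in> carrier M \<Longrightarrow>
          (W +>\<^bsub>M\<^esub> x) \<oplus>\<^bsub>mquot M W\<^esub> (W +>\<^bsub>M\<^esub> y) = W +>\<^bsub>M\<^esub> (x \<oplus>\<^bsub>M\<^esub> y)"
    using A.a_rcos_sum[of x y] by (simp add: mquot_def)
  show "W +>\<^bsub>M\<^esub> \<zero>\<^bsub>M\<^esub> = W" using A.a_subset by simp
  show self: "x \<in> carrier M \<Longrightarrow> x \<in> W +>\<^bsub>M\<^esub> x" for x using A.a_rcos_self by simp
  show mem: "u \<in> carrier M \<and> u \<ominus>\<^bsub>M\<^esub> x \<in> W" if "x \<in> carrier M" "u \<in> W +>\<^bsub>M\<^esub> x" for x u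
    using A.a_elemrcos_carrier A.a_rcos_module_imp that
    by (fastforce simp: a_minus_def)
  show "W +>\<^bsub>M\<^esub> x = W +>\<^bsub>M\<^esub> y \<longleftrightarrow> x \<ominus>\<^bsub>M\<^esub> y \<in> W"
    if "x \<in> carrier M" "y \<in> carrier M"
  proof
    assume "W +>\<^bsub>M\<^esub> x = W +>\<^bsub>M\<^esub> y"
    then show "x \<ominus>\<^bsub>M\<^esub> y \<in> W" using self mem that by blast
  next
    assume "x \<ominus>\<^bsub>M\<^esub> y \<in> W"
    then have "x \<in> W +>\<^bsub>M\<^esub> y"
      using A.a_rcos_module_rev that by (simp add: a_minus_def)
    then show "W +>\<^bsub>M\<^esub> x = W +>\<^bsub>M\<^esub> y"
      using A.a_repr_independence' that by metis
  qed
qed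

lemma coset_in_mquot:
  "rmodule M \<Longrightarrow> submodule W real_ring M \<Longrightarrow> x \<in> carrier M \<Longrightarrow> W +>\<^bsub>M\<^esub> x \<in> carrier (mquot M W)"
  by (auto simp: mquot_carrier)

text \<open>A linear map that respects the submodules divided out induces a linear map of the quotients.\<close>

lemma quot_map_coset:
  assumes M: "rmodule M" and N: "rmodule N" and W: "submodule W real_ring M"
    and W': "submodule W' real_ring N" and F: "rlinear M N F"
    and FW: "\<And>w. w \<in> W \<Longrightarrow> F w \<in> W'" and x: "x \<in> carrier M"
  shows "quot_map N W' F (W +>\<^bsub>M\<^esub> x) = W' +>\<^bsub>N\<^esub> F x"
proof -
  have "W' +>\<^bsub>N\<^esub> F u = W' +>\<^bsub>N\<^esub> F x" if "u \<in> W +>\<^bsub>M\<^esub> x" for u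
  proof -
    have "u \<in> carrier M" "u \<ominus>\<^bsub>M\<^esub> x \<in> W" using coset_memD[OF M W x that] by auto
    then have "F u \<ominus>\<^bsub>N\<^esub> F x \<in> W'" using FW rlinear_minus[OF M N F] x by metis
    then show ?thesis
      using coset_eq_iff[OF N W'] \<open>u \<in> carrier M\<close> x rlinearD(1)[OF F] by blast
  qed
  then show ?thesis
    using coset_self[OF M W x] unfolding quot_map_def by blast
qed

lemma coset_smult:
  assumes M: "rmodule M" and W: "submodule W real_ring M" and x: "x \<in> carrier M"
  shows "r \<odot>\<^bsub>mquot M W\<^esub> (W +>\<^bsub>M\<^esub> x) = W +>\<^bsub>M\<^esub> (r \<odot>\<^bsub>M\<^esub> x)"
proof -
  have "rlinear M M (\<lambda>u. r \<odot>\<^bsub>M\<^esub> u)"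
    using rlinear_smult[OF M, of M "\<lambda>u. u" r] by (auto simp: rlinear_def)
  then show ?thesis
    using quot_map_coset[OF M M W W, of "\<lambda>u. r \<odot>\<^bsub>M\<^esub> u" x] x rsubmodule_simps(4)[OF M W]
    by (simp add: mquot_def)
qed

lemma rmodule_mquot:
  assumes M: "rmodule M" and W: "submodule W real_ring M"
  shows "rmodule (mquot M W)"
proof -
  interpret M: Module.module real_ring M by fact
  have neg: "x \<oplus>\<^bsub>M\<^esub> (-1) \<odot>\<^bsub>M\<^esub> x = \<zero>\<^bsub>M\<^esub>" if "x \<in> carrier M" for x
    using rmodule_smult(1)[OF M that, of 1 "-1"] that by (simp add: rmodule_smult[OF M])
  have z: "zero (mquot M W) = W +>\<^bsub>M\<^esub> \<zero>\<^bsub>M\<^esub>"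
    using M W by (simp add: mquot_zero coset_zero)
  note simps = coset_add[OF M W] coset_smult[OF M W] rmodule_smult[OF M] M neg M.a_ac
  show ?thesis
    by (rule rmoduleI, unfold mquot_carrier[OF M W] z) (auto simp: simps)
qed

lemma rlinear_coset:
  "rmodule M \<Longrightarrow> submodule W real_ring M \<Longrightarrow> rlinear M (mquot M W) (\<lambda>x. W +>\<^bsub>M\<^esub> x)"
  by (intro rlinearI) (auto simp: coset_in_mquot coset_add coset_smult)

lemma quot_map_linear:
  assumes M: "rmodule M" and N: "rmodule N" and W: "submodule W real_ring M"
    and W': "submodule W' real_ring N" and F: "rlinear M N F"
    and FW: "\<And>w. w \<in> W \<Longrightarrow> F w \<in> W'"
  shows "rlinear (mquot M W) (mquot N W') (quot_map N W' F)"
proof (rule rlinearI)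
  note q = quot_map_coset[OF M N W W' F FW]
  fix r S T assume "S \<in> carrier (mquot M W)"
  then obtain x where x: "S = W +>\<^bsub>M\<^esub> x" "x \<in> carrier M" by (auto simp: mquot_carrier[OF M W])
  then show "quot_map N W' F S \<in> carrier (mquot N W')"
    and "quot_map N W' F (r \<odot>\<^bsub>mquot M W\<^esub> S) = r \<odot>\<^bsub>mquot N W'\<^esub> quot_map N W' F S"
    using rlinearD[OF F] M W N W' by (auto simp: q coset_smult coset_in_mquot)
  assume "T \<in> carrier (mquot M W)"
  then obtain y where y: "T = W +>\<^bsub>M\<^esub> y" "y \<in> carrier M" by (auto simp: mquot_carrier[OF M W])
  then show "quot_map N W' F (S \<oplus>\<^bsub>mquot M W\<^esub> T) = quot_map N W' F S \<oplus>\<^bsub>mquot N W'\<^esub> quot_map N W' F T"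
    using x rlinearD[OF F] M W N W' by (auto simp: q coset_add)
qed

lemma rlinear_factor_through_quotient:
  assumes M: "rmodule M" and N: "rmodule N" and W: "submodule W real_ring M" and F: "rlinear M N F"
    and "\<And>w. w \<in> W \<Longrightarrow> F w = \<zero>\<^bsub>N\<^esub>"
  obtains F' where "rlinear (mquot M W) N F'" "\<And>x. x \<in> carrier M \<Longrightarrow> F' (W +>\<^bsub>M\<^esub> x) = F x"
proof -
  \<comment> \<open>all representatives of a coset have the same value, so any choice will do\<close>
  define F' where "F' S = F (SOME u. u \<in> S)" for S
  have F': "F' (W +>\<^bsub>M\<^esub> x) = F x" if x: "x \<in> carrier M" for x
  proof -
    let ?u = "SOME u. u \<in> W +>\<^bsub>M\<^esub> x"
    have "?u \<in> W +>\<^bsub>M\<^esub> x" using coset_self[OF M W x] by (metis someI)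
    then have u: "?u \<in> carrier M" "?u \<ominus>\<^bsub>M\<^esub> x \<in> W" using coset_memD[OF M W x] by auto
    then have "F ?u \<ominus>\<^bsub>N\<^esub> F x = \<zero>\<^bsub>N\<^esub>" using assms(5) rlinear_minus[OF M N F] x by metis
    then show ?thesis
      unfolding F'_def using rmodule_diff_eq_zero[OF N] u x rlinearD(1)[OF F] by blast
  qed
  show ?thesis
  proof (rule that[OF rlinearI F'])
    fix r S T assume "S \<in> carrier (mquot M W)"
    then obtain x where x: "S = W +>\<^bsub>M\<^esub> x" "x \<in> carrier M" by (auto simp: mquot_carrier[OF M W])
    then show "F' S \<in> carrier N" "F' (r \<odot>\<^bsub>mquot M W\<^esub> S) = r \<odot>\<^bsub>N\<^esub> F' S"
      using rlinearD[OF F] M W by (auto simp: F' coset_smult)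
    assume "T \<in> carrier (mquot M W)"
    then obtain y where y: "T = W +>\<^bsub>M\<^esub> y" "y \<in> carrier M" by (auto simp: mquot_carrier[OF M W])
    then show "F' (S \<oplus>\<^bsub>mquot M W\<^esub> T) = F' S \<oplus>\<^bsub>N\<^esub> F' T"
      using x rlinearD[OF F] M W by (auto simp: F' coset_add)
  qed
qed


subsection \<open>Free vector spaces\<close>

lemma lookup_scale [simp]:
  "Poly_Mapping.lookup (Poly_Mapping.map ((*) (r::real)) u) t = r * Poly_Mapping.lookup u t"
  by transfer (simp add: when_def)

lemma free_mod_simps [simp]:
  "zero (free_mod G) = 0" "add (free_mod G) = (+)"
  "smult (free_mod G) r = Poly_Mapping.map ((*) r)"
  "carrier (free_mod G) = {u. Poly_Mapping.keys u \<subseteq> G}"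
  by (auto simp: free_mod_def)

lemma keys_scale: "Poly_Mapping.keys (Poly_Mapping.map ((*) (r::real)) u) \<subseteq> Poly_Mapping.keys u"
  by (auto simp: in_keys_iff)

lemma rmodule_free_mod: "rmodule (free_mod G)"
proof (rule rmoduleI, goal_cases)
  case (1 x y)
  then show ?case using Poly_Mapping.keys_add[of x y] by auto
next
  case (3 r x)
  then show ?case using keys_scale[of r x] by auto
qed (auto intro!: poly_mapping_eqI simp: lookup_add algebra_simps)

lemma free_mod_minus:
  assumes "u \<in> carrier (free_mod G)" "v \<in> carrier (free_mod G)"
  shows "u \<ominus>\<^bsub>free_mod G\<^esub> v = u - v"
  using rmodule_minus_eq[OF rmodule_free_mod assms]
  by (auto intro!: poly_mapping_eqI simp: lookup_add lookup_minus)

text \<open>A vector space freely generated by \<open>G\<close> is spanned by the generators, and maps of generators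
  extend to linear maps.\<close>

lemma free_mod_span:
  "rspan (free_mod G) ((\<lambda>t. Poly_Mapping.single t 1) ` G) = carrier (free_mod G)" (is "rspan _ ?S = _")
proof
  have S: "?S \<subseteq> carrier (free_mod G)" by auto
  show "rspan (free_mod G) ?S \<subseteq> carrier (free_mod G)"
    by (rule rspan_subset[OF rmodule_free_mod S])
  note sub = rsubmodule_simps[OF rmodule_free_mod rspan_submodule[OF rmodule_free_mod S], simplified]
  show "carrier (free_mod G) \<subseteq> rspan (free_mod G) ?S"
  proof
    fix u :: "'a \<Rightarrow>\<^sub>0 real" assume u: "u \<in> carrier (free_mod G)"
    have single: "Poly_Mapping.single t r \<in> rspan (free_mod G) ?S" if "t \<in> G" for t r
      using sub(4)[OF rspan_base[of "Poly_Mapping.single t 1" ?S], of r] that by auto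
    have "(\<Sum>t\<in>A. Poly_Mapping.single t (Poly_Mapping.lookup u t)) \<in> rspan (free_mod G) ?S"
      if "finite A" "A \<subseteq> G" for A
      using that by (induction A) (auto intro: sub single)
    moreover have "u = (\<Sum>t\<in>Poly_Mapping.keys u. Poly_Mapping.single t (Poly_Mapping.lookup u t))"
      by (rule poly_mapping_eqI)
        (auto simp: lookup_sum lookup_single when_def in_keys_iff)
    ultimately show "u \<in> rspan (free_mod G) ?S" using u by (metis (no_types, lifting)
          finite_keys free_mod_simps(4) mem_Collect_eq)
  qed
qed

lemma free_mod_universal:
  assumes N: "rmodule N" and \<phi>: "\<And>t. t \<in> G \<Longrightarrow> \<phi> t \<in> carrier N"
  obtains L where "rlinear (free_mod G) N L" "\<And>t r. t \<in> G \<Longrightarrow> L (Poly_Mapping.single t r) = r \<odot>\<^bsub>N\<^esub> \<phi> t"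
proof -
  interpret N: Module.module real_ring N by fact
  define L where "L u = finsum N (\<lambda>t. Poly_Mapping.lookup u t \<odot>\<^bsub>N\<^esub> \<phi> t) (Poly_Mapping.keys u)" for u
  have L: "L u = finsum N (\<lambda>t. Poly_Mapping.lookup u t \<odot>\<^bsub>N\<^esub> \<phi> t) A"
    if "finite A" "Poly_Mapping.keys u \<subseteq> A" "A \<subseteq> G" for u A
    unfolding L_def using that \<phi> N
    by (intro N.add.finprod_mono_neutral_cong_left)
      (auto simp: in_keys_iff rmodule_smult)
  have "rlinear (free_mod G) N L"
  proof (rule rlinearI)
    fix u v assume u: "u \<in> carrier (free_mod G)" 
    then show "L u \<in> carrier N" using \<phi> N by (auto simp: L_def intro!: N.finsum_closed)
    show "L (r \<odot>\<^bsub>free_mod G\<^esub> u) = r \<odot>\<^bsub>N\<^esub> L u" for r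
    proof -
      have "L (r \<odot>\<^bsub>free_mod G\<^esub> u) = finsum N (\<lambda>t. r \<odot>\<^bsub>N\<^esub> (Poly_Mapping.lookup u t \<odot>\<^bsub>N\<^esub> \<phi> t)) (Poly_Mapping.keys u)"
        using L[of "Poly_Mapping.keys u" "r \<odot>\<^bsub>free_mod G\<^esub> u"] u keys_scale[of r u] \<phi> N
        by (auto simp: rmodule_smult intro!: N.finsum_cong')
      then show ?thesis
        using u \<phi> N by (auto simp: L_def intro!: N.finsum_smult_ldistr[symmetric])
    qed
    assume v: "v \<in> carrier (free_mod G)"
    let ?A = "Poly_Mapping.keys u \<union> Poly_Mapping.keys v"
    have "L (u + v) = finsum N (\<lambda>t. Poly_Mapping.lookup u t \<odot>\<^bsub>N\<^esub> \<phi> t \<oplus>\<^bsub>N\<^esub> Poly_Mapping.lookup v t \<odot>\<^bsub>N\<^esub> \<phi> t) ?A"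
      using L[of ?A "u + v"] u v Poly_Mapping.keys_add[of u v] \<phi> N
      by (auto simp: rmodule_smult lookup_add intro!: N.finsum_cong')
    also have "\<dots> = L u \<oplus>\<^bsub>N\<^esub> L v"
      using L[of ?A u] L[of ?A v] u v \<phi> N by (subst N.finsum_addf) auto
    finally show "L (u \<oplus>\<^bsub>free_mod G\<^esub> v) = L u \<oplus>\<^bsub>N\<^esub> L v" by simp
  qed
  moreover have "L (Poly_Mapping.single t r) = r \<odot>\<^bsub>N\<^esub> \<phi> t" if "t \<in> G" for t r
    using L[of "{t}" "Poly_Mapping.single t r"] that \<phi> N by (auto simp: rmodule_smult)
  ultimately show ?thesis by (rule that)
qed

lemma rlinear_lin_ext:
  fixes F :: "'g \<Rightarrow> ('h \<Rightarrow>\<^sub>0 real)"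
  assumes "\<And>t. t \<in> G \<Longrightarrow> F t \<in> carrier (free_mod H)"
  shows "rlinear (free_mod G) (free_mod H) (lin_ext F)"
proof -
  have look: "Poly_Mapping.lookup (lin_ext F u) s =
      (\<Sum>t\<in>A. Poly_Mapping.lookup u t * Poly_Mapping.lookup (F t) s)"
    if "finite A" "Poly_Mapping.keys u \<subseteq> A" for u A s
    unfolding lin_ext_def lookup_sum lookup_scale using that
    by (intro sum.mono_neutral_left) (auto simp: in_keys_iff)
  show ?thesis
  proof (rule rlinearI)
    fix u v :: "'g \<Rightarrow>\<^sub>0 real" assume u: "u \<in> carrier (free_mod G)"
    have "Poly_Mapping.lookup (lin_ext F u) s = 0" if "s \<notin> H" for s
      unfolding look[OF finite_keys order_refl] using assms u that
      by (intro sum.neutral) (auto simp: in_keys_iff subset_iff)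
    then show "lin_ext F u \<in> carrier (free_mod H)" by (auto simp: in_keys_iff)
    show "lin_ext F (r \<odot>\<^bsub>free_mod G\<^esub> u) = r \<odot>\<^bsub>free_mod H\<^esub> lin_ext F u" for r
      by (rule poly_mapping_eqI)
        (simp add: look[of "Poly_Mapping.keys u"] keys_scale sum_distrib_left mult.assoc)
    let ?A = "Poly_Mapping.keys u \<union> Poly_Mapping.keys v"
    show "lin_ext F (u \<oplus>\<^bsub>free_mod G\<^esub> v) = lin_ext F u \<oplus>\<^bsub>free_mod H\<^esub> lin_ext F v"
      using Poly_Mapping.keys_add[of u v]
      by (intro poly_mapping_eqI)
        (simp add: look[of ?A] lookup_add sum.distrib distrib_right)
  qed
qed

lemma lin_ext_single [simp]:
  "lin_ext F (Poly_Mapping.single t r) = Poly_Mapping.map ((*) r) (F t)"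
  by (auto simp: lin_ext_def intro!: poly_mapping_eqI)


section \<open>Tensor products of graded vector spaces\<close>

lemma gvs_rmodule: "graded_vector_space P \<Longrightarrow> rmodule (grade P d)"
  by (simp add: graded_vector_space_def)

lemma rmodule_free_tens: "rmodule (free_tens P Q d)"
  by (simp add: free_tens_def rmodule_free_mod)

lemma single_in_free_tens:
  "x \<in> gcarrier P i \<Longrightarrow> y \<in> gcarrier Q (d - i) \<Longrightarrow>
     Poly_Mapping.single (i, x, y) r \<in> carrier (free_tens P Q d)"
  by (auto simp: free_tens_def tens_gens_def)

lemma free_tens_minus:
  "u \<in> carrier (free_tens P Q d) \<Longrightarrow> v \<in> carrier (free_tens P Q d) \<Longrightarrow>
     u \<ominus>\<^bsub>free_tens P Q d\<^esub> v = u - v"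
  unfolding free_tens_def by (rule free_mod_minus)

lemma free_tens_diff_closed:
  "u \<in> carrier (free_tens P Q d) \<Longrightarrow> v \<in> carrier (free_tens P Q d) \<Longrightarrow>
     u - v \<in> carrier (free_tens P Q d)"
  by (metis free_tens_minus rmodule_closed(4) rmodule_free_tens)

lemma tens_rels_cases:
  assumes "u \<in> tens_rels P Q d"
  obtains (add_left) i x x' y where "x \<in> gcarrier P i" "x' \<in> gcarrier P i" "y \<in> gcarrier Q (d - i)"
      "u = Poly_Mapping.single (i, x \<oplus>\<^bsub>grade P i\<^esub> x', y) 1
        - Poly_Mapping.single (i, x, y) 1 - Poly_Mapping.single (i, x', y) 1"
  | (add_right) i x y y' where "x \<in> gcarrier P i" "y \<in> gcarrier Q (d - i)" "y' \<in> gcarrier Q (d - i)"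
      "u = Poly_Mapping.single (i, x, y \<oplus>\<^bsub>grade Q (d - i)\<^esub> y') 1
        - Poly_Mapping.single (i, x, y) 1 - Poly_Mapping.single (i, x, y') 1"
  | (smult_left) i r x y where "x \<in> gcarrier P i" "y \<in> gcarrier Q (d - i)"
      "u = Poly_Mapping.single (i, r \<odot>\<^bsub>grade P i\<^esub> x, y) 1 - Poly_Mapping.single (i, x, y) r"
  | (smult_right) i r x y where "x \<in> gcarrier P i" "y \<in> gcarrier Q (d - i)"
      "u = Poly_Mapping.single (i, x, r \<odot>\<^bsub>grade Q (d - i)\<^esub> y) 1 - Poly_Mapping.single (i, x, y) r"
  using assms unfolding tens_rels_def by blast

text \<open>The linear map on degree \<open>d\<close> of a tensor product with prescribed bilinear values \<open>B i x y\<close> on pure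
  tensors. Outside the carrier its values are arbitrary.\<close>

definition tensor_lift ::
  "('a,'y) gvs_scheme \<Rightarrow> ('b,'z) gvs_scheme \<Rightarrow> int \<Rightarrow> (real,'c) module
     \<Rightarrow> (int \<Rightarrow> 'a \<Rightarrow> 'b \<Rightarrow> 'c) \<Rightarrow> ('a,'b) free_tensor set \<Rightarrow> 'c" where
  "tensor_lift P Q d N B = (SOME T. rlinear (gtensor P Q d) N T \<and>
     (\<forall>i. \<forall>x\<in>gcarrier P i. \<forall>y\<in>gcarrier Q (d - i). T (tens P Q d i x y) = B i x y))"

text \<open>Two graded vector spaces whose tensor product is considered.\<close>

locale tensor_product =
  fixes P :: "('a,'y) gvs_scheme" and Q :: "('b,'z) gvs_scheme"
  assumes P: "graded_vector_space P" and Q: "graded_vector_space Q"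
begin

lemmas rmod_P = gvs_rmodule[OF P]
lemmas rmod_Q = gvs_rmodule[OF Q]

lemma tens_rels_subset: "tens_rels P Q d \<subseteq> carrier (free_tens P Q d)"
  unfolding tens_rels_def
  by (auto intro!: free_tens_diff_closed single_in_free_tens simp: rmod_P rmod_Q)

lemma tens_ker_submodule: "submodule (tens_ker P Q d) real_ring (free_tens P Q d)"
  unfolding tens_ker_def by (rule rspan_submodule[OF rmodule_free_tens tens_rels_subset])

lemma rmodule_gtensor: "rmodule (gtensor P Q d)"
  unfolding gtensor_def by (rule rmodule_mquot[OF rmodule_free_tens tens_ker_submodule])

lemma tens_closed:
  "x \<in> gcarrier P i \<Longrightarrow> y \<in> gcarrier Q (d - i) \<Longrightarrow> tens P Q d i x y \<in> carrier (gtensor P Q d)"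
  unfolding tens_def gtensor_def
  by (rule coset_in_mquot[OF rmodule_free_tens tens_ker_submodule single_in_free_tens])

lemma coset_single:
  assumes "x \<in> gcarrier P i" "y \<in> gcarrier Q (d - i)"
  shows "tens_ker P Q d +>\<^bsub>free_tens P Q d\<^esub> Poly_Mapping.single (i, x, y) r
     = r \<odot>\<^bsub>gtensor P Q d\<^esub> tens P Q d i x y"
proof -
  have "Poly_Mapping.single (i, x, y) r = r \<odot>\<^bsub>free_tens P Q d\<^esub> Poly_Mapping.single (i, x, y) 1"
    by (simp add: free_tens_def)
  then show ?thesis
    using coset_smult[OF rmodule_free_tens tens_ker_submodule single_in_free_tens, OF assms, of r 1]
    by (simp add: tens_def gtensor_def)
qed

lemma coset_eqI:
  assumes "u \<in> carrier (free_tens P Q d)" "v \<in> carrier (free_tens P Q d)" "u - v \<in> tens_ker P Q d"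
  shows "tens_ker P Q d +>\<^bsub>free_tens P Q d\<^esub> u = tens_ker P Q d +>\<^bsub>free_tens P Q d\<^esub> v"
  using coset_eq_iff[OF rmodule_free_tens tens_ker_submodule assms(1,2)] assms
  by (simp add: free_tens_minus)

lemma tens_smult_left:
  assumes "x \<in> gcarrier P i" "y \<in> gcarrier Q (d - i)"
  shows "tens P Q d i (r \<odot>\<^bsub>grade P i\<^esub> x) y = r \<odot>\<^bsub>gtensor P Q d\<^esub> tens P Q d i x y"
proof -
  have "Poly_Mapping.single (i, r \<odot>\<^bsub>grade P i\<^esub> x, y) 1 - Poly_Mapping.single (i, x, y) r \<in> tens_ker P Q d"
    unfolding tens_ker_def using assms by (intro rspan_base) (auto simp: tens_rels_def)
  then show ?thesis
    unfolding coset_single[OF assms, symmetric] unfolding tens_def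
    using assms by (intro coset_eqI single_in_free_tens) (auto simp: rmod_P)
qed

lemma tens_smult_right:
  assumes "x \<in> gcarrier P i" "y \<in> gcarrier Q (d - i)"
  shows "tens P Q d i x (r \<odot>\<^bsub>grade Q (d - i)\<^esub> y) = r \<odot>\<^bsub>gtensor P Q d\<^esub> tens P Q d i x y"
proof -
  have "Poly_Mapping.single (i, x, r \<odot>\<^bsub>grade Q (d - i)\<^esub> y) 1 - Poly_Mapping.single (i, x, y) r \<in> tens_ker P Q d"
    unfolding tens_ker_def using assms by (intro rspan_base) (auto simp: tens_rels_def)
  then show ?thesis
    unfolding coset_single[OF assms, symmetric] unfolding tens_def
    using assms by (intro coset_eqI single_in_free_tens) (auto simp: rmod_Q)
qed

lemma coset_tens_add:
  assumes "u \<in> carrier (free_tens P Q d)" "v \<in> carrier (free_tens P Q d)"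
  shows "(tens_ker P Q d +>\<^bsub>free_tens P Q d\<^esub> u) \<oplus>\<^bsub>gtensor P Q d\<^esub> (tens_ker P Q d +>\<^bsub>free_tens P Q d\<^esub> v)
     = tens_ker P Q d +>\<^bsub>free_tens P Q d\<^esub> (u + v)"
  using coset_add[OF rmodule_free_tens tens_ker_submodule assms]
  by (simp add: gtensor_def free_tens_def)

lemma free_tens_add_closed:
  "u \<in> carrier (free_tens P Q d) \<Longrightarrow> v \<in> carrier (free_tens P Q d) \<Longrightarrow>
     u + v \<in> carrier (free_tens P Q d)"
  using rmodule_closed(1)[OF rmodule_free_tens, of u P Q d v] by (simp add: free_tens_def)

lemma tens_add_left:
  assumes "x \<in> gcarrier P i" "x' \<in> gcarrier P i" "y \<in> gcarrier Q (d - i)"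
  shows "tens P Q d i (x \<oplus>\<^bsub>grade P i\<^esub> x') y = tens P Q d i x y \<oplus>\<^bsub>gtensor P Q d\<^esub> tens P Q d i x' y"
proof -
  have "Poly_Mapping.single (i, x \<oplus>\<^bsub>grade P i\<^esub> x', y) 1
        - Poly_Mapping.single (i, x, y) 1 - Poly_Mapping.single (i, x', y) 1 \<in> tens_ker P Q d"
    unfolding tens_ker_def using assms by (intro rspan_base) (auto simp: tens_rels_def)
  then show ?thesis
    unfolding tens_def using assms
    by (subst coset_tens_add, (intro single_in_free_tens; simp)+)
      (intro coset_eqI single_in_free_tens free_tens_add_closed, auto simp: rmod_P diff_diff_add)
qed

lemma tens_add_right:
  assumes "x \<in> gcarrier P i" "y \<in> gcarrier Q (d - i)" "y' \<in> gcarrier Q (d - i)"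
  shows "tens P Q d i x (y \<oplus>\<^bsub>grade Q (d - i)\<^esub> y') = tens P Q d i x y \<oplus>\<^bsub>gtensor P Q d\<^esub> tens P Q d i x y'"
proof -
  have "Poly_Mapping.single (i, x, y \<oplus>\<^bsub>grade Q (d - i)\<^esub> y') 1
        - Poly_Mapping.single (i, x, y) 1 - Poly_Mapping.single (i, x, y') 1 \<in> tens_ker P Q d"
    unfolding tens_ker_def using assms by (intro rspan_base) (auto simp: tens_rels_def)
  then show ?thesis
    unfolding tens_def using assms
    by (subst coset_tens_add, (intro single_in_free_tens; simp)+)
      (intro coset_eqI single_in_free_tens free_tens_add_closed, auto simp: rmod_Q diff_diff_add)
qed

text \<open>The pure tensors of total degree \<open>d\<close>, with factors of any degrees \<open>i\<close> and \<open>d - i\<close>.\<close>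

definition pure_tensors :: "int \<Rightarrow> ('a,'b) free_tensor set set" where
  "pure_tensors d = {tens P Q d i x y | i x y. x \<in> gcarrier P i \<and> y \<in> gcarrier Q (d - i)}"

lemma pure_tensors_subset: "pure_tensors d \<subseteq> carrier (gtensor P Q d)"
  by (auto simp: pure_tensors_def tens_closed)

lemma gtensor_span: "rspan (gtensor P Q d) (pure_tensors d) = carrier (gtensor P Q d)"
proof
  show "rspan (gtensor P Q d) (pure_tensors d) \<subseteq> carrier (gtensor P Q d)"
    by (rule rspan_subset[OF rmodule_gtensor pure_tensors_subset])
  let ?S = "(\<lambda>t. Poly_Mapping.single t 1) ` tens_gens P Q d"
  let ?c = "\<lambda>u. tens_ker P Q d +>\<^bsub>free_tens P Q d\<^esub> u"
  have c: "rlinear (free_tens P Q d) (gtensor P Q d) ?c"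
    unfolding gtensor_def by (rule rlinear_coset[OF rmodule_free_tens tens_ker_submodule])
  have "?c u \<in> rspan (gtensor P Q d) (pure_tensors d)" if "u \<in> carrier (free_tens P Q d)" for u
  proof (rule rspan_map[OF rmodule_free_tens rmodule_gtensor c _ pure_tensors_subset])
    show "?S \<subseteq> carrier (free_tens P Q d)" by (auto simp: free_tens_def)
    show "u \<in> rspan (free_tens P Q d) ?S"
      using that free_mod_span[of "tens_gens P Q d"] by (simp add: free_tens_def)
    show "?c x \<in> rspan (gtensor P Q d) (pure_tensors d)" if "x \<in> ?S" for x
      using that by (intro rspan_base) (auto simp: pure_tensors_def tens_gens_def tens_def)
  qed
  then show "carrier (gtensor P Q d) \<subseteq> rspan (gtensor P Q d) (pure_tensors d)"
    using mquot_carrier[OF rmodule_free_tens tens_ker_submodule, of d] by (auto simp: gtensor_def)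
qed

lemma gtensor_linear_eqI:
  assumes "rmodule N" "rlinear (gtensor P Q d) N f" "rlinear (gtensor P Q d) N g"
    and "\<And>i x y. x \<in> gcarrier P i \<Longrightarrow> y \<in> gcarrier Q (d - i) \<Longrightarrow>
           f (tens P Q d i x y) = g (tens P Q d i x y)"
    and "z \<in> carrier (gtensor P Q d)"
  shows "f z = g z"
  by (rule rlinear_eq_on_span[OF rmodule_gtensor assms(1-3) pure_tensors_subset])
    (use assms(4,5) in \<open>auto simp: gtensor_span, auto simp: pure_tensors_def\<close>)

text \<open>The universal property; there is one bilinear map for every degree \<open>i\<close> of the first factor, and
  these maps need not be related.\<close>

lemma gtensor_universal:
  assumes N: "rmodule N" and B: "\<And>i. rbilinear (grade P i) (grade Q (d - i)) N (B i)"
  obtains T where "rlinear (gtensor P Q d) N T"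
    and "\<And>i x y. x \<in> gcarrier P i \<Longrightarrow> y \<in> gcarrier Q (d - i) \<Longrightarrow> T (tens P Q d i x y) = B i x y"
proof -
  have Bl: "rlinear (grade P i) N (\<lambda>x. B i x y)" if "y \<in> gcarrier Q (d - i)" for i y
    using B[of i] that by (simp add: rbilinear_def)
  have Br: "rlinear (grade Q (d - i)) N (B i x)" if "x \<in> gcarrier P i" for i x
    using B[of i] that by (simp add: rbilinear_def)
  have Bc: "B i x y \<in> carrier N" if "x \<in> gcarrier P i" "y \<in> gcarrier Q (d - i)" for i x y
    using rlinearD(1)[OF Br] that by simp
  obtain L where L: "rlinear (free_tens P Q d) N L"
    and Ls: "\<And>t r. t \<in> tens_gens P Q d \<Longrightarrow> L (Poly_Mapping.single t r) = r \<odot>\<^bsub>N\<^esub> (\<lambda>(i,x,y). B i x y) t"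
  proof (rule free_mod_universal[OF N, of "tens_gens P Q d" "\<lambda>(i,x,y). B i x y"])
    show "(\<lambda>(i,x,y). B i x y) t \<in> carrier N" if "t \<in> tens_gens P Q d" for t
      using that Bc by (auto simp: tens_gens_def)
  qed (auto simp: free_tens_def)
  have Ls': "L (Poly_Mapping.single (i, x, y) r) = r \<odot>\<^bsub>N\<^esub> B i x y"
    if "x \<in> gcarrier P i" "y \<in> gcarrier Q (d - i)" for i x y r
    using Ls[of "(i, x, y)" r] that by (simp add: tens_gens_def)
  have Lm: "L (u - v) = L u \<ominus>\<^bsub>N\<^esub> L v"
    if "u \<in> carrier (free_tens P Q d)" "v \<in> carrier (free_tens P Q d)" for u v
    using rlinear_minus[OF rmodule_free_tens N L that] that by (simp add: free_tens_minus)
  interpret N: Module.module real_ring N by fact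
  have cancel: "a \<oplus>\<^bsub>N\<^esub> b \<ominus>\<^bsub>N\<^esub> a \<ominus>\<^bsub>N\<^esub> b = \<zero>\<^bsub>N\<^esub>" if "a \<in> carrier N" "b \<in> carrier N" for a b
    using that by (metis N.add.inv_solve_right' N.a_comm N.minus_eq N.add.m_closed N.r_neg N.r_neg2 N.a_assoc N.a_inv_closed N.r_zero)
  have self: "a \<ominus>\<^bsub>N\<^esub> a = \<zero>\<^bsub>N\<^esub>" if "a \<in> carrier N" for a
    using that by (simp add: rmodule_diff_eq_zero[OF N])
  have "L u = \<zero>\<^bsub>N\<^esub>" if "u \<in> tens_rels P Q d" for u
    using that
  proof (cases rule: tens_rels_cases)
    case (add_left i x x' y)
    then show ?thesis
      using rlinearD(2)[OF Bl, of y i x x']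
      by (simp add: Lm Ls' single_in_free_tens free_tens_diff_closed rmod_P Bc rmodule_smult(3)[OF N] cancel N)
  next
    case (add_right i x y y')
    then show ?thesis
      using rlinearD(2)[OF Br, of x i y y']
      by (simp add: Lm Ls' single_in_free_tens free_tens_diff_closed rmod_Q Bc rmodule_smult(3)[OF N] cancel N)
  next
    case (smult_left i r x y)
    then show ?thesis
      using rlinearD(3)[OF Bl, of y i x r]
      by (simp add: Lm Ls' single_in_free_tens rmod_P Bc rmodule_smult(3)[OF N] self N)
  next
    case (smult_right i r x y)
    then show ?thesis
      using rlinearD(3)[OF Br, of x i y r]
      by (simp add: Lm Ls' single_in_free_tens rmod_Q Bc rmodule_smult(3)[OF N] self N)
  qed
  then have "L u = \<zero>\<^bsub>N\<^esub>" if "u \<in> tens_ker P Q d" for u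
    using rlinear_zero_on_span[OF rmodule_free_tens N L tens_rels_subset] that
    unfolding tens_ker_def by blast
  then obtain T where T: "rlinear (gtensor P Q d) N T"
    and Tc: "\<And>x. x \<in> carrier (free_tens P Q d) \<Longrightarrow> T (tens_ker P Q d +>\<^bsub>free_tens P Q d\<^esub> x) = L x"
    using rlinear_factor_through_quotient[OF rmodule_free_tens N tens_ker_submodule L]
    unfolding gtensor_def by metis
  show ?thesis
  proof (rule that[OF T])
    fix i x y assume "x \<in> gcarrier P i" "y \<in> gcarrier Q (d - i)"
    then show "T (tens P Q d i x y) = B i x y"
      unfolding tens_def by (simp add: Tc single_in_free_tens Ls' Bc rmodule_smult(3)[OF N])
  qed
qed

lemma tens_linear_right:
  assumes "x \<in> gcarrier P i"
  shows "rlinear (grade Q (d - i)) (gtensor P Q d) (tens P Q d i x)"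
  using assms by (intro rlinearI) (auto simp: tens_closed tens_add_right tens_smult_right)

lemma tens_linear_left:
  assumes "y \<in> gcarrier Q (d - i)"
  shows "rlinear (grade P i) (gtensor P Q d) (\<lambda>x. tens P Q d i x y)"
  using assms by (intro rlinearI) (auto simp: tens_closed tens_add_left tens_smult_left)

lemma tensor_lift:
  assumes "rmodule N" "\<And>i. rbilinear (grade P i) (grade Q (d - i)) N (B i)"
  shows tensor_lift_linear: "rlinear (gtensor P Q d) N (tensor_lift P Q d N B)"
    and tensor_lift_tens: "x \<in> gcarrier P i \<Longrightarrow> y \<in> gcarrier Q (d - i) \<Longrightarrow>
           tensor_lift P Q d N B (tens P Q d i x y) = B i x y"
proof -
  have "\<exists>T. rlinear (gtensor P Q d) N T \<and>
     (\<forall>i. \<forall>x\<in>gcarrier P i. \<forall>y\<in>gcarrier Q (d - i). T (tens P Q d i x y) = B i x y)"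
    by (rule gtensor_universal[OF assms]) blast+
  from someI_ex[OF this]
  show "rlinear (gtensor P Q d) N (tensor_lift P Q d N B)"
    and "x \<in> gcarrier P i \<Longrightarrow> y \<in> gcarrier Q (d - i) \<Longrightarrow>
           tensor_lift P Q d N B (tens P Q d i x y) = B i x y"
    unfolding tensor_lift_def by blast+
qed

end

text \<open>Maps of tensor products given on pure tensors by \<open>x \<otimes> y \<mapsto> c (\<rho> x \<otimes> \<sigma> y)\<close>, where \<open>\<rho> x\<close> has degree
  \<open>s i\<close> if \<open>x\<close> has degree \<open>i\<close>, and the real number \<open>c\<close> may depend on \<open>i\<close>. Both actions of functions and
  all restriction maps on tensor products have this form.\<close>

lemma gtensor_induced_map:
  fixes P :: "('a,'y) gvs_scheme" and Q :: "('b,'z) gvs_scheme"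
    and P' :: "('c,'v) gvs_scheme" and Q' :: "('e,'w) gvs_scheme" and c :: "int \<Rightarrow> real"
  assumes "tensor_product P Q" "tensor_product P' Q'"
    and \<rho>: "\<And>i. rlinear (grade P i) (grade P' (s i)) (\<rho> i)"
    and \<sigma>: "\<And>i. rlinear (grade Q (d - i)) (grade Q' (d' - s i)) (\<sigma> i)"
  defines "F \<equiv> lin_ext (\<lambda>(i, x, y). Poly_Mapping.single (s i, \<rho> i x, \<sigma> i y) (c i))"
  shows gtensor_induced_linear:
      "rlinear (gtensor P Q d) (gtensor P' Q' d') (quot_map (free_tens P' Q' d') (tens_ker P' Q' d') F)"
    and gtensor_induced_tens:
      "x \<in> gcarrier P i \<Longrightarrow> y \<in> gcarrier Q (d - i) \<Longrightarrow>
        quot_map (free_tens P' Q' d') (tens_ker P' Q' d') F (tens P Q d i x y)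
          = c i \<odot>\<^bsub>gtensor P' Q' d'\<^esub> tens P' Q' d' (s i) (\<rho> i x) (\<sigma> i y)"
proof -
  interpret A: tensor_product P Q by fact
  interpret B: tensor_product P' Q' by fact
  let ?M = "free_tens P Q d" and ?M' = "free_tens P' Q' d'" and ?N = "gtensor P' Q' d'"
  let ?k = "\<lambda>u. tens_ker P Q d +>\<^bsub>?M\<^esub> u" and ?k' = "\<lambda>u. tens_ker P' Q' d' +>\<^bsub>?M'\<^esub> u"
  let ?B = "\<lambda>i x y. c i \<odot>\<^bsub>?N\<^esub> tens P' Q' d' (s i) (\<rho> i x) (\<sigma> i y)"
  note rc = rlinearD(1)[OF \<rho>] rlinearD(1)[OF \<sigma>]
  have "rlinear (grade P i) ?N (\<lambda>x. ?B i x y)" if "y \<in> gcarrier Q (d - i)" for i y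
    by (rule rlinear_smult[OF B.rmodule_gtensor rlinear_comp[OF \<rho> B.tens_linear_left[OF rc(2)[OF that]]]])
  moreover have "rlinear (grade Q (d - i)) ?N (?B i x)" if "x \<in> gcarrier P i" for i x
    by (rule rlinear_smult[OF B.rmodule_gtensor rlinear_comp[OF \<sigma> B.tens_linear_right[OF rc(1)[OF that]]]])
  ultimately have "rbilinear (grade P i) (grade Q (d - i)) ?N (?B i)" for i
    by (simp add: rbilinear_def)
  then obtain T where T: "rlinear (gtensor P Q d) ?N T"
    and Tt: "\<And>i x y. x \<in> gcarrier P i \<Longrightarrow> y \<in> gcarrier Q (d - i) \<Longrightarrow> T (tens P Q d i x y) = ?B i x y"
    by (rule A.gtensor_universal[OF B.rmodule_gtensor]) blast+
  have F: "rlinear ?M ?M' F"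
    unfolding free_tens_def F_def using rc
    by (intro rlinear_lin_ext) (auto simp: tens_gens_def split: if_splits)
  have k: "rlinear ?M (gtensor P Q d) ?k" and k': "rlinear ?M' ?N ?k'"
    unfolding gtensor_def
    by (rule rlinear_coset[OF rmodule_free_tens A.tens_ker_submodule]
        rlinear_coset[OF rmodule_free_tens B.tens_ker_submodule])+
  \<comment> \<open>the lift of \<open>F\<close> agrees with \<open>T\<close> on generators\<close>
  have FT: "?k' (F u) = T (?k u)" if "u \<in> carrier ?M" for u
  proof (rule rlinear_eq_on_span[OF rmodule_free_tens B.rmodule_gtensor rlinear_comp[OF F k'] rlinear_comp[OF k T]])
    let ?S = "(\<lambda>t. Poly_Mapping.single t (1::real)) ` tens_gens P Q d"
    show "?S \<subseteq> carrier ?M" by (auto simp: free_tens_def)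
    show "u \<in> rspan ?M ?S" using that free_mod_span[of "tens_gens P Q d"] by (simp add: free_tens_def)
    fix v assume "v \<in> ?S"
    then obtain i x y where v: "v = Poly_Mapping.single (i, x, y) 1"
      and xy: "x \<in> gcarrier P i" "y \<in> gcarrier Q (d - i)" by (auto simp: tens_gens_def)
    have "?k' (F v) = ?B i x y"
      using B.coset_single[OF rc, OF xy, of "c i"] by (simp add: v F_def)
    then show "?k' (F v) = T (?k v)" using Tt[OF xy] by (simp add: v tens_def)
  qed
  have FW: "F u \<in> tens_ker P' Q' d'" if u: "u \<in> tens_ker P Q d" for u
  proof -
    note W = rsubmodule_simps[OF rmodule_free_tens A.tens_ker_submodule[of d]]
    have uM: "u \<in> carrier ?M" using u W(1) by blast
    have "?k u = ?k \<zero>\<^bsub>?M\<^esub>"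
      using coset_eq_iff[OF rmodule_free_tens A.tens_ker_submodule uM] W(2,5) u W(1) by blast
    then have "?k' (F u) = ?k' (F \<zero>\<^bsub>?M\<^esub>)" using FT[OF uM] FT[of "\<zero>\<^bsub>?M\<^esub>"] W(1,2) by auto
    also have "\<dots> = tens_ker P' Q' d'"
      using rlinear_zero[OF rmodule_free_tens rmodule_free_tens F] coset_zero[OF rmodule_free_tens B.tens_ker_submodule]
      by simp
    finally show ?thesis
      using coset_self[OF rmodule_free_tens B.tens_ker_submodule rlinearD(1)[OF F uM]] by simp
  qed
  note q = rmodule_free_tens rmodule_free_tens A.tens_ker_submodule B.tens_ker_submodule F FW
  show "rlinear (gtensor P Q d) ?N (quot_map ?M' (tens_ker P' Q' d') F)"
    unfolding gtensor_def by (rule quot_map_linear[OF q])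
  show "quot_map ?M' (tens_ker P' Q' d') F (tens P Q d i x y) = ?B i x y"
    if xy: "x \<in> gcarrier P i" "y \<in> gcarrier Q (d - i)"
    using quot_map_coset[OF q single_in_free_tens[OF xy], of 1] FT[OF single_in_free_tens[OF xy], of 1]
      Tt[OF xy] by (simp add: tens_def)
qed


section \<open>Contractions of tensors\<close>

text \<open>Linear functionals, as maps into the type of real numbers.\<close>

definition functional :: "(real,'a) module \<Rightarrow> ('a \<Rightarrow> real) \<Rightarrow> bool" where
  "functional M c \<longleftrightarrow> (\<forall>x\<in>carrier M. \<forall>y\<in>carrier M. c (x \<oplus>\<^bsub>M\<^esub> y) = c x + c y) \<and>
     (\<forall>r. \<forall>x\<in>carrier M. c (r \<odot>\<^bsub>M\<^esub> x) = r * c x)"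

text \<open>The contraction \<open>x \<otimes> y \<mapsto> c x \<cdot> y\<close> of the first factor with a functional \<open>c\<close> on its degree \<open>i\<close>; pure
  tensors whose first factor has another degree are sent to 0.\<close>

definition contract ::
  "('a,'y) gvs_scheme \<Rightarrow> ('b,'z) gvs_scheme \<Rightarrow> int \<Rightarrow> int \<Rightarrow> ('a \<Rightarrow> real)
     \<Rightarrow> ('a,'b) free_tensor set \<Rightarrow> 'b" where
  "contract P Q d i c = tensor_lift P Q d (grade Q (d - i))
     (\<lambda>j x y. if j = i then c x \<odot>\<^bsub>grade Q (d - i)\<^esub> y else \<zero>\<^bsub>grade Q (d - i)\<^esub>)"

context tensor_product
begin

lemma contract:
  assumes "functional (grade P i) c"
  shows contract_linear: "rlinear (gtensor P Q d) (grade Q (d - i)) (contract P Q d i c)"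
    and contract_tens: "x \<in> gcarrier P j \<Longrightarrow> y \<in> gcarrier Q (d - j) \<Longrightarrow>
       contract P Q d i c (tens P Q d j x y)
         = (if j = i then c x \<odot>\<^bsub>grade Q (d - i)\<^esub> y else \<zero>\<^bsub>grade Q (d - i)\<^esub>)"
proof -
  let ?N = "grade Q (d - i)"
  let ?B = "\<lambda>j x y. if j = i then c x \<odot>\<^bsub>?N\<^esub> y else \<zero>\<^bsub>?N\<^esub>"
  have "rbilinear (grade P j) (grade Q (d - j)) ?N (?B j)" for j
  proof (cases "j = i")
    case True
    then show ?thesis
      using assms rmodule_smult[OF rmod_Q] rmodule_smult_commute[OF rmod_Q]
      by (auto simp: rbilinear_def rlinear_def functional_def rmod_Q)
  next
    case False
    then show ?thesis
      using rlinear_const_zero[OF rmod_Q[of "d - i"], of "grade Q (d - j)"]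
        rlinear_const_zero[OF rmod_Q[of "d - i"], of "grade P j"] by (simp add: rbilinear_def)
  qed
  from tensor_lift[OF rmod_Q this]
  show "rlinear (gtensor P Q d) (grade Q (d - i)) (contract P Q d i c)"
    and "x \<in> gcarrier P j \<Longrightarrow> y \<in> gcarrier Q (d - j) \<Longrightarrow>
       contract P Q d i c (tens P Q d j x y)
         = (if j = i then c x \<odot>\<^bsub>grade Q (d - i)\<^esub> y else \<zero>\<^bsub>grade Q (d - i)\<^esub>)"
    unfolding contract_def by blast+
qed

text \<open>The sums of \<open>N\<close> pure tensors.\<close>

primrec sums_of_tensors :: "int \<Rightarrow> nat \<Rightarrow> ('a,'b) free_tensor set set" where
  "sums_of_tensors d 0 = {\<zero>\<^bsub>gtensor P Q d\<^esub>}"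
| "sums_of_tensors d (Suc N) = {t \<oplus>\<^bsub>gtensor P Q d\<^esub> z | t z. t \<in> pure_tensors d \<and> z \<in> sums_of_tensors d N}"

lemma sums_of_tensors_subset: "sums_of_tensors d N \<subseteq> carrier (gtensor P Q d)"
  using pure_tensors_subset[of d] by (induction N) (auto simp: rmodule_gtensor subset_iff)

lemma sums_of_tensors_map:
  assumes f: "rlinear (gtensor P Q d) (gtensor P Q d) f"
    and "\<And>t. t \<in> pure_tensors d \<Longrightarrow> f t \<in> pure_tensors d" and "z \<in> sums_of_tensors d N"
  shows "f z \<in> sums_of_tensors d N"
  using assms(3)
proof (induction N arbitrary: z)
  case 0
  then show ?case using rlinear_zero[OF rmodule_gtensor rmodule_gtensor f] by simp
next
  case (Suc N)
  then obtain t w where z: "z = t \<oplus>\<^bsub>gtensor P Q d\<^esub> w" "t \<in> pure_tensors d" "w \<in> sums_of_tensors d N"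
    by auto
  then have "f z = f t \<oplus>\<^bsub>gtensor P Q d\<^esub> f w"
    using rlinearD(2)[OF f, of t w] subsetD[OF pure_tensors_subset z(2)]
      subsetD[OF sums_of_tensors_subset z(3)] by simp
  then show ?case using Suc.IH[OF z(3)] assms(2)[OF z(2)] by auto
qed

lemma sums_of_tensors_add:
  assumes "z \<in> sums_of_tensors d N" "w \<in> sums_of_tensors d M"
  shows "z \<oplus>\<^bsub>gtensor P Q d\<^esub> w \<in> sums_of_tensors d (N + M)"
  using assms(1)
proof (induction N arbitrary: z)
  interpret G: Module.module real_ring "gtensor P Q d" by (rule rmodule_gtensor)
  case 0
  then show ?case using assms(2) subsetD[OF sums_of_tensors_subset assms(2)] by simp
next
  interpret G: Module.module real_ring "gtensor P Q d" by (rule rmodule_gtensor)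
  case (Suc N)
  then obtain t u where z: "z = t \<oplus>\<^bsub>gtensor P Q d\<^esub> u" "t \<in> pure_tensors d" "u \<in> sums_of_tensors d N"
    by auto
  then have "z \<oplus>\<^bsub>gtensor P Q d\<^esub> w = t \<oplus>\<^bsub>gtensor P Q d\<^esub> (u \<oplus>\<^bsub>gtensor P Q d\<^esub> w)"
    using G.a_assoc[of t u w] subsetD[OF pure_tensors_subset z(2)]
      subsetD[OF sums_of_tensors_subset z(3)] subsetD[OF sums_of_tensors_subset assms(2)] by simp
  then show ?case using Suc.IH[OF z(3)] z(2) by auto
qed

lemma gtensor_sums_of_tensors:
  assumes "z \<in> carrier (gtensor P Q d)"
  obtains N where "z \<in> sums_of_tensors d N"
proof -
  interpret G: Module.module real_ring "gtensor P Q d" by (rule rmodule_gtensor)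
  let ?H = "\<Union>N. sums_of_tensors d N"
  have "submodule ?H real_ring (gtensor P Q d)"
  proof (rule rsubmoduleI[OF rmodule_gtensor])
    show "?H \<subseteq> carrier (gtensor P Q d)" using sums_of_tensors_subset by blast
    show "\<zero>\<^bsub>gtensor P Q d\<^esub> \<in> ?H" by (rule UN_I[of 0]) auto
    show "x \<oplus>\<^bsub>gtensor P Q d\<^esub> y \<in> ?H" if "x \<in> ?H" "y \<in> ?H" for x y
      using that sums_of_tensors_add by blast
    have pure: "r \<odot>\<^bsub>gtensor P Q d\<^esub> t \<in> pure_tensors d" if "t \<in> pure_tensors d" for r t
    proof -
      from that obtain i x y where "t = tens P Q d i x y" "x \<in> gcarrier P i" "y \<in> gcarrier Q (d - i)"
        by (auto simp: pure_tensors_def)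
      then have "r \<odot>\<^bsub>gtensor P Q d\<^esub> t = tens P Q d i (r \<odot>\<^bsub>grade P i\<^esub> x) y"
          "r \<odot>\<^bsub>grade P i\<^esub> x \<in> gcarrier P i"
        by (auto simp: tens_smult_left rmod_P)
      with \<open>y \<in> _\<close> show ?thesis unfolding pure_tensors_def by blast
    qed
    have lin: "rlinear (gtensor P Q d) (gtensor P Q d) (\<lambda>z. r \<odot>\<^bsub>gtensor P Q d\<^esub> z)" for r
      by (rule rlinear_smult[OF rmodule_gtensor]) (auto simp: rlinear_def)
    show "r \<odot>\<^bsub>gtensor P Q d\<^esub> x \<in> ?H" if "x \<in> ?H" for r x
      using sums_of_tensors_map[OF lin pure] that by auto
  qed
  moreover have "pure_tensors d \<subseteq> ?H"
  proof
    fix t assume "t \<in> pure_tensors d"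
    moreover from this have "t = t \<oplus>\<^bsub>gtensor P Q d\<^esub> \<zero>\<^bsub>gtensor P Q d\<^esub>"
      using pure_tensors_subset[of d] by (simp add: subsetD)
    ultimately have "t \<in> sums_of_tensors d (Suc 0)" by auto
    then show "t \<in> ?H" by blast
  qed
  ultimately have "rspan (gtensor P Q d) (pure_tensors d) \<subseteq> ?H" by (rule rspan_least)
  then show ?thesis using assms that gtensor_span by blast
qed

text \<open>Contractions with a separating family of functionals separate the elements of the tensor
  product. A sum of \<open>Suc N\<close> pure tensors all of whose contractions vanish is a sum of \<open>N\<close> pure tensors:
  if \<open>x \<otimes> y\<close> is a summand with \<open>c x = 1\<close>, then the linear map sending \<open>z\<close> to the difference of \<open>z\<close> and
  \<open>x \<otimes> contract c z\<close> fixes the sum, kills this summand and takes pure tensors to pure tensors.\<close>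

theorem contractions_separate:
  assumes func: "\<And>i c. c \<in> F i \<Longrightarrow> functional (grade P i) c"
    and sep: "\<And>i x. x \<in> gcarrier P i \<Longrightarrow> (\<And>c. c \<in> F i \<Longrightarrow> c x = 0) \<Longrightarrow> x = \<zero>\<^bsub>grade P i\<^esub>"
    and z: "z \<in> carrier (gtensor P Q d)"
    and zero: "\<And>i c. c \<in> F i \<Longrightarrow> contract P Q d i c z = \<zero>\<^bsub>grade Q (d - i)\<^esub>"
  shows "z = \<zero>\<^bsub>gtensor P Q d\<^esub>"
proof -
  let ?G = "gtensor P Q d"
  interpret G: Module.module real_ring ?G by (rule rmodule_gtensor)
  obtain N where "z \<in> sums_of_tensors d N" using z by (rule gtensor_sums_of_tensors)
  then show ?thesis using zero
  proof (induction N arbitrary: z)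
    case 0
    then show ?case by simp
  next
    case (Suc N)
    from Suc.prems(1) obtain i x y w where z: "z = tens P Q d i x y \<oplus>\<^bsub>?G\<^esub> w"
      and x: "x \<in> gcarrier P i" and y: "y \<in> gcarrier Q (d - i)" and w: "w \<in> sums_of_tensors d N"
      by (auto simp: pure_tensors_def)
    have wG: "w \<in> carrier ?G" using w sums_of_tensors_subset by blast
    have xy: "tens P Q d i x y \<in> carrier ?G" using x y by (rule tens_closed)
    have "z \<in> sums_of_tensors d N"
    proof (cases "\<forall>c\<in>F i. c x = 0")
      case True
      then have "x = \<zero>\<^bsub>grade P i\<^esub>" using sep[OF x] by blast
      then have "tens P Q d i x y = \<zero>\<^bsub>?G\<^esub>"
        using rlinear_zero[OF rmod_P rmodule_gtensor tens_linear_left[OF y]] by simp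
      then show ?thesis using z w wG by simp
    next
      case False
      then obtain c where c: "c \<in> F i" "c x \<noteq> 0" by blast
      note cf = func[OF c(1)]
      \<comment> \<open>normalized so that \<open>c x1 = 1\<close>\<close>
      define x1 where "x1 = (1 / c x) \<odot>\<^bsub>grade P i\<^esub> x"
      have x1: "x1 \<in> gcarrier P i" using x by (simp add: x1_def rmod_P)
      \<comment> \<open>\<open>h\<close> replaces \<open>u \<otimes> v\<close> by \<open>(u - c u \<cdot> x1) \<otimes> v\<close> if \<open>u\<close> has degree \<open>i\<close>, and keeps it otherwise\<close>
      define h where "h v = v \<ominus>\<^bsub>?G\<^esub> tens P Q d i x1 (contract P Q d i c v)" for v
      have h: "rlinear ?G ?G h"
        unfolding h_def
        by (intro rlinear_diff[OF rmodule_gtensor] rlinear_comp[OF contract_linear[OF cf] tens_linear_right[OF x1]])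
          (auto simp: rlinear_def)
      have tens0: "tens P Q d i x1 \<zero>\<^bsub>grade Q (d - i)\<^esub> = \<zero>\<^bsub>?G\<^esub>"
        by (rule rlinear_zero[OF rmod_Q rmodule_gtensor tens_linear_right[OF x1]])
      have h_pure_i: "h (tens P Q d i u v) = tens P Q d i (u \<ominus>\<^bsub>grade P i\<^esub> c u \<odot>\<^bsub>grade P i\<^esub> x1) v"
        if u: "u \<in> gcarrier P i" and v: "v \<in> gcarrier Q (d - i)" for u v
      proof -
        have "h (tens P Q d i u v) = tens P Q d i u v \<ominus>\<^bsub>?G\<^esub> tens P Q d i x1 (c u \<odot>\<^bsub>grade Q (d - i)\<^esub> v)"
          using contract_tens[OF cf u v] by (simp add: h_def)
        also have "\<dots> = tens P Q d i u v \<ominus>\<^bsub>?G\<^esub> tens P Q d i (c u \<odot>\<^bsub>grade P i\<^esub> x1) v"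
          using tens_smult_right[OF x1 v] tens_smult_left[OF x1 v] by simp
        also have "\<dots> = tens P Q d i (u \<ominus>\<^bsub>grade P i\<^esub> c u \<odot>\<^bsub>grade P i\<^esub> x1) v"
          using rlinear_minus[OF rmod_P rmodule_gtensor tens_linear_left[OF v]] u x1 by (simp add: rmod_P)
        finally show ?thesis .
      qed
      have h_pure: "h t \<in> pure_tensors d" if t: "t \<in> pure_tensors d" for t
      proof -
        obtain j u v where t: "t = tens P Q d j u v" and u: "u \<in> gcarrier P j" and v: "v \<in> gcarrier Q (d - j)"
          using t by (auto simp: pure_tensors_def)
        show ?thesis
        proof (cases "j = i")
          case True
          have "u \<ominus>\<^bsub>grade P i\<^esub> c u \<odot>\<^bsub>grade P i\<^esub> x1 \<in> gcarrier P i"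
            using u x1 True by (simp add: rmod_P)
          then show ?thesis
            unfolding t True using h_pure_i u v True unfolding pure_tensors_def by blast
        next
          case False
          then have "h t = t"
            using contract_tens[OF cf u v] tens0 t tens_closed[OF u v] by (simp add: h_def G.minus_eq)
          then show ?thesis using \<open>t \<in> pure_tensors d\<close> by simp
        qed
      qed
      have "c x \<odot>\<^bsub>grade P i\<^esub> x1 = x"
        unfolding x1_def using c(2) x by (simp flip: rmodule_smult(2)[OF rmod_P x] add: rmodule_smult(3)[OF rmod_P x])
      then have "h (tens P Q d i x y) = tens P Q d i \<zero>\<^bsub>grade P i\<^esub> y"
        using h_pure_i[OF x y] rmodule_diff_eq_zero[OF rmod_P x x] by simp
      also have "\<dots> = \<zero>\<^bsub>?G\<^esub>"
        by (rule rlinear_zero[OF rmod_P rmodule_gtensor tens_linear_left[OF y]])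
      finally have "h z = h w"
        using rlinearD(1,2)[OF h] z xy wG by simp
      moreover have "h z = z"
        using Suc.prems(2)[OF c(1)] tens0 z xy wG by (simp add: h_def G.minus_eq)
      ultimately show ?thesis using sums_of_tensors_map[OF h h_pure w] by simp
    qed
    then show ?case using Suc.IH Suc.prems(2) by blast
  qed
qed

end


section \<open>Smooth functions\<close>

text \<open>Smoothness is defined by iterated partial derivatives along coordinate lines. Two functions that
  agree on an open set have the same partial derivatives there, as a coordinate line through a point of
  the set stays in it near that point.\<close>

lemma eventually_in_open_along_line:
  assumes U: "openin (Euclidean_space m) U" and x: "x \<in> U" and i: "i < m"
  shows "eventually (\<lambda>t. x(i := t) \<in> U) (nhds (x i))"
proof -
  have "U \<subseteq> topspace (Euclidean_space m)" using U by (rule openin_subset)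
  then have "continuous_map euclideanreal (Euclidean_space m) (\<lambda>t. x(i := t))"
    using x i by (auto simp: Euclidean_space_def continuous_map_in_subtopology
        continuous_map_componentwise_UNIV topspace_Euclidean_space)
  from openin_continuous_map_preimage[OF this U] have "open {t. x(i := t) \<in> U}"
    by simp
  from eventually_nhds_in_open[OF this, of "x i"] x show ?thesis by simp
qed

lemma partial_deriv_cong:
  assumes "openin (Euclidean_space m) U" "x \<in> U" "i < m" "\<And>y. y \<in> U \<Longrightarrow> f y = g y"
  shows "partial_deriv i f x = partial_deriv i g x"
    and "(\<lambda>t. f (x(i := t))) differentiable (at (x i)) \<Longrightarrow> (\<lambda>t. g (x(i := t))) differentiable (at (x i))"
proof -
  have ev: "eventually (\<lambda>t. f (x(i := t)) = g (x(i := t))) (nhds (x i))"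
    using eventually_in_open_along_line[OF assms(1-3)] by (rule eventually_mono) (rule assms(4))
  then show "partial_deriv i f x = partial_deriv i g x"
    unfolding partial_deriv_def by (rule deriv_cong_ev) simp
  show "(\<lambda>t. g (x(i := t))) differentiable (at (x i))" if "(\<lambda>t. f (x(i := t))) differentiable (at (x i))"
    using that DERIV_cong_ev[OF refl ev refl] by (auto simp: real_differentiable_def)
qed

lemma times_cont_diff_continuous:
  "times_cont_diff m k U f \<Longrightarrow> continuous_map (subtopology (Euclidean_space m) U) euclideanreal f"
  by (cases k) auto

lemma times_cont_diff_cong:
  assumes U: "openin (Euclidean_space m) U"
  shows "\<lbrakk>\<And>y. y \<in> U \<Longrightarrow> f y = g y; times_cont_diff m k U f\<rbrakk> \<Longrightarrow> times_cont_diff m k U g"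
proof (induction k arbitrary: f g)
  case 0
  then show ?case by (auto elim!: continuous_map_eq)
next
  case (Suc k)
  have "times_cont_diff m k U (partial_deriv i g)" if "i < m" for i
  proof (rule Suc.IH)
    show "partial_deriv i f y = partial_deriv i g y" if "y \<in> U" for y
      by (rule partial_deriv_cong(1)[OF U that \<open>i < m\<close> Suc.prems(1)])
    show "times_cont_diff m k U (partial_deriv i f)" using Suc.prems(2) that by simp
  qed
  moreover have "continuous_map (subtopology (Euclidean_space m) U) euclideanreal g"
    using Suc.prems by (auto elim!: continuous_map_eq)
  moreover have "(\<lambda>t. g (x(i := t))) differentiable (at (x i))" if "x \<in> U" "i < m" for x i
  proof (rule partial_deriv_cong(2)[OF U that])
    show "(\<lambda>t. f (x(i := t))) differentiable (at (x i))"
      using Suc.prems(2) that unfolding times_cont_diff.simps by blast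
  qed (rule Suc.prems(1))
  ultimately show ?case unfolding times_cont_diff.simps by blast
qed

lemma times_cont_diff_SucD: "times_cont_diff m (Suc k) U f \<Longrightarrow> times_cont_diff m k U f"
  by (induction k arbitrary: f) auto

lemma times_cont_diff_const: "times_cont_diff m k U (\<lambda>x. c)"
proof (induction k arbitrary: c)
  case (Suc k)
  have "partial_deriv i (\<lambda>x. c) = (\<lambda>x. 0)" for i by (simp add: partial_deriv_def fun_eq_iff)
  then show ?case using Suc.IH[of 0] by auto
qed auto

lemma has_partial_deriv:
  assumes "times_cont_diff m (Suc k) U f" "x \<in> U" "i < m"
  shows "((\<lambda>t. f (x(i := t))) has_field_derivative partial_deriv i f x) (at (x i))"
  using assms by (simp add: partial_deriv_def DERIV_deriv_iff_real_differentiable)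

lemma times_cont_diff_SucI:
  assumes U: "openin (Euclidean_space m) U"
    and "continuous_map (subtopology (Euclidean_space m) U) euclideanreal f"
    and D: "\<And>i x. i < m \<Longrightarrow> x \<in> U \<Longrightarrow> ((\<lambda>t. f (x(i := t))) has_field_derivative D i x) (at (x i))"
    and "\<And>i. i < m \<Longrightarrow> times_cont_diff m k U (D i)"
  shows "times_cont_diff m (Suc k) U f"
proof -
  have "D i x = partial_deriv i f x" if "i < m" "x \<in> U" for i x
    unfolding partial_deriv_def using DERIV_imp_deriv[OF D[OF that]] by simp
  then have "times_cont_diff m k U (partial_deriv i f)" if "i < m" for i
    using times_cont_diff_cong[OF U _ assms(4)[OF that]] that by blast
  then show ?thesis
    using assms(2) D by (auto simp: real_differentiable_def)
qed

lemma times_cont_diff_add: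
  assumes U: "openin (Euclidean_space m) U"
  shows "\<lbrakk>times_cont_diff m k U f; times_cont_diff m k U g\<rbrakk> \<Longrightarrow> times_cont_diff m k U (\<lambda>x. f x + g x)"
proof (induction k arbitrary: f g)
  case 0
  then show ?case by (auto intro: continuous_map_add)
next
  case (Suc k)
  show ?case
  proof (rule times_cont_diff_SucI[OF U])
    show "continuous_map (subtopology (Euclidean_space m) U) euclideanreal (\<lambda>x. f x + g x)"
      using Suc.prems by (intro continuous_map_add) auto
    fix i assume i: "i < m"
    show "((\<lambda>t. f (x(i := t)) + g (x(i := t))) has_field_derivative
        partial_deriv i f x + partial_deriv i g x) (at (x i))" if "x \<in> U" for x
      by (intro DERIV_add has_partial_deriv[OF _ that i, where k = k] Suc.prems)
    show "times_cont_diff m k U (\<lambda>x. partial_deriv i f x + partial_deriv i g x)"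
      using Suc.prems i by (intro Suc.IH) auto
  qed
qed

lemma times_cont_diff_mult:
  assumes U: "openin (Euclidean_space m) U"
  shows "\<lbrakk>times_cont_diff m k U f; times_cont_diff m k U g\<rbrakk> \<Longrightarrow> times_cont_diff m k U (\<lambda>x. f x * g x)"
proof (induction k arbitrary: f g)
  case 0
  then show ?case by (auto intro: continuous_map_real_mult)
next
  case (Suc k)
  show ?case
  proof (rule times_cont_diff_SucI[OF U])
    show "continuous_map (subtopology (Euclidean_space m) U) euclideanreal (\<lambda>x. f x * g x)"
      using Suc.prems by (intro continuous_map_real_mult) auto
    fix i assume i: "i < m"
    show "((\<lambda>t. f (x(i := t)) * g (x(i := t))) has_field_derivative
        f x * partial_deriv i g x + partial_deriv i f x * g x) (at (x i))" if "x \<in> U" for x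
      using DERIV_mult'[OF has_partial_deriv[OF Suc.prems(1) that i] has_partial_deriv[OF Suc.prems(2) that i]]
      by (simp only: fun_upd_triv)
    show "times_cont_diff m k U (\<lambda>x. f x * partial_deriv i g x + partial_deriv i f x * g x)"
      using Suc.prems i times_cont_diff_SucD[OF Suc.prems(1)] times_cont_diff_SucD[OF Suc.prems(2)]
      by (intro times_cont_diff_add[OF U] Suc.IH) auto
  qed
qed

lemma times_cont_diff_inverse:
  assumes U: "openin (Euclidean_space m) U" and nz: "\<And>x. x \<in> U \<Longrightarrow> f x \<noteq> 0"
  shows "times_cont_diff m k U f \<Longrightarrow> times_cont_diff m k U (\<lambda>x. inverse (f x))"
proof (induction k)
  case 0
  then show ?case using nz by (auto intro!: continuous_map_real_inverse)
next
  case (Suc k)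
  show ?case
  proof (rule times_cont_diff_SucI[OF U])
    show "continuous_map (subtopology (Euclidean_space m) U) euclideanreal (\<lambda>x. inverse (f x))"
      using Suc.prems nz by (intro continuous_map_real_inverse) auto
    fix i assume i: "i < m"
    show "((\<lambda>t. inverse (f (x(i := t)))) has_field_derivative
        (- 1) * (inverse (f x) * partial_deriv i f x * inverse (f x))) (at (x i))" if "x \<in> U" for x
      using DERIV_inverse'[OF has_partial_deriv[OF Suc.prems that i]] nz[OF that]
      by (simp only: fun_upd_triv mult_minus1 not_False_eq_True)
    show "times_cont_diff m k U (\<lambda>x. (- 1) * (inverse (f x) * partial_deriv i f x * inverse (f x)))"
      using Suc.prems i times_cont_diff_SucD[OF Suc.prems]
      by (intro times_cont_diff_mult[OF U] Suc.IH times_cont_diff_const) auto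
  qed
qed

lemma smooth_on_cong:
  "openin (Euclidean_space m) U \<Longrightarrow> smooth_on m U f \<Longrightarrow> (\<And>y. y \<in> U \<Longrightarrow> g y = f y) \<Longrightarrow> smooth_on m U g"
  unfolding smooth_on_def using times_cont_diff_cong[of m U f g] by metis

lemma smooth_on_arith:
  assumes "openin (Euclidean_space m) U"
  shows smooth_on_const: "smooth_on m U (\<lambda>x. c)"
    and smooth_on_add: "smooth_on m U f \<Longrightarrow> smooth_on m U g \<Longrightarrow> smooth_on m U (\<lambda>x. f x + g x)"
    and smooth_on_mult: "smooth_on m U f \<Longrightarrow> smooth_on m U g \<Longrightarrow> smooth_on m U (\<lambda>x. f x * g x)"
    and smooth_on_inverse: "smooth_on m U f \<Longrightarrow> (\<And>x. x \<in> U \<Longrightarrow> f x \<noteq> 0) \<Longrightarrow>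
           smooth_on m U (\<lambda>x. inverse (f x))"
  using assms by (auto simp: smooth_on_def times_cont_diff_const intro: times_cont_diff_add
      times_cont_diff_mult times_cont_diff_inverse)

lemma smooth_on_diff:
  assumes "openin (Euclidean_space m) U" "smooth_on m U f" "smooth_on m U g"
  shows "smooth_on m U (\<lambda>x. f x - g x)"
proof -
  have "smooth_on m U (\<lambda>x. f x + (- 1) * g x)"
    using assms by (intro smooth_on_arith)
  then show ?thesis by simp
qed

lemma smooth_on_sum:
  assumes "openin (Euclidean_space m) U" "\<And>i. i \<in> I \<Longrightarrow> smooth_on m U (f i)"
  shows "smooth_on m U (\<lambda>x. \<Sum>i\<in>I. f i x)"
  using assms(2)
  by (induction I rule: infinite_finite_induct) (auto intro: smooth_on_arith[OF assms(1)])

lemma smooth_on_continuous: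
  "smooth_on m U f \<Longrightarrow> continuous_map (subtopology (Euclidean_space m) U) euclideanreal f"
  using times_cont_diff_continuous by (auto simp: smooth_on_def)


section \<open>Invertible power series\<close>

text \<open>Formal variables are pairs; quantifiers over variables are kept unsplit.\<close>

declare split_paired_All [simp del] split_paired_Ex [simp del]

lemma sum_pair_cong:
  "(\<And>p q. (p, q) \<in> A \<Longrightarrow> f p q = g p q) \<Longrightarrow> (\<Sum>(p, q)\<in>A. f p q) = (\<Sum>(p, q)\<in>A. g p q)"
  by (rule sum.cong) auto

lemma finite_gvars:
  assumes "finite {j. n j \<noteq> 0}"
  shows "finite (gvars n)"
proof (rule finite_subset)
  show "gvars n \<subseteq> Sigma {j. n j \<noteq> 0} (\<lambda>j. {..<n j})" by (auto simp: gvars_def)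
qed (use assms in auto)

text \<open>The order of a monomial, counting all variables with weight 1.\<close>

definition mono_order :: "(int \<Rightarrow> nat) \<Rightarrow> multi_index \<Rightarrow> nat" where
  "mono_order n p = (\<Sum>v\<in>gvars n. p v)"

text \<open>The factorizations of the monomial with exponent \<open>r\<close> into two monomials.\<close>

abbreviation mono_splits :: "multi_index \<Rightarrow> (multi_index \<times> multi_index) set" where
  "mono_splits r \<equiv> {(p, q). \<forall>v. p v + q v = r v}"

lemma mono_order_split:
  assumes "(p, q) \<in> mono_splits r"
  shows "mono_order n p + mono_order n q = mono_order n r"
proof -
  have r: "r v = p v + q v" for v using assms by simp
  show ?thesis unfolding mono_order_def r sum.distrib ..
qed

lemma mono_order_pos:
  assumes "finite (gvars n)" "\<And>v. v \<notin> gvars n \<Longrightarrow> r v = 0" "(p, q) \<in> mono_splits r" "p \<noteq> (\<lambda>v. 0)"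
  shows "mono_order n q < mono_order n r"
proof -
  from assms(4) obtain v where v: "p v \<noteq> 0" by blast
  moreover have "p v + q v = r v" using assms(3) by simp
  ultimately have "v \<in> gvars n" using assms(2)[of v] by auto
  then have "mono_order n p > 0"
    using v assms(1) by (auto simp: mono_order_def intro: gr0I)
  then show ?thesis using mono_order_split[OF assms(3), of n] by simp
qed

lemma finite_mono_splits:
  assumes "finite (gvars n)" "\<And>v. v \<notin> gvars n \<Longrightarrow> r v = 0"
  shows "finite (mono_splits r)"
proof -
  let ?B = "{p. \<forall>v. (v \<in> gvars n \<longrightarrow> p v \<in> {..Max (r ` gvars n)}) \<and> (v \<notin> gvars n \<longrightarrow> p v = (0::nat))}"
  have "mono_splits r \<subseteq> ?B \<times> ?B"
  proof clarify
    fix p q assume pq: "\<forall>v. p v + q v = r v"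
    have "r v \<le> Max (r ` gvars n)" if "v \<in> gvars n" for v using that assms(1) by auto
    then have "p v \<le> Max (r ` gvars n)" "q v \<le> Max (r ` gvars n)" if "v \<in> gvars n" for v
      using that pq by (metis add_leE)+
    moreover have "p v = 0" "q v = 0" if "v \<notin> gvars n" for v
      using assms(2)[OF that] pq by (metis add_is_0)+
    ultimately show "p \<in> ?B \<and> q \<in> ?B" by simp
  qed
  moreover have "finite (?B \<times> ?B)"
    by (intro finite_cartesian_product finite_set_of_finite_funs[OF assms(1)]) simp_all
  ultimately show ?thesis by (rule finite_subset)
qed

lemma mono_sign_trivial [simp]: "mono_sign n (\<lambda>v. 0) q = 1"
  by (auto simp: mono_sign_def koszul_def intro!: prod.neutral)

lemma multi_indices_gvars: "r \<in> multi_indices n d \<Longrightarrow> v \<notin> gvars n \<Longrightarrow> r v = 0"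
  unfolding multi_indices_def by blast

lemma mono_splits_nonzero:
  assumes "(p, q) \<in> mono_splits r - {(\<lambda>v. 0, r)}"
  shows "p \<noteq> (\<lambda>v. 0)" "(p, q) \<in> mono_splits r"
proof -
  have eq: "p v + q v = r v" for v using assms by blast
  then show "(p, q) \<in> mono_splits r" by blast
  show "p \<noteq> (\<lambda>v. 0)"
  proof
    assume p: "p = (\<lambda>v. 0)"
    have "q = r" by (rule ext) (use eq p in simp)
    with p assms show False by blast
  qed
qed

lemma zero_multi_index [simp]: "(\<lambda>v. 0) \<in> multi_indices n d \<longleftrightarrow> d = 0"
  by (auto simp: multi_indices_def)

lemma mono_splits_zero [simp]: "mono_splits (\<lambda>v. 0) = {(\<lambda>v. 0, \<lambda>v. 0)}"
  by (auto simp: fun_eq_iff)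

text \<open>Successive approximations to the inverse \<open>h\<close> of a power series \<open>f\<close> of degree 0 over \<open>S\<close>, obtained by
  solving \<open>f h = 1\<close> for the coefficient of \<open>h\<close> at \<open>r\<close>; the other coefficients of \<open>h\<close> that occur in this
  equation have lower order. The coefficients of order below \<open>k\<close> are correct after \<open>k\<close> steps.\<close>

primrec series_inverse_approx ::
  "(int \<Rightarrow> nat) \<Rightarrow> point set \<Rightarrow> power_series \<Rightarrow> nat \<Rightarrow> power_series" where
  "series_inverse_approx n S f 0 = (\<lambda>r x. 0)"
| "series_inverse_approx n S f (Suc k) = (\<lambda>r x. if r \<in> multi_indices n 0 \<and> x \<in> S
     then inverse (f (\<lambda>v. 0) x) * ((if r = (\<lambda>v. 0) then 1 else 0) -
       (\<Sum>(p, q)\<in>mono_splits r - {(\<lambda>v. 0, r)}. mono_sign n p q * f p x * series_inverse_approx n S f k q x))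
     else 0)"

lemma series_inverse_approx_stable:
  assumes n: "finite (gvars n)"
  shows "mono_order n r < k \<Longrightarrow> series_inverse_approx n S f (Suc k) r = series_inverse_approx n S f k r"
proof (induction k arbitrary: r)
  case (Suc k)
  have IH: "series_inverse_approx n S f (Suc k) q = series_inverse_approx n S f k q"
    if "(p, q) \<in> mono_splits r - {(\<lambda>v. 0, r)}" "r \<in> multi_indices n 0" for p q
  proof -
    have "mono_order n q < mono_order n r"
      by (rule mono_order_pos[OF n multi_indices_gvars[OF that(2)] mono_splits_nonzero(2,1)[OF that(1)]])
    then show ?thesis using Suc by simp
  qed
  have eq: "(\<Sum>(p, q)\<in>mono_splits r - {(\<lambda>v. 0, r)}. mono_sign n p q * f p x * series_inverse_approx n S f (Suc k) q x)
      = (\<Sum>(p, q)\<in>mono_splits r - {(\<lambda>v. 0, r)}. mono_sign n p q * f p x * series_inverse_approx n S f k q x)"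
    if "r \<in> multi_indices n 0" for x
    by (rule sum_pair_cong) (simp only: IH that)
  have "series_inverse_approx n S f (Suc (Suc k)) r x = series_inverse_approx n S f (Suc k) r x" for x
  proof (cases "r \<in> multi_indices n 0")
    case True
    show ?thesis
      by (simp only: series_inverse_approx.simps(2)[of n S f "Suc k"]
          series_inverse_approx.simps(2)[of n S f k] flip: eq[OF True])
  qed simp
  then show ?case by (rule ext)
qed simp

text \<open>A power series of degree 0 is invertible if its body has no zeros.\<close>

lemma series_inverse:
  assumes fin: "finite (gvars n)" and S: "openin (Euclidean_space (n 0)) S"
    and f: "f \<in> gcarrier (model_alg n S) 0" and nz: "\<And>x. x \<in> S \<Longrightarrow> f (\<lambda>v. 0) x \<noteq> 0"
  obtains h where "h \<in> gcarrier (model_alg n S) 0"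
    "gmult (model_alg n S) 0 0 f h = gone (model_alg n S)"
proof
  let ?H = "series_inverse_approx n S f"
  \<comment> \<open>the coefficient at \<open>r\<close> is final from this step on\<close>
  define h where "h r = ?H (Suc (mono_order n r)) r" for r
  have h_eq: "?H k r = h r" if "mono_order n r < k" for k r
    using that
  proof (induction k)
    case (Suc k)
    show ?case
    proof (cases "mono_order n r = k")
      case False
      then show ?thesis using Suc series_inverse_approx_stable[OF fin, of r k] by simp
    qed (simp add: h_def)
  qed simp
  have fs: "smooth_on (n 0) S (f p)" for p
    using f smooth_on_const[OF S, of 0] by (cases "p \<in> multi_indices n 0") (auto simp: model_alg_def)
  have Hs: "smooth_on (n 0) S (?H k r)" for k r
  proof (induction k arbitrary: r)
    case 0
    then show ?case by (simp add: smooth_on_const[OF S])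
  next
    case (Suc k)
    show ?case
    proof (cases "r \<in> multi_indices n 0")
      case True
      have "smooth_on (n 0) S (\<lambda>x. inverse (f (\<lambda>v. 0) x) * ((if r = (\<lambda>v. 0) then 1 else 0) -
         (\<Sum>(p, q)\<in>mono_splits r - {(\<lambda>v. 0, r)}. mono_sign n p q * f p x * ?H k q x)))"
        unfolding case_prod_beta
        by (intro smooth_on_arith[OF S] smooth_on_diff[OF S] smooth_on_sum[OF S] fs nz Suc.IH)
      then show ?thesis
        by (rule smooth_on_cong[OF S]) (simp add: True)
    next
      case False
      then show ?thesis using smooth_on_const[OF S, of 0] by (simp add: smooth_on_cong[OF S])
    qed
  qed
  have "h r x = 0" if "r \<notin> multi_indices n 0 \<or> x \<notin> S" for r x
    using that by (auto simp: h_def)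
  moreover have "smooth_on (n 0) S (h r)" for r unfolding h_def by (rule Hs)
  ultimately show "h \<in> gcarrier (model_alg n S) 0"
    by (simp add: model_alg_def fun_eq_iff)
  have "(\<Sum>(p, q)\<in>mono_splits r. mono_sign n p q * f p x * h q x) = (if r = (\<lambda>v. 0) \<and> x \<in> S then 1 else 0)"
    if r: "r \<in> multi_indices n 0" for r x
  proof (cases "x \<in> S")
    case True
    have split: "mono_splits r = insert (\<lambda>v. 0, r) (mono_splits r - {(\<lambda>v. 0, r)})" by auto
    have fin': "finite (mono_splits r)"
      by (rule finite_mono_splits[OF fin]) (rule multi_indices_gvars[OF r])
    have "h q = ?H (mono_order n r) q" if "(p, q) \<in> mono_splits r - {(\<lambda>v. 0, r)}" for p q
    proof -
      have "mono_order n q < mono_order n r"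
        by (rule mono_order_pos[OF fin multi_indices_gvars[OF r] mono_splits_nonzero(2,1)[OF that]])
      then show ?thesis by (rule h_eq[symmetric])
    qed
    then have "(\<Sum>(p, q)\<in>mono_splits r - {(\<lambda>v. 0, r)}. mono_sign n p q * f p x * h q x)
       = (\<Sum>(p, q)\<in>mono_splits r - {(\<lambda>v. 0, r)}. mono_sign n p q * f p x * ?H (mono_order n r) q x)"
      by (intro sum_pair_cong) (simp only:)
    also have "f (\<lambda>v. 0) x * h r x = (if r = (\<lambda>v. 0) then 1 else 0) - \<dots>"
      using True r nz[OF True] by (simp add: h_def)
    finally show ?thesis
      using True fin' by (subst split, subst sum.insert) auto
  next
    case False
    then have "f p x = 0" for p
      using f by (cases "p \<in> multi_indices n 0") (auto simp: model_alg_def)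
    then show ?thesis using False by (auto intro!: sum.neutral)
  qed
  note coeff = this
  show "gmult (model_alg n S) 0 0 f h = gone (model_alg n S)"
  proof (intro ext)
    fix r x
    show "gmult (model_alg n S) 0 0 f h r x = gone (model_alg n S) r x"
    proof (cases "r \<in> multi_indices n 0")
      case True
      then show ?thesis using coeff[OF True, of x] by (simp add: model_alg_def)
    next
      case False
      then have "r \<noteq> (\<lambda>v. 0)" by auto
      then show ?thesis using False by (simp add: model_alg_def)
    qed
  qed
qed


section \<open>Presheaves and graded algebra\<close>

lemma presheafD:
  assumes "presheaf X F"
  shows presheaf_gvs: "openin X U \<Longrightarrow> graded_vector_space (sec F U)"
    and presheaf_res: "openin X U \<Longrightarrow> openin X V \<Longrightarrow> V \<subseteq> U \<Longrightarrow>
          rlinear (grade (sec F U) d) (grade (sec F V) d) (res F U V d)"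
    and presheaf_res_id: "openin X U \<Longrightarrow> x \<in> gcarrier (sec F U) d \<Longrightarrow> res F U U d x = x"
    and presheaf_res_res: "openin X U \<Longrightarrow> openin X V \<Longrightarrow> openin X W \<Longrightarrow> W \<subseteq> V \<Longrightarrow> V \<subseteq> U \<Longrightarrow>
          x \<in> gcarrier (sec F U) d \<Longrightarrow> res F V W d (res F U V d x) = res F U W d x"
  using assms by (simp_all add: presheaf_def)

lemma sheaf_presheaf: "sheaf X F \<Longrightarrow> presheaf X F"
  by (simp add: sheaf_def)

text \<open>Sections of a sheaf that agree locally are equal.\<close>

lemma sheaf_eqI:
  assumes F: "sheaf X F" and U: "openin X U" and x: "x \<in> gcarrier (sec F U) d" and y: "y \<in> gcarrier (sec F U) d"
    and loc: "\<And>m. m \<in> U \<Longrightarrow> \<exists>W. openin X W \<and> m \<in> W \<and> W \<subseteq> U \<and> res F U W d x = res F U W d y"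
  shows "x = y"
proof -
  let ?\<U> = "{W. openin X W \<and> W \<subseteq> U \<and> res F U W d x = res F U W d y}"
  have eq: "\<Union>?\<U> = U" using loc by blast
  have "\<forall>V\<in>?\<U>. openin X V" by blast
  then have "(\<forall>x\<in>gcarrier (sec F (\<Union>?\<U>)) d. \<forall>y\<in>gcarrier (sec F (\<Union>?\<U>)) d.
           (\<forall>V\<in>?\<U>. res F (\<Union>?\<U>) V d x = res F (\<Union>?\<U>) V d y) \<longrightarrow> x = y)"
    using F unfolding sheaf_def by blast
  then show ?thesis unfolding eq using x y by blast
qed

lemma koszul_zero [simp]: "koszul 0 i = 1" "koszul i 0 = 1"
  by (simp_all add: koszul_def)

lemma graded_comm_algebraD:
  assumes "graded_comm_algebra A"
  shows "graded_vector_space A"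
    and "rbilinear (grade A i) (grade A j) (grade A (i + j)) (gmult A i j)"
    and "x \<in> gcarrier A i \<Longrightarrow> y \<in> gcarrier A j \<Longrightarrow> z \<in> gcarrier A k \<Longrightarrow>
        gmult A (i + j) k (gmult A i j x y) z = gmult A i (j + k) x (gmult A j k y z)"
    and "x \<in> gcarrier A i \<Longrightarrow> y \<in> gcarrier A j \<Longrightarrow>
        gmult A i j x y = koszul i j \<odot>\<^bsub>grade A (i + j)\<^esub> gmult A j i y x"
    and "gone A \<in> gcarrier A 0"
    and "x \<in> gcarrier A i \<Longrightarrow> gmult A 0 i (gone A) x = x"
proof -
  note a = assms[unfolded graded_comm_algebra_def]
  show "graded_vector_space A" "gone A \<in> gcarrier A 0" using a by blast+
  show "rbilinear (grade A i) (grade A j) (grade A (i + j)) (gmult A i j)"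
    using a[THEN conjunct2, THEN conjunct1] by blast
  show "x \<in> gcarrier A i \<Longrightarrow> y \<in> gcarrier A j \<Longrightarrow> z \<in> gcarrier A k \<Longrightarrow>
        gmult A (i + j) k (gmult A i j x y) z = gmult A i (j + k) x (gmult A j k y z)"
    using a[THEN conjunct2, THEN conjunct2, THEN conjunct1] by blast
  show "x \<in> gcarrier A i \<Longrightarrow> y \<in> gcarrier A j \<Longrightarrow>
        gmult A i j x y = koszul i j \<odot>\<^bsub>grade A (i + j)\<^esub> gmult A j i y x"
    using a[THEN conjunct2, THEN conjunct2, THEN conjunct2, THEN conjunct1] by blast
  show "x \<in> gcarrier A i \<Longrightarrow> gmult A 0 i (gone A) x = x"
    using a[THEN conjunct2, THEN conjunct2, THEN conjunct2, THEN conjunct2] by blast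
qed

lemma graded_moduleD:
  assumes "graded_module A P"
  shows "graded_vector_space P"
    and "rbilinear (grade A i) (grade P j) (grade P (i + j)) (gact P i j)"
    and "f \<in> gcarrier A i \<Longrightarrow> g \<in> gcarrier A j \<Longrightarrow> x \<in> gcarrier P k \<Longrightarrow>
        gact P (i + j) k (gmult A i j f g) x = gact P i (j + k) f (gact P j k g x)"
    and "x \<in> gcarrier P i \<Longrightarrow> gact P 0 i (gone A) x = x"
  using assms by (simp_all add: graded_module_def)

lemma rbilinearD:
  assumes "rbilinear M N P b"
  shows "x \<in> carrier M \<Longrightarrow> rlinear N P (b x)" "y \<in> carrier N \<Longrightarrow> rlinear M P (\<lambda>x. b x y)"
    and "x \<in> carrier M \<Longrightarrow> y \<in> carrier N \<Longrightarrow> b x y \<in> carrier P"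
  using assms rlinearD(1)[of N P "b x" y] by (simp_all add: rbilinear_def)

lemma algebra_sheafD:
  assumes "algebra_sheaf X C"
  shows "sheaf X C" "presheaf X C"
    and "openin X U \<Longrightarrow> graded_comm_algebra (sec C U)"
    and "openin X U \<Longrightarrow> openin X V \<Longrightarrow> V \<subseteq> U \<Longrightarrow> res C U V 0 (gone (sec C U)) = gone (sec C V)"
    and "openin X U \<Longrightarrow> openin X V \<Longrightarrow> V \<subseteq> U \<Longrightarrow> f \<in> gcarrier (sec C U) i \<Longrightarrow> g \<in> gcarrier (sec C U) j \<Longrightarrow>
           res C U V (i + j) (gmult (sec C U) i j f g)
             = gmult (sec C V) i j (res C U V i f) (res C U V j g)"
  using assms by (simp_all add: algebra_sheaf_def sheaf_presheaf)


lemma module_sheafD: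
  assumes "module_sheaf X C F"
  shows "sheaf X F" "presheaf X F"
    and "openin X U \<Longrightarrow> graded_module (sec C U) (sec F U)"
    and "openin X U \<Longrightarrow> openin X V \<Longrightarrow> V \<subseteq> U \<Longrightarrow> f \<in> gcarrier (sec C U) i \<Longrightarrow> x \<in> gcarrier (sec F U) j \<Longrightarrow>
           res F U V (i + j) (gact (sec F U) i j f x)
             = gact (sec F V) i j (res C U V i f) (res F U V j x)"
  using assms by (simp_all add: module_sheaf_def sheaf_presheaf)

lemma mod_homD:
  assumes "mod_hom X C F G \<alpha>" "openin X U"
  shows "rlinear (grade (sec F U) d) (grade (sec G U) d) (\<alpha> U d)"
    and "openin X V \<Longrightarrow> V \<subseteq> U \<Longrightarrow> x \<in> gcarrier (sec F U) d \<Longrightarrow>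
           res G U V d (\<alpha> U d x) = \<alpha> V d (res F U V d x)"
    and "f \<in> gcarrier (sec C U) i \<Longrightarrow> x \<in> gcarrier (sec F U) j \<Longrightarrow>
           \<alpha> U (i + j) (gact (sec F U) i j f x) = gact (sec G U) i j f (\<alpha> U j x)"
  using assms by (simp_all add: mod_hom_def psh_hom_def)


section \<open>Values of functions on a graded manifold\<close>

text \<open>A chart \<open>\<alpha>\<close> over \<open>V\<close>, with underlying homeomorphism \<open>\<phi>\<close>. Over an open subset of \<open>V\<close> it turns functions
  into power series, and \<open>\<alpha> W d f p (\<phi> a)\<close> is the coefficient of \<open>f\<close> at the monomial \<open>p\<close> and the point \<open>a\<close>.\<close>

locale chart =
  fixes n :: "int \<Rightarrow> nat" and X :: "'p topology" and C :: "('p,'a) alg_psh"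
    and V :: "'p set" and \<phi> :: "'p \<Rightarrow> point" and \<alpha> :: "'p set \<Rightarrow> int \<Rightarrow> 'a \<Rightarrow> power_series"
  assumes C: "algebra_sheaf X C" and fin: "finite {j. n j \<noteq> 0}" and chart: "graded_chart n X C V \<phi> \<alpha>"
begin

lemma V_open: "openin X V"
  using chart by (simp add: graded_chart_def)

lemma image_open:
  assumes "openin X W" "W \<subseteq> V"
  shows "openin (Euclidean_space (n 0)) (\<phi> ` W)"
proof -
  have hom: "homeomorphic_map (subtopology X V) (subtopology (Euclidean_space (n 0)) (\<phi> ` V)) \<phi>"
    and V: "openin (Euclidean_space (n 0)) (\<phi> ` V)"
    using chart by (auto simp: graded_chart_def)
  have "openin (subtopology X V) W"
    using assms V_open by (simp add: openin_open_subtopology)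
  then have "openin (subtopology (Euclidean_space (n 0)) (\<phi> ` V)) (\<phi> ` W)"
    using homeomorphic_imp_open_map[OF hom] by (simp add: open_map_def)
  then show ?thesis using V openin_trans_full by blast
qed

lemma preimage_open:
  assumes "openin X W" "W \<subseteq> V" "openin (Euclidean_space (n 0)) S"
  shows "openin X {m \<in> W. \<phi> m \<in> S}"
proof -
  have "continuous_map (subtopology X V) (Euclidean_space (n 0)) \<phi>"
    using chart homeomorphic_imp_continuous_map continuous_map_in_subtopology
    by (fastforce simp: graded_chart_def)
  then have "openin (subtopology X V) {m \<in> topspace (subtopology X V). \<phi> m \<in> S}"
    using assms(3) by (rule openin_continuous_map_preimage)
  then have "openin X {m \<in> topspace (subtopology X V). \<phi> m \<in> S}"
    using V_open openin_trans_full by blast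
  from openin_Int[OF this assms(1)] have "openin X ({m \<in> topspace (subtopology X V). \<phi> m \<in> S} \<inter> W)" .
  moreover have "{m \<in> topspace (subtopology X V). \<phi> m \<in> S} \<inter> W = {m \<in> W. \<phi> m \<in> S}"
    using assms openin_subset[OF assms(1)] by auto
  ultimately show ?thesis by simp
qed

lemma chart_hom:
  assumes W: "openin X W" "W \<subseteq> V"
  shows coord_linear: "rlinear (grade (sec C W) d) (grade (model_alg n (\<phi> ` W)) d) (\<alpha> W d)"
    and coord_one: "\<alpha> W 0 (gone (sec C W)) = gone (model_alg n (\<phi> ` W))"
    and coord_mult: "f \<in> gcarrier (sec C W) i \<Longrightarrow> g \<in> gcarrier (sec C W) j \<Longrightarrow>
      \<alpha> W (i + j) (gmult (sec C W) i j f g) = gmult (model_alg n (\<phi> ` W)) i j (\<alpha> W i f) (\<alpha> W j g)"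
    and coord_inj: "f \<in> gcarrier (sec C W) d \<Longrightarrow> g \<in> gcarrier (sec C W) d \<Longrightarrow> \<alpha> W d f = \<alpha> W d g \<Longrightarrow> f = g"
    and coord_surj: "h \<in> gcarrier (model_alg n (\<phi> ` W)) d \<Longrightarrow> \<exists>f\<in>gcarrier (sec C W) d. \<alpha> W d f = h"
proof -
  let ?Y = "subtopology X V" and ?M = "psh_transport \<phi> (model n)"
  have oW: "openin ?Y W" using W V_open by (simp add: openin_open_subtopology)
  have sM: "sec ?M W = model_alg n (\<phi> ` W)" by (simp add: psh_transport_def model_def)
  have iso: "alg_iso ?Y C ?M \<alpha>" using chart by (simp add: graded_chart_def)
  then have hom: "alg_hom ?Y C ?M \<alpha>" by (simp add: alg_iso_def)
  show "rlinear (grade (sec C W) d) (grade (model_alg n (\<phi> ` W)) d) (\<alpha> W d)"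
    using hom oW by (simp add: alg_hom_def psh_hom_def flip: sM)
  show "\<alpha> W 0 (gone (sec C W)) = gone (model_alg n (\<phi> ` W))"
    using hom oW by (simp add: alg_hom_def flip: sM)
  show "\<alpha> W (i + j) (gmult (sec C W) i j f g) = gmult (model_alg n (\<phi> ` W)) i j (\<alpha> W i f) (\<alpha> W j g)"
    if "f \<in> gcarrier (sec C W) i" "g \<in> gcarrier (sec C W) j"
    using hom oW that by (simp add: alg_hom_def flip: sM)
  obtain \<beta> where \<beta>: "alg_hom ?Y ?M C \<beta>" "mutually_inverse ?Y C ?M \<alpha> \<beta>"
    using iso by (auto simp: alg_iso_def)
  show "f = g" if "f \<in> gcarrier (sec C W) d" "g \<in> gcarrier (sec C W) d" "\<alpha> W d f = \<alpha> W d g"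
    using \<beta>(2) oW that unfolding mutually_inverse_def by metis
  have lin: "rlinear (grade (sec ?M W) d) (grade (sec C W) d) (\<beta> W d)"
    using \<beta>(1) oW by (simp add: alg_hom_def psh_hom_def)
  show "\<exists>f\<in>gcarrier (sec C W) d. \<alpha> W d f = h" if "h \<in> gcarrier (model_alg n (\<phi> ` W)) d"
  proof
    show "\<beta> W d h \<in> gcarrier (sec C W) d" using rlinearD(1)[OF lin] that sM by simp
    show "\<alpha> W d (\<beta> W d h) = h"
      using \<beta>(2) oW that sM unfolding mutually_inverse_def by simp
  qed
qed

lemma coord_res:
  assumes W: "openin X W" "W \<subseteq> V" and W': "openin X W'" "W' \<subseteq> W" and f: "f \<in> gcarrier (sec C W) d"
  shows "\<alpha> W' d (res C W W' d f) = (\<lambda>p x. if x \<in> \<phi> ` W' then \<alpha> W d f p x else 0)"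
proof -
  let ?Y = "subtopology X V" and ?M = "psh_transport \<phi> (model n)"
  have "openin ?Y W" "openin ?Y W'" using W W' V_open by (auto simp: openin_open_subtopology)
  moreover have "psh_hom ?Y C ?M \<alpha>" using chart by (simp add: graded_chart_def alg_iso_def alg_hom_def)
  ultimately have "\<alpha> W' d (res C W W' d f) = res ?M W W' d (\<alpha> W d f)"
    using W' f by (simp add: psh_hom_def)
  then show ?thesis by (simp add: psh_transport_def model_def)
qed

lemma coeff_res:
  assumes "openin X W" "W \<subseteq> V" "openin X W'" "W' \<subseteq> W" "f \<in> gcarrier (sec C W) d" "a \<in> W'"
  shows "\<alpha> W' d (res C W W' d f) p (\<phi> a) = \<alpha> W d f p (\<phi> a)"
  using coord_res[OF assms(1-5)] assms(6) by simp

lemma coeff_functional: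
  assumes "openin X W" "W \<subseteq> V"
  shows "functional (grade (sec C W) d) (\<lambda>f. \<alpha> W d f p x)"
  using rlinearD(2,3)[OF coord_linear[OF assms, of d]] by (simp add: functional_def model_alg_def)

lemma coeff_outside:
  assumes "openin X W" "W \<subseteq> V" "f \<in> gcarrier (sec C W) d" "p \<notin> multi_indices n d \<or> x \<notin> \<phi> ` W"
  shows "\<alpha> W d f p x = 0"
  using rlinearD(1)[OF coord_linear[OF assms(1,2), of d] assms(3)] assms(4)
  by (cases "p \<in> multi_indices n d") (auto simp: model_alg_def)

text \<open>The coefficients at all monomials and points form a separating family of functionals.\<close>

lemma coeff_separate:
  assumes W: "openin X W" "W \<subseteq> V" and f: "f \<in> gcarrier (sec C W) d"
    and zero: "\<And>p a. p \<in> multi_indices n d \<Longrightarrow> a \<in> W \<Longrightarrow> \<alpha> W d f p (\<phi> a) = 0"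
  shows "f = \<zero>\<^bsub>grade (sec C W) d\<^esub>"
proof -
  have r: "rmodule (grade (sec C W) d)"
    using gvs_rmodule[OF graded_comm_algebraD(1)[OF algebra_sheafD(3)[OF C W(1)]]] .
  have z: "\<zero>\<^bsub>grade (sec C W) d\<^esub> \<in> gcarrier (sec C W) d" using r by simp
  have "\<alpha> W d \<zero>\<^bsub>grade (sec C W) d\<^esub> p x = 0" for p x
    using rlinearD(3)[OF coord_linear[OF W, of d] z, of 0] rmodule_smult(4)[OF r z] by (simp add: model_alg_def)
  moreover have "\<alpha> W d f p x = 0" for p x
  proof (cases "p \<in> multi_indices n d \<and> x \<in> \<phi> ` W")
    case True
    then obtain a where "x = \<phi> a" "a \<in> W" by blast
    then show ?thesis using zero True by simp
  next
    case False
    then show ?thesis using coeff_outside[OF W f] by simp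
  qed
  ultimately have "\<alpha> W d f = \<alpha> W d \<zero>\<^bsub>grade (sec C W) d\<^esub>" by (intro ext) simp
  then show ?thesis using coord_inj[OF W f z] by simp
qed

lemma coeff_mult:
  assumes "openin X W" "W \<subseteq> V" "f \<in> gcarrier (sec C W) i" "g \<in> gcarrier (sec C W) j"
  shows "\<alpha> W (i + j) (gmult (sec C W) i j f g) r x = (if r \<in> multi_indices n (i + j)
     then \<Sum>(p, q)\<in>mono_splits r. mono_sign n p q * \<alpha> W i f p x * \<alpha> W j g q x else 0)"
  using coord_mult[OF assms] by (simp add: model_alg_def)

lemma body_mult:
  assumes "openin X W" "W \<subseteq> V" "f \<in> gcarrier (sec C W) 0" "g \<in> gcarrier (sec C W) 0"
  shows "\<alpha> W 0 (gmult (sec C W) 0 0 f g) (\<lambda>v. 0) x = \<alpha> W 0 f (\<lambda>v. 0) x * \<alpha> W 0 g (\<lambda>v. 0) x"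
  using coeff_mult[OF assms, of "\<lambda>v. 0" x, unfolded mono_splits_zero] by simp

text \<open>A function whose body does not vanish at a point is invertible near that point.\<close>

lemma invertible_near:
  assumes W: "openin X W" "W \<subseteq> V" and g: "g \<in> gcarrier (sec C W) 0"
    and a: "a \<in> W" "\<alpha> W 0 g (\<lambda>v. 0) (\<phi> a) \<noteq> 0"
  obtains W' h where "openin X W'" "a \<in> W'" "W' \<subseteq> W" "h \<in> gcarrier (sec C W') 0"
    "gmult (sec C W') 0 0 (res C W W' 0 g) h = gone (sec C W')"
proof -
  let ?E = "Euclidean_space (n 0)" and ?b = "\<alpha> W 0 g (\<lambda>v. 0)"
  have \<phi>W: "openin ?E (\<phi> ` W)" using W by (rule image_open)
  have "smooth_on (n 0) (\<phi> ` W) ?b"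
    using rlinearD(1)[OF coord_linear[OF W, of 0] g] by (simp add: model_alg_def)
  then have "continuous_map (subtopology ?E (\<phi> ` W)) euclideanreal ?b" by (rule smooth_on_continuous)
  then have "openin (subtopology ?E (\<phi> ` W)) {y \<in> topspace (subtopology ?E (\<phi> ` W)). ?b y \<in> - {0}}"
    by (rule openin_continuous_map_preimage) (simp add: open_Compl flip: open_openin)
  then have "openin ?E {y \<in> topspace (subtopology ?E (\<phi> ` W)). ?b y \<in> - {0}}"
    using \<phi>W openin_trans_full by blast
  moreover have "{y \<in> topspace (subtopology ?E (\<phi> ` W)). ?b y \<in> - {0}} = {y \<in> \<phi> ` W. ?b y \<noteq> 0}"
    using openin_subset[OF \<phi>W] by auto
  ultimately have S: "openin ?E {y \<in> \<phi> ` W. ?b y \<noteq> 0}" by simp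
  \<comment> \<open>the part of \<open>W\<close> where the body does not vanish\<close>
  define W' where "W' = {m \<in> W. \<phi> m \<in> {y \<in> \<phi> ` W. ?b y \<noteq> 0}}"
  have W': "openin X W'" unfolding W'_def using W S by (rule preimage_open)
  have sub: "W' \<subseteq> W" by (auto simp: W'_def)
  then have W'V: "W' \<subseteq> V" using W(2) by simp
  have aW': "a \<in> W'" using a by (auto simp: W'_def)
  let ?g = "res C W W' 0 g"
  have rg: "?g \<in> gcarrier (sec C W') 0"
    using rlinearD(1)[OF presheaf_res[OF algebra_sheafD(2)[OF C] W(1) W' sub] g] .
  have "\<alpha> W' 0 ?g (\<lambda>v. 0) x \<noteq> 0" if "x \<in> \<phi> ` W'" for x
    using that coord_res[OF W W' sub g] by (auto simp: W'_def)
  then obtain k where k: "k \<in> gcarrier (model_alg n (\<phi> ` W')) 0"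
    "gmult (model_alg n (\<phi> ` W')) 0 0 (\<alpha> W' 0 ?g) k = gone (model_alg n (\<phi> ` W'))"
    using series_inverse[OF finite_gvars[OF fin] image_open[OF W' W'V]
        rlinearD(1)[OF coord_linear[OF W' W'V] rg]] by blast
  obtain h where h: "h \<in> gcarrier (sec C W') 0" "\<alpha> W' 0 h = k"
    using coord_surj[OF W' W'V k(1)] by blast
  have A: "graded_comm_algebra (sec C W')" by (rule algebra_sheafD(3)[OF C W'])
  have "gmult (sec C W') 0 0 ?g h = gone (sec C W')"
  proof (rule coord_inj[OF W' W'V, where d = 0])
    show "gmult (sec C W') 0 0 ?g h \<in> gcarrier (sec C W') 0"
      using rbilinearD(3)[OF graded_comm_algebraD(2)[OF A, of 0 0] rg h(1)] by simp
    show "gone (sec C W') \<in> gcarrier (sec C W') 0" by (rule graded_comm_algebraD(5)[OF A])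
    show "\<alpha> W' 0 (gmult (sec C W') 0 0 ?g h) = \<alpha> W' 0 (gone (sec C W'))"
      using coord_mult[OF W' W'V rg h(1)] h(2) k(2) coord_one[OF W' W'V] by simp
  qed
  then show ?thesis by (rule that[OF W' aW' sub h(1)])
qed

end

text \<open>The value of a function does not depend on the chart: if \<open>f\<close> had the values \<open>s \<noteq> r\<close> in two charts,
  \<open>f - s\<close> would be invertible near the point by the second chart, but its body vanishes in the first.\<close>

lemma body_chart_independent:
  assumes ch: "chart n X C V \<phi> \<alpha>" and ch': "chart n X C V' \<phi>' \<alpha>'"
    and W: "openin X W" "W \<subseteq> V" "W \<subseteq> V'" and f: "f \<in> gcarrier (sec C W) d" and a: "a \<in> W"
  shows "\<alpha> W d f (\<lambda>v. 0) (\<phi> a) = \<alpha>' W d f (\<lambda>v. 0) (\<phi>' a)"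
proof (cases "d = 0")
  case False
  then show ?thesis
    using chart.coeff_outside[OF ch W(1,2) f] chart.coeff_outside[OF ch' W(1,3) f] by simp
next
  case True
  interpret A: chart n X C V \<phi> \<alpha> by fact
  interpret B: chart n X C V' \<phi>' \<alpha>' by fact
  note C = A.C
  let ?R = "grade (sec C W) 0" and ?z = "\<lambda>v. 0 :: nat"
  have f0: "f \<in> gcarrier (sec C W) 0" using f True by simp
  have alg: "graded_comm_algebra (sec C W)" by (rule algebra_sheafD(3)[OF C W(1)])
  have R: "rmodule ?R" using gvs_rmodule[OF graded_comm_algebraD(1)[OF alg]] .
  have one: "gone (sec C W) \<in> carrier ?R" by (rule graded_comm_algebraD(5)[OF alg])
  \<comment> \<open>\<open>g = f - s\<close> has body 0 at the point in the first chart\<close>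
  define s where "s = \<alpha> W 0 f ?z (\<phi> a)"
  define g where "g = f \<oplus>\<^bsub>?R\<^esub> (- s) \<odot>\<^bsub>?R\<^esub> gone (sec C W)"
  have g: "g \<in> carrier ?R" using f0 one R by (simp add: g_def)
  have g1: "\<alpha> W 0 g ?z (\<phi> a) = 0"
    using A.coeff_functional[OF W(1,2), of 0 ?z "\<phi> a"] f0 one R A.coord_one[OF W(1,2)] a
    by (simp add: g_def functional_def s_def model_alg_def)
  have g2: "\<alpha>' W 0 g ?z (\<phi>' a) = \<alpha>' W 0 f ?z (\<phi>' a) - s"
    using B.coeff_functional[OF W(1,3), of 0 ?z "\<phi>' a"] f0 one R B.coord_one[OF W(1,3)] a
    by (simp add: g_def functional_def model_alg_def)
  have "\<alpha>' W 0 g ?z (\<phi>' a) = 0"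
  proof (rule ccontr)
    assume "\<alpha>' W 0 g ?z (\<phi>' a) \<noteq> 0"
    then obtain W' h where W': "openin X W'" "a \<in> W'" "W' \<subseteq> W" and h: "h \<in> gcarrier (sec C W') 0"
      and inv: "gmult (sec C W') 0 0 (res C W W' 0 g) h = gone (sec C W')"
      using B.invertible_near[OF W(1,3) g a] by metis
    have W'V: "W' \<subseteq> V" using W' W by simp
    have rg: "res C W W' 0 g \<in> gcarrier (sec C W') 0"
      using rlinearD(1)[OF presheaf_res[OF algebra_sheafD(2)[OF C] W(1) W'(1,3)] g] .
    have "\<alpha> W' 0 (gone (sec C W')) ?z (\<phi> a) = \<alpha> W' 0 (res C W W' 0 g) ?z (\<phi> a) * \<alpha> W' 0 h ?z (\<phi> a)"
      using A.body_mult[OF W'(1) W'V rg h, of "\<phi> a"] inv by simp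
    also have "\<alpha> W' 0 (res C W W' 0 g) ?z (\<phi> a) = 0"
      using A.coeff_res[OF W(1,2) W'(1,3) g W'(2)] g1 by simp
    finally show False
      using A.coord_one[OF W'(1) W'V] W'(2) by (simp add: model_alg_def)
  qed
  then show ?thesis using g2 True by (simp add: s_def)
qed

lemma body_value_eq:
  assumes ch: "chart n X C V \<phi> \<alpha>" and U: "openin X U" and f: "f \<in> gcarrier (sec C U) d" and a: "a \<in> U" "a \<in> V"
  shows "body_value n X C U d f a = \<alpha> (U \<inter> V) d (res C U (U \<inter> V) d f) (\<lambda>v. 0) (\<phi> a)"
proof -
  interpret A: chart n X C V \<phi> \<alpha> by fact
  note C = A.C
  have indep: "\<alpha>' (U \<inter> V') d (res C U (U \<inter> V') d f) (\<lambda>v. 0) (\<phi>' a)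
      = \<alpha> (U \<inter> V) d (res C U (U \<inter> V) d f) (\<lambda>v. 0) (\<phi> a)"
    if ch': "graded_chart n X C V' \<phi>' \<alpha>'" and aV': "a \<in> V'" for V' \<phi>' \<alpha>'
  proof -
    interpret B: chart n X C V' \<phi>' \<alpha>' using C A.fin ch' by unfold_locales
    let ?W = "U \<inter> V \<inter> V'"
    have o: "openin X (U \<inter> V)" "openin X (U \<inter> V')" "openin X ?W"
      using U A.V_open B.V_open by auto
    have sub: "?W \<subseteq> U \<inter> V'" by blast
    have rf: "res C U W d f \<in> gcarrier (sec C W) d" if "openin X W" "W \<subseteq> U" for W
      using rlinearD(1)[OF presheaf_res[OF algebra_sheafD(2)[OF C] U that] f] .
    have rr: "res C W ?W d (res C U W d f) = res C U ?W d f" if "openin X W" "W \<subseteq> U" "?W \<subseteq> W" for W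
      using presheaf_res_res[OF algebra_sheafD(2)[OF C] U that(1) o(3) that(3,2) f] .
    have "\<alpha> (U \<inter> V) d (res C U (U \<inter> V) d f) (\<lambda>v. 0) (\<phi> a) = \<alpha> ?W d (res C U ?W d f) (\<lambda>v. 0) (\<phi> a)"
      using A.coeff_res[OF o(1) Int_lower2 o(3) Int_lower1 rf[OF o(1) Int_lower1], of a "\<lambda>v. 0"]
        rr[OF o(1) Int_lower1 Int_lower1] a aV' by simp
    also have "\<dots> = \<alpha>' ?W d (res C U ?W d f) (\<lambda>v. 0) (\<phi>' a)"
      by (rule body_chart_independent[OF ch B.chart_axioms o(3) _ _ rf[OF o(3)]]) (use a aV' in auto)
    also have "\<dots> = \<alpha>' (U \<inter> V') d (res C U (U \<inter> V') d f) (\<lambda>v. 0) (\<phi>' a)"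
      using B.coeff_res[OF o(2) Int_lower2 o(3) sub rf[OF o(2) Int_lower1], of a "\<lambda>v. 0"]
        rr[OF o(2) Int_lower1 sub] a aV' by simp
    finally show ?thesis by simp
  qed
  show ?thesis
    unfolding body_value_def
  proof (rule the_equality)
    show "r = \<alpha> (U \<inter> V) d (res C U (U \<inter> V) d f) (\<lambda>v. 0) (\<phi> a)"
      if "\<forall>V \<phi> \<alpha>. graded_chart n X C V \<phi> \<alpha> \<and> a \<in> V \<longrightarrow>
        \<alpha> (U \<inter> V) d (res C U (U \<inter> V) d f) (\<lambda>v. 0) (\<phi> a) = r" for r
      using that A.chart a by metis
  qed (use indep in blast)
qed


section \<open>Actions and restrictions on tensor products\<close>

lemma gca_rmodule: "graded_comm_algebra A \<Longrightarrow> rmodule (grade A d)"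
  by (rule gvs_rmodule[OF graded_comm_algebraD(1)])

lemma left_act:
  assumes A: "graded_comm_algebra A" and Q: "graded_vector_space Q" and f: "f \<in> gcarrier A p"
  shows left_act_linear: "rlinear (gtensor A Q d) (gtensor A Q (p + d)) (left_act A Q p d f)"
    and left_act_tens: "g \<in> gcarrier A i \<Longrightarrow> y \<in> gcarrier Q (d - i) \<Longrightarrow>
      left_act A Q p d f (tens A Q d i g y) = tens A Q (p + d) (p + i) (gmult A p i f g) y"
proof -
  interpret tensor_product A Q by unfold_locales (use A Q graded_comm_algebraD(1) in auto)
  have \<rho>: "rlinear (grade A i) (grade A (p + i)) (gmult A p i f)" for i
    by (rule rbilinearD(1)[OF graded_comm_algebraD(2)[OF A] f])
  have \<sigma>: "rlinear (grade Q (d - i)) (grade Q (p + d - (p + i))) (\<lambda>y. y)" for i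
    by (simp add: rlinear_id)
  note ind = gtensor_induced_map[OF tensor_product_axioms tensor_product_axioms,
      where s = "\<lambda>i. p + i" and \<rho> = "\<lambda>i. gmult A p i f" and d = d and d' = "p + d"
        and \<sigma> = "\<lambda>i y. y" and c = "\<lambda>i. 1", OF \<rho> \<sigma>]
  show "rlinear (gtensor A Q d) (gtensor A Q (p + d)) (left_act A Q p d f)"
    unfolding left_act_def by (rule ind(1))
  show "left_act A Q p d f (tens A Q d i g y) = tens A Q (p + d) (p + i) (gmult A p i f g) y"
    if "g \<in> gcarrier A i" "y \<in> gcarrier Q (d - i)"
  proof -
    have "tens A Q (p + d) (p + i) (gmult A p i f g) y \<in> carrier (gtensor A Q (p + d))"
      using that rlinearD(1)[OF \<rho>] by (intro tens_closed) auto
    then show ?thesis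
      unfolding left_act_def using ind(2)[OF that] rmodule_smult(3)[OF rmodule_gtensor] by simp
  qed
qed

lemma right_act_tens:
  assumes A: "graded_comm_algebra A" and Qm: "graded_module A Q" and f: "f \<in> gcarrier A p"
    and gy: "g \<in> gcarrier A i" "y \<in> gcarrier Q (d - i)"
  shows "right_act A Q p d f (tens A Q d i g y)
    = koszul p i \<odot>\<^bsub>gtensor A Q (p + d)\<^esub> tens A Q (p + d) i g (gact Q p (d - i) f y)"
proof -
  interpret tensor_product A Q
    by unfold_locales (use A Qm graded_comm_algebraD(1) graded_moduleD(1) in auto)
  have \<sigma>: "rlinear (grade Q (d - i)) (grade Q (p + d - i)) (gact Q p (d - i) f)" for i
    using rbilinearD(1)[OF graded_moduleD(2)[OF Qm] f, of "d - i"] by (simp add: algebra_simps)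
  from gtensor_induced_tens[OF tensor_product_axioms tensor_product_axioms,
      where s = "\<lambda>i. i" and \<rho> = "\<lambda>i x. x" and d = d and d' = "p + d"
        and \<sigma> = "\<lambda>i. gact Q p (d - i) f" and c = "koszul p", OF rlinear_id \<sigma> gy]
  show ?thesis unfolding right_act_def .
qed

lemma tens_map:
  assumes PQ: "tensor_product P Q" and PQ': "tensor_product P' Q'"
    and \<rho>: "\<And>i. rlinear (grade P i) (grade P' i) (\<rho> i)"
    and \<sigma>: "\<And>i. rlinear (grade Q i) (grade Q' i) (\<sigma> i)"
  shows tens_map_linear: "rlinear (gtensor P Q d) (gtensor P' Q' d) (tens_map P' Q' d \<rho> \<sigma>)"
    and tens_map_tens: "x \<in> gcarrier P i \<Longrightarrow> y \<in> gcarrier Q (d - i) \<Longrightarrow>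
      tens_map P' Q' d \<rho> \<sigma> (tens P Q d i x y) = tens P' Q' d i (\<rho> i x) (\<sigma> (d - i) y)"
proof -
  interpret B: tensor_product P' Q' by fact
  note ind = gtensor_induced_map[OF PQ PQ', where s = "\<lambda>i. i" and \<rho> = \<rho> and d = d and d' = d
      and \<sigma> = "\<lambda>i. \<sigma> (d - i)" and c = "\<lambda>i. 1", OF \<rho> \<sigma>]
  show "rlinear (gtensor P Q d) (gtensor P' Q' d) (tens_map P' Q' d \<rho> \<sigma>)"
    unfolding tens_map_def by (rule ind(1))
  show "tens_map P' Q' d \<rho> \<sigma> (tens P Q d i x y) = tens P' Q' d i (\<rho> i x) (\<sigma> (d - i) y)"
    if "x \<in> gcarrier P i" "y \<in> gcarrier Q (d - i)"
  proof -
    have "tens P' Q' d i (\<rho> i x) (\<sigma> (d - i) y) \<in> carrier (gtensor P' Q' d)"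
      using that rlinearD(1)[OF \<rho>] rlinearD(1)[OF \<sigma>] by (intro B.tens_closed) auto
    then show ?thesis
      unfolding tens_map_def using ind(2)[OF that] rmodule_smult(3)[OF B.rmodule_gtensor] by simp
  qed
qed

section \<open>Invisible elements\<close>

context chart
begin

text \<open>A sum of products of \<open>q\<close> functions vanishing at \<open>a\<close> has no terms of order below \<open>q\<close> at \<open>a\<close>: to a
  term of such an order, one of the factors contributes only its body, whose value at \<open>a\<close> is 0. Here the order counts
  the formal variables only; derivatives along the base play no role.\<close>

lemma ideal_power_coeff:
  assumes U: "openin X U" and a: "a \<in> U" "a \<in> V"
    and f: "f \<in> ideal_power (sec C U) (vanishing_ideal n X C U a) q d"
  shows ideal_power_carrier: "f \<in> gcarrier (sec C U) d"
    and ideal_power_coeff_zero: "mono_order n r < q \<Longrightarrow> \<alpha> (U \<inter> V) d (res C U (U \<inter> V) d f) r (\<phi> a) = 0"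
proof -
  let ?W = "U \<inter> V" and ?I = "vanishing_ideal n X C U a"
  let ?c = "\<lambda>d r f. \<alpha> (U \<inter> V) d (res C U (U \<inter> V) d f) r (\<phi> a)"
  let ?Z = "\<lambda>q d. {f \<in> gcarrier (sec C U) d. \<forall>r. mono_order n r < q \<longrightarrow> ?c d r f = 0}"
  have W: "openin X ?W" "?W \<subseteq> U" "?W \<subseteq> V" using U V_open by auto
  have A: "graded_comm_algebra (sec C U)" by (rule algebra_sheafD(3)[OF C U])
  have res: "rlinear (grade (sec C U) d) (grade (sec C ?W) d) (res C U ?W d)" for d
    by (rule presheaf_res[OF algebra_sheafD(2)[OF C] U W(1,2)])
  have mult: "gmult (sec C U) i j f g \<in> gcarrier (sec C U) (i + j)"
    if "f \<in> gcarrier (sec C U) i" "g \<in> gcarrier (sec C U) j" for i j f g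
    using rbilinearD(3)[OF graded_comm_algebraD(2)[OF A]] that by blast
  have func: "functional (grade (sec C U) d) (?c d r)" for d r
    using coeff_functional[OF W(1,3), of d r "\<phi> a"] rlinearD[OF res] by (simp add: functional_def)
  have sub: "submodule (?Z q d) real_ring (grade (sec C U) d)" for q d
  proof (rule rsubmoduleI[OF gca_rmodule[OF A]])
    have z: "\<zero>\<^bsub>grade (sec C U) d\<^esub> \<in> gcarrier (sec C U) d" using gca_rmodule[OF A] by simp
    have "?c d r \<zero>\<^bsub>grade (sec C U) d\<^esub> = 0" for r
      using func[of d r] z rmodule_smult(4)[OF gca_rmodule[OF A] z] unfolding functional_def
      by (metis mult_zero_left)
    then show "\<zero>\<^bsub>grade (sec C U) d\<^esub> \<in> ?Z q d" using z by simp
  qed (use func gca_rmodule[OF A] in \<open>auto simp: functional_def\<close>)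
  have "ideal_power (sec C U) ?I q d \<subseteq> ?Z q d" for q d
  proof (induction q arbitrary: d)
    case 0
    then show ?case by simp
  next
    case (Suc q)
    have "gmult (sec C U) p (d - p) f g \<in> ?Z (Suc q) d"
      if f: "f \<in> ?I p" and g: "g \<in> ideal_power (sec C U) ?I q (d - p)" for p f g
    proof -
      have fc: "f \<in> gcarrier (sec C U) p" and f0: "?c p (\<lambda>v. 0) f = 0"
        using f body_value_eq[OF chart_axioms U _ a, of f p] by (auto simp: vanishing_ideal_def)
      have gc: "g \<in> gcarrier (sec C U) (d - p)" and g0: "mono_order n r < q \<Longrightarrow> ?c (d - p) r g = 0" for r
        using Suc.IH[of "d - p"] g by auto
      have "?c d r (gmult (sec C U) p (d - p) f g) = 0" if r: "mono_order n r < Suc q" for r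
      proof (cases "r \<in> multi_indices n d")
        case True
        have eq: "?c d r (gmult (sec C U) p (d - p) f g)
           = (\<Sum>(s, t)\<in>mono_splits r. mono_sign n s t * ?c p s f * ?c (d - p) t g)"
          using algebra_sheafD(5)[OF C U W(1,2) fc gc]
            coeff_mult[OF W(1,3) rlinearD(1)[OF res fc] rlinearD(1)[OF res gc], of r "\<phi> a"] True by simp
        also have "\<dots> = (\<Sum>(s, t)\<in>mono_splits r. 0)"
        proof (rule sum_pair_cong)
          fix s t assume st: "(s, t) \<in> mono_splits r"
          show "mono_sign n s t * ?c p s f * ?c (d - p) t g = 0"
          proof (cases "s = (\<lambda>v. 0)")
            case False
            then have "mono_order n t < mono_order n r"
              using mono_order_pos[OF finite_gvars[OF fin] multi_indices_gvars[OF True] st] by blast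
            then show ?thesis using g0 r by simp
          qed (simp add: f0)
        qed
        finally show ?thesis by simp
      next
        case False
        then show ?thesis
          using coeff_outside[OF W(1,3) rlinearD(1)[OF res], of _ d r "\<phi> a"] mult[OF fc gc] by simp
      qed
      then show ?thesis using mult[OF fc gc] by simp
    qed
    then show ?case unfolding ideal_power.simps by (intro rspan_least[OF sub]) blast
  qed
  then show "f \<in> gcarrier (sec C U) d"
    and "mono_order n r < q \<Longrightarrow> \<alpha> (U \<inter> V) d (res C U (U \<inter> V) d f) r (\<phi> a) = 0"
    using f by blast+
qed

text \<open>Over a set that lies in a chart and trivializes the bundle, a section becomes a tensor of functions
  and vectors of the fibre. If it is a combination of sections multiplied by functions without terms of
  order up to that of \<open>p\<close> at \<open>a\<close>, its contraction with the coefficient at \<open>p\<close> and \<open>a\<close> vanishes. An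
  invisible section is such a combination for all \<open>p\<close> and \<open>a\<close>, and the contractions separate tensors.\<close>

lemma invisible_trivial:
  assumes E: "module_sheaf X C E" and K: "graded_vector_space K"
    and V': "openin X V'" and \<tau>: "mod_iso (subtopology X V') C E (const_tensor C K) \<tau>"
    and U: "openin X U" and x: "x \<in> invisible n X C U (sec E U) d"
  shows "res E U (U \<inter> V \<inter> V') d x = \<zero>\<^bsub>grade (sec E (U \<inter> V \<inter> V')) d\<^esub>"
proof -
  let ?W = "U \<inter> V \<inter> V'" and ?Y = "subtopology X V'"
  let ?A = "sec C ?W" and ?B = "sec C U" and ?I = "vanishing_ideal n X C U"
  have W: "openin X ?W" "?W \<subseteq> U" "?W \<subseteq> V" "openin ?Y ?W"
    and UV: "openin X (U \<inter> V)" "U \<inter> V \<subseteq> U" "U \<inter> V \<subseteq> V" "?W \<subseteq> U \<inter> V"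
    using U V_open V' by (auto simp: openin_open_subtopology)
  have A: "graded_comm_algebra ?A" and B: "graded_comm_algebra ?B"
    using algebra_sheafD(3)[OF C] W(1) U by auto
  interpret T: tensor_product ?A K
    by unfold_locales (use K graded_comm_algebraD(1)[OF A] in auto)
  have EW: "rmodule (grade (sec E ?W) d)" and EU: "rmodule (grade (sec E U) d)" for d
    using gvs_rmodule[OF graded_moduleD(1)[OF module_sheafD(3)[OF E]]] W(1) U by auto
  have hom: "mod_hom ?Y C E (const_tensor C K) \<tau>" using \<tau> by (simp add: mod_iso_def)
  have t: "rlinear (grade (sec E ?W) d) (gtensor ?A K d) (\<tau> ?W d)" for d
    using mod_homD(1)[OF hom W(4)] by (simp add: const_tensor_def tensor_module_def)
  have resE: "rlinear (grade (sec E U) d) (grade (sec E ?W) d) (res E U ?W d)" for d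
    by (rule presheaf_res[OF module_sheafD(2)[OF E] U W(1,2)])
  have resC: "rlinear (grade ?B d) (grade ?A d) (res C U ?W d)"
      "rlinear (grade ?B d) (grade (sec C (U \<inter> V)) d) (res C U (U \<inter> V) d)" for d
    using presheaf_res[OF algebra_sheafD(2)[OF C] U] W UV by auto
  let ?F = "\<lambda>i. {(\<lambda>f. \<alpha> ?W i f p (\<phi> a)) | p a. p \<in> multi_indices n i \<and> a \<in> ?W}"
  have act: "gact (sec E U) p (d - p) f y \<in> gcarrier (sec E U) d"
    if "f \<in> gcarrier ?B p" "y \<in> gcarrier (sec E U) (d - p)" for p f y
    using rbilinearD(3)[OF graded_moduleD(2)[OF module_sheafD(3)[OF E U]] that] by simp
  have xU: "x \<in> gcarrier (sec E U) d" using x by (simp add: invisible_def)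
  let ?z = "\<tau> ?W d (res E U ?W d x)"
  have z: "?z \<in> carrier (gtensor ?A K d)" using xU rlinearD(1)[OF t] rlinearD(1)[OF resE] by blast
  have "?z = \<zero>\<^bsub>gtensor ?A K d\<^esub>"
  proof (rule T.contractions_separate[where F = ?F, OF _ _ z])
    fix i c assume "c \<in> ?F i"
    then obtain p a where c: "c = (\<lambda>f. \<alpha> ?W i f p (\<phi> a))" and p: "p \<in> multi_indices n i" and a: "a \<in> ?W" by blast
    show cf: "functional (grade ?A i) c" unfolding c by (rule coeff_functional[OF W(1,3)])
    \<comment> \<open>a power of the ideal that kills all coefficients up to the order of \<open>p\<close>\<close>
    let ?q = "Suc (mono_order n p)"
    let ?L = "\<lambda>x. contract ?A K d i c (\<tau> ?W d (res E U ?W d x))"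
    let ?N = "grade K (d - i)"
    have L: "rlinear (grade (sec E U) d) ?N ?L"
      by (rule rlinear_comp[OF rlinear_comp[OF resE t] T.contract_linear[OF cf]])
    let ?S = "{gact (sec E U) p (d - p) f x | p f x.
       f \<in> ideal_power ?B (?I a) ?q p \<and> x \<in> gcarrier (sec E U) (d - p)}"
    have xS: "x \<in> rspan (grade (sec E U) d) ?S"
      using x a unfolding invisible_def ideal_times_module_def by blast
    note pw = ideal_power_coeff[OF U, of a]
    show "contract ?A K d i c ?z = \<zero>\<^bsub>?N\<^esub>"
    proof (rule rlinear_zero_on_span[OF EU T.rmod_Q L _ _ xS])
      show "?S \<subseteq> gcarrier (sec E U) d" using act ideal_power_coeff(1)[OF U] a by fast
      fix s assume "s \<in> ?S"
      then obtain k f y where s: "s = gact (sec E U) k (d - k) f y"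
        and f: "f \<in> ideal_power ?B (?I a) ?q k" and y: "y \<in> gcarrier (sec E U) (d - k)" by blast
      have fB: "f \<in> gcarrier ?B k" using ideal_power_coeff(1)[OF U _ _ f] a by simp
      let ?f = "res C U ?W k f" and ?y = "\<tau> ?W (d - k) (res E U ?W (d - k) y)"
      have f': "?f \<in> gcarrier ?A k" using rlinearD(1)[OF resC(1) fB] .
      have y': "?y \<in> carrier (gtensor ?A K (d - k))" using y rlinearD(1)[OF t] rlinearD(1)[OF resE] by blast
      have f0: "\<alpha> ?W k ?f r (\<phi> a) = 0" if "mono_order n r \<le> mono_order n p" for r
      proof -
        have "\<alpha> ?W k ?f r (\<phi> a) = \<alpha> (U \<inter> V) k (res C U (U \<inter> V) k f) r (\<phi> a)"
          using coeff_res[OF UV(1,3) W(1) UV(4) rlinearD(1)[OF resC(2) fB] a]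
            presheaf_res_res[OF algebra_sheafD(2)[OF C] U UV(1) W(1) UV(4,2) fB] by simp
        then show ?thesis using ideal_power_coeff(2)[OF U _ _ f] a that by simp
      qed
      have c0: "c (gmult ?A k j ?f g) = 0" if "k + j = i" "g \<in> gcarrier ?A j" for j g
      proof -
        have "c (gmult ?A k j ?f g) = (\<Sum>(s, t)\<in>mono_splits p.
            mono_sign n s t * \<alpha> ?W k ?f s (\<phi> a) * \<alpha> ?W j g t (\<phi> a))"
          using coeff_mult[OF W(1,3) f' that(2), of p "\<phi> a"] p that(1) by (simp add: c)
        also have "\<dots> = (\<Sum>(s, t)\<in>mono_splits p. 0)"
        proof (rule sum_pair_cong)
          fix s t assume "(s, t) \<in> mono_splits p"
          then have "mono_order n s \<le> mono_order n p" using mono_order_split[of s t p n] by simp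
          then show "mono_sign n s t * \<alpha> ?W k ?f s (\<phi> a) * \<alpha> ?W j g t (\<phi> a) = 0" using f0 by simp
        qed
        finally show ?thesis by simp
      qed
      have kd: "k + (d - k) = d" by simp
      have lin: "rlinear (gtensor ?A K (d - k)) ?N (\<lambda>z. contract ?A K d i c (left_act ?A K k (d - k) ?f z))"
        using rlinear_comp[OF left_act_linear[OF A K f', of "d - k"], of ?N "contract ?A K d i c"]
          T.contract_linear[OF cf, of d] by simp
      have zero: "contract ?A K d i c (left_act ?A K k (d - k) ?f z) = \<zero>\<^bsub>?N\<^esub>"
        if "z \<in> carrier (gtensor ?A K (d - k))" for z
      proof (rule T.gtensor_linear_eqI[OF T.rmod_Q lin rlinear_const_zero[OF T.rmod_Q] _ that])
        fix j g v assume g: "g \<in> gcarrier ?A j" and v: "v \<in> gcarrier K (d - k - j)"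
        have fg: "gmult ?A k j ?f g \<in> gcarrier ?A (k + j)"
          using rbilinearD(3)[OF graded_comm_algebraD(2)[OF A] f' g] .
        have v': "v \<in> gcarrier K (d - (k + j))" using v by (simp add: algebra_simps)
        show "contract ?A K d i c (left_act ?A K k (d - k) ?f (tens ?A K (d - k) j g v)) = \<zero>\<^bsub>?N\<^esub>"
          using left_act_tens[OF A K f' g v] T.contract_tens[OF cf fg v'] c0[OF _ g] v'
            rmodule_smult(4)[OF T.rmod_Q v'] by auto
      qed
      have "\<tau> ?W d (res E U ?W d s) = left_act ?A K k (d - k) ?f ?y"
        using module_sheafD(4)[OF E U W(1,2) fB y] mod_homD(3)[OF hom W(4) f' rlinearD(1)[OF resE y]]
        by (simp add: s const_tensor_def tensor_module_def)
      then show "?L s = \<zero>\<^bsub>?N\<^esub>" using zero[OF y'] by simp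
    qed
  next
    fix i f assume "f \<in> gcarrier ?A i" "\<And>c. c \<in> ?F i \<Longrightarrow> c f = 0"
    then show "f = \<zero>\<^bsub>grade ?A i\<^esub>" by (intro coeff_separate[OF W(1,3)]) auto
  qed
  moreover have "\<tau> ?W d \<zero>\<^bsub>grade (sec E ?W) d\<^esub> = \<zero>\<^bsub>gtensor ?A K d\<^esub>"
    by (rule rlinear_zero[OF EW T.rmodule_gtensor t])
  moreover obtain \<beta> where "mutually_inverse ?Y E (const_tensor C K) \<tau> \<beta>"
    using \<tau> by (auto simp: mod_iso_def)
  ultimately show ?thesis
    using W(4) rlinearD(1)[OF resE xU] EW unfolding mutually_inverse_def
    by (metis rmodule_closed(2))
qed

end

text \<open>Hence the sections of a graded vector bundle are geometric: none but 0 is invisible.\<close>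

theorem invisible_bundle:
  assumes M: "graded_manifold n X C" and E: "graded_vector_bundle X C K E" and U: "openin X U"
  shows "invisible n X C U (sec E U) d = {\<zero>\<^bsub>grade (sec E U) d\<^esub>}"
proof -
  have C: "algebra_sheaf X C" and fin: "finite {j. n j \<noteq> 0}" using M by (auto simp: graded_manifold_def)
  have Em: "module_sheaf X C E" and K: "graded_vector_space K"
    using E by (auto simp: graded_vector_bundle_def finite_dim_gvs_def)
  have EU: "rmodule (grade (sec E U) d)" for d
    using gvs_rmodule[OF graded_moduleD(1)[OF module_sheafD(3)[OF Em U]]] .
  have "x = \<zero>\<^bsub>grade (sec E U) d\<^esub>" if x: "x \<in> invisible n X C U (sec E U) d" for x
  proof (rule sheaf_eqI[OF module_sheafD(1)[OF Em] U])
    show "x \<in> gcarrier (sec E U) d" using x by (simp add: invisible_def)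
    show "\<zero>\<^bsub>grade (sec E U) d\<^esub> \<in> gcarrier (sec E U) d" using EU by simp
    fix m assume m: "m \<in> U"
    then have mX: "m \<in> topspace X" using openin_subset[OF U] by blast
    obtain V \<phi> \<alpha> where V: "m \<in> V" "graded_chart n X C V \<phi> \<alpha>"
      using M mX by (auto simp: graded_manifold_def)
    obtain V' \<tau> where V': "openin X V'" "m \<in> V'" "mod_iso (subtopology X V') C E (const_tensor C K) \<tau>"
      using E mX by (auto simp: graded_vector_bundle_def)
    interpret chart n X C V \<phi> \<alpha> using C fin V(2) by unfold_locales
    let ?W = "U \<inter> V \<inter> V'"
    have W: "openin X ?W" "?W \<subseteq> U" using U V_open V'(1) by auto
    have EW: "rmodule (grade (sec E ?W) d)"
      using gvs_rmodule[OF graded_moduleD(1)[OF module_sheafD(3)[OF Em W(1)]]] .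
    have "res E U ?W d x = res E U ?W d \<zero>\<^bsub>grade (sec E U) d\<^esub>"
      using invisible_trivial[OF Em K V'(1,3) U x]
        rlinear_zero[OF EU EW presheaf_res[OF module_sheafD(2)[OF Em] U W]] by simp
    then show "\<exists>W. openin X W \<and> m \<in> W \<and> W \<subseteq> U \<and> res E U W d x = res E U W d \<zero>\<^bsub>grade (sec E U) d\<^esub>"
      using W V V' m by blast
  qed
  moreover have "\<zero>\<^bsub>grade (sec E U) d\<^esub> \<in> rspan (grade (sec E U) d) S" for S
    by (auto simp: rspan_def rsubmodule_simps(2)[OF EU])
  ultimately show ?thesis using EU by (auto simp: invisible_def ideal_times_module_def)
qed


section \<open>Transport of sheaves of modules\<close>

text \<open>\<open>\<alpha>\<close> identifies the presheaf \<open>F\<close> with \<open>G\<close>: it is bijective in every degree and respects all operations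
  and restrictions. The operations of \<open>G\<close> need not satisfy any laws beforehand, so the module and sheaf
  axioms can be carried over from \<open>F\<close>; this is also why zero has to be mentioned separately.\<close>

definition sheaf_copy ::
  "'p topology \<Rightarrow> ('p,'a) alg_psh \<Rightarrow> ('p,'a,'b) mod_psh \<Rightarrow> ('p,'a,'c) mod_psh
     \<Rightarrow> ('p set \<Rightarrow> int \<Rightarrow> 'b \<Rightarrow> 'c) \<Rightarrow> bool" where
  "sheaf_copy X C F G \<alpha> \<longleftrightarrow> mod_hom X C F G \<alpha> \<and>
     (\<forall>U d. openin X U \<longrightarrow> bij_betw (\<alpha> U d) (gcarrier (sec F U) d) (gcarrier (sec G U) d) \<and>
        \<alpha> U d \<zero>\<^bsub>grade (sec F U) d\<^esub> = \<zero>\<^bsub>grade (sec G U) d\<^esub>)"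

lemma rmodule_transport:
  assumes M: "rmodule M" and h: "rlinear M N h" and bij: "bij_betw h (carrier M) (carrier N)"
    and zero: "h \<zero>\<^bsub>M\<^esub> = \<zero>\<^bsub>N\<^esub>"
  shows "rmodule N"
proof -
  interpret M: Module.module real_ring M by fact
  have neg: "x \<oplus>\<^bsub>M\<^esub> (-1) \<odot>\<^bsub>M\<^esub> x = \<zero>\<^bsub>M\<^esub>" if "x \<in> carrier M" for x
    using rmodule_smult(1)[OF M that, of 1 "-1"] that by (simp add: rmodule_smult[OF M])
  have surj: "carrier N = h ` carrier M" using bij by (simp add: bij_betw_def)
  have add: "h x \<oplus>\<^bsub>N\<^esub> h y = h (x \<oplus>\<^bsub>M\<^esub> y)" if "x \<in> carrier M" "y \<in> carrier M" for x y
    using rlinearD(2)[OF h that] by simp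
  have smult: "r \<odot>\<^bsub>N\<^esub> h x = h (r \<odot>\<^bsub>M\<^esub> x)" if "x \<in> carrier M" for r x
    using rlinearD(3)[OF h that] by simp
  show ?thesis
    by (rule rmoduleI, unfold surj)
      (auto simp: add smult M neg rmodule_smult[OF M] M.a_ac simp flip: zero)
qed

text \<open>If \<open>h\<close> and \<open>k\<close> turn the linear map \<open>f\<close> into \<open>g\<close>, then \<open>g\<close> is linear; no laws are required of its
  source and target.\<close>

lemma rlinear_transport:
  assumes M: "rmodule M" and h: "rlinear M N h" "carrier N = h ` carrier M"
    and f: "rlinear M M' f" and k: "rlinear M' N' k" and g: "\<And>x. x \<in> carrier M \<Longrightarrow> g (h x) = k (f x)"
  shows "rlinear N N' g"
proof (rule rlinearI; unfold h(2), elim imageE)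
  fix y x assume y: "y = h x" and x: "x \<in> carrier M"
  show "g y \<in> carrier N'" using x y rlinearD(1)[OF f] rlinearD(1)[OF k] by (simp add: g)
  show "g (r \<odot>\<^bsub>N\<^esub> y) = r \<odot>\<^bsub>N'\<^esub> g y" for r
    using x y M rlinearD[OF f] by (simp add: g rlinearD(3)[OF k] flip: rlinearD(3)[OF h(1)])
  fix y' x' assume "y' = h x'" "x' \<in> carrier M"
  then show "g (y \<oplus>\<^bsub>N\<^esub> y') = g y \<oplus>\<^bsub>N'\<^esub> g y'"
    using x y M rlinearD[OF f] by (simp add: g rlinearD(2)[OF k] flip: rlinearD(2)[OF h(1)])
qed

lemma sheaf_copyD:
  assumes "sheaf_copy X C F G \<alpha>" "openin X U"
  shows sheaf_copy_linear: "rlinear (grade (sec F U) d) (grade (sec G U) d) (\<alpha> U d)"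
    and sheaf_copy_bij: "bij_betw (\<alpha> U d) (gcarrier (sec F U) d) (gcarrier (sec G U) d)"
    and sheaf_copy_zero: "\<alpha> U d \<zero>\<^bsub>grade (sec F U) d\<^esub> = \<zero>\<^bsub>grade (sec G U) d\<^esub>"
    and sheaf_copy_res: "openin X V \<Longrightarrow> V \<subseteq> U \<Longrightarrow> x \<in> gcarrier (sec F U) d \<Longrightarrow>
           res G U V d (\<alpha> U d x) = \<alpha> V d (res F U V d x)"
    and sheaf_copy_act: "f \<in> gcarrier (sec C U) i \<Longrightarrow> x \<in> gcarrier (sec F U) j \<Longrightarrow>
           gact (sec G U) i j f (\<alpha> U j x) = \<alpha> U (i + j) (gact (sec F U) i j f x)"
    and sheaf_copy_inj: "x \<in> gcarrier (sec F U) d \<Longrightarrow> y \<in> gcarrier (sec F U) d \<Longrightarrow>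
           \<alpha> U d x = \<alpha> U d y \<Longrightarrow> x = y"
    and sheaf_copy_carrier: "gcarrier (sec G U) d = \<alpha> U d ` gcarrier (sec F U) d"
  using assms by (auto simp: sheaf_copy_def bij_betw_def inj_on_def mod_hom_def psh_hom_def)

lemma module_sheaf_rmodule:
  "module_sheaf X C F \<Longrightarrow> openin X U \<Longrightarrow> rmodule (grade (sec F U) d)"
  by (rule gvs_rmodule[OF graded_moduleD(1)[OF module_sheafD(3)]])

lemma module_sheaf_act_closed:
  "module_sheaf X C F \<Longrightarrow> openin X U \<Longrightarrow> f \<in> gcarrier (sec C U) i \<Longrightarrow> x \<in> gcarrier (sec F U) j \<Longrightarrow>
    gact (sec F U) i j f x \<in> gcarrier (sec F U) (i + j)"
  by (rule rbilinearD(3)[OF graded_moduleD(2)[OF module_sheafD(3)]])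

lemma presheaf_res_closed:
  "presheaf X F \<Longrightarrow> openin X U \<Longrightarrow> openin X V \<Longrightarrow> V \<subseteq> U \<Longrightarrow> x \<in> gcarrier (sec F U) d \<Longrightarrow>
     res F U V d x \<in> gcarrier (sec F V) d"
  by (rule rlinearD(1)[OF presheaf_res])

lemma sheaf_glue:
  assumes "sheaf X F" "\<And>V. V \<in> \<U> \<Longrightarrow> openin X V" "\<And>V. V \<in> \<U> \<Longrightarrow> s V \<in> gcarrier (sec F V) d"
    and "\<And>V W. V \<in> \<U> \<Longrightarrow> W \<in> \<U> \<Longrightarrow> res F V (V \<inter> W) d (s V) = res F W (V \<inter> W) d (s W)"
  obtains x where "x \<in> gcarrier (sec F (\<Union>\<U>)) d" "\<And>V. V \<in> \<U> \<Longrightarrow> res F (\<Union>\<U>) V d x = s V"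
proof -
  have "\<exists>x\<in>gcarrier (sec F (\<Union>\<U>)) d. \<forall>V\<in>\<U>. res F (\<Union>\<U>) V d x = s V"
  proof (rule assms(1)[unfolded sheaf_def, THEN conjunct2, THEN spec, THEN spec, THEN mp,
        THEN conjunct2, THEN spec, THEN mp])
    show "\<forall>V\<in>\<U>. openin X V" using assms(2) by blast
    show "(\<forall>V\<in>\<U>. s V \<in> gcarrier (sec F V) d) \<and>
        (\<forall>V\<in>\<U>. \<forall>W\<in>\<U>. res F V (V \<inter> W) d (s V) = res F W (V \<inter> W) d (s W))"
      by (intro conjI ballI assms(3,4))
  qed
  then obtain x where "x \<in> gcarrier (sec F (\<Union>\<U>)) d" "\<forall>V\<in>\<U>. res F (\<Union>\<U>) V d x = s V" ..
  then show ?thesis by (intro that) auto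
qed

text \<open>A presheaf identified with a sheaf of modules is one itself.\<close>

lemma module_sheaf_transport:
  assumes C: "algebra_sheaf X C" and F: "module_sheaf X C F" and \<alpha>: "sheaf_copy X C F G \<alpha>"
  shows "module_sheaf X C G"
proof -
  note D = sheaf_copyD[OF \<alpha>]
  have pF: "presheaf X F" and sF: "sheaf X F" using module_sheafD[OF F] by auto
  have rF: "rmodule (grade (sec F U) d)" if "openin X U" for U d
    using module_sheaf_rmodule[OF F that] .
  have rG: "rmodule (grade (sec G U) d)" if "openin X U" for U d
    using rmodule_transport[OF rF D(1,2,3)] that by blast
  note res = presheaf_res_closed[OF pF]
  note act = module_sheaf_act_closed[OF F]
  have pG: "presheaf X G"
    unfolding presheaf_def
  proof (intro conjI allI impI ballI)
    show "graded_vector_space (sec G U)" if "openin X U" for U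
      using rG that by (simp add: graded_vector_space_def)
    show "rlinear (grade (sec G U) d) (grade (sec G V) d) (res G U V d)"
      if "openin X U \<and> openin X V \<and> V \<subseteq> U" for U V d
    proof -
      have U: "openin X U" and V: "openin X V" "V \<subseteq> U" using that by auto
      show ?thesis
        by (rule rlinear_transport[OF rF[OF U] D(1,7)[OF U] presheaf_res[OF pF U V] D(1)[OF V(1)] D(4)[OF U V]])
    qed
    show "res G U U d y = y" if "openin X U" "y \<in> gcarrier (sec G U) d" for U d y
      using that D(4)[of U U _ d] presheaf_res_id[OF pF] by (auto simp: D(7))
    show "res G V W d (res G U V d y) = res G U W d y"
      if "openin X U \<and> openin X V \<and> openin X W \<and> W \<subseteq> V \<and> V \<subseteq> U" and y: "y \<in> gcarrier (sec G U) d" for U V W d y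
    proof -
      from that(1) have o: "openin X U" "openin X V" "openin X W" "W \<subseteq> V" "V \<subseteq> U" "W \<subseteq> U" by auto
      obtain x where x: "y = \<alpha> U d x" "x \<in> gcarrier (sec F U) d" using y by (auto simp: D(7)[OF o(1)])
      show ?thesis
        using o x D(4)[OF o(1) o(2,5) x(2)] D(4)[OF o(1) o(3,6) x(2)] D(4)[OF o(2) o(3,4) res[OF o(1,2,5) x(2)]]
          presheaf_res_res[OF pF o(1-5) x(2)] by simp
    qed
  qed
  have "sheaf X G"
    unfolding sheaf_def
  proof (intro conjI allI impI pG ballI)
    fix \<U> d x y
    assume \<U>: "\<forall>V\<in>\<U>. openin X V" and x: "x \<in> gcarrier (sec G (\<Union>\<U>)) d" and y: "y \<in> gcarrier (sec G (\<Union>\<U>)) d"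
      and eq: "\<forall>V\<in>\<U>. res G (\<Union>\<U>) V d x = res G (\<Union>\<U>) V d y"
    have U: "openin X (\<Union>\<U>)" using \<U> by (intro openin_Union) auto
    obtain x' y' where x': "x = \<alpha> (\<Union>\<U>) d x'" "x' \<in> gcarrier (sec F (\<Union>\<U>)) d"
      and y': "y = \<alpha> (\<Union>\<U>) d y'" "y' \<in> gcarrier (sec F (\<Union>\<U>)) d"
      using x y by (auto simp: D(7)[OF U])
    have "x' = y'"
    proof (rule sheaf_eqI[OF sF U x'(2) y'(2)])
      fix m assume "m \<in> \<Union>\<U>"
      then obtain V where V: "V \<in> \<U>" "m \<in> V" by blast
      have oV: "openin X V" "V \<subseteq> \<Union>\<U>" using V \<U> by auto
      have "\<alpha> V d (res F (\<Union>\<U>) V d x') = \<alpha> V d (res F (\<Union>\<U>) V d y')"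
        using eq V(1) D(4)[OF U oV x'(2)] D(4)[OF U oV y'(2)] x'(1) y'(1) by simp
      then have "res F (\<Union>\<U>) V d x' = res F (\<Union>\<U>) V d y'"
        by (rule D(6)[OF oV(1) res[OF U oV x'(2)] res[OF U oV y'(2)]])
      then show "\<exists>W. openin X W \<and> m \<in> W \<and> W \<subseteq> \<Union>\<U> \<and> res F (\<Union>\<U>) W d x' = res F (\<Union>\<U>) W d y'"
        using oV V(2) by blast
    qed
    then show "x = y" using x' y' by simp
  next
    fix \<U> d s
    assume \<U>: "\<forall>V\<in>\<U>. openin X V"
      and s: "(\<forall>V\<in>\<U>. s V \<in> gcarrier (sec G V) d) \<and>
             (\<forall>V\<in>\<U>. \<forall>W\<in>\<U>. res G V (V \<inter> W) d (s V) = res G W (V \<inter> W) d (s W))"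
    have U: "openin X (\<Union>\<U>)" using \<U> by (intro openin_Union) auto
    define t where "t V = inv_into (gcarrier (sec F V) d) (\<alpha> V d) (s V)" for V
    have t: "t V \<in> gcarrier (sec F V) d" "\<alpha> V d (t V) = s V" if "V \<in> \<U>" for V
    proof -
      have "s V \<in> \<alpha> V d ` gcarrier (sec F V) d" using s \<U> that D(7) by blast
      then show "t V \<in> gcarrier (sec F V) d" "\<alpha> V d (t V) = s V"
        unfolding t_def by (auto intro: inv_into_into f_inv_into_f)
    qed
    obtain x where x: "x \<in> gcarrier (sec F (\<Union>\<U>)) d" "\<And>V. V \<in> \<U> \<Longrightarrow> res F (\<Union>\<U>) V d x = t V"
    proof (rule sheaf_glue[OF sF, of \<U> t d])
      show "openin X V" "t V \<in> gcarrier (sec F V) d" if "V \<in> \<U>" for V using \<U> t that by auto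
      fix V W assume VW: "V \<in> \<U>" "W \<in> \<U>"
      then have o: "openin X V" "openin X W" "openin X (V \<inter> W)" using \<U> by auto
      have "res G V (V \<inter> W) d (s V) = res G W (V \<inter> W) d (s W)" using s VW by blast
      then have "\<alpha> (V \<inter> W) d (res F V (V \<inter> W) d (t V)) = \<alpha> (V \<inter> W) d (res F W (V \<inter> W) d (t W))"
        using D(4)[OF o(1,3) Int_lower1 t(1)[OF VW(1)]] D(4)[OF o(2,3) Int_lower2 t(1)[OF VW(2)]]
        by (simp add: t(2) VW)
      then show "res F V (V \<inter> W) d (t V) = res F W (V \<inter> W) d (t W)"
        using D(6)[OF o(3) res[OF o(1,3) Int_lower1 t(1)[OF VW(1)]] res[OF o(2,3) Int_lower2 t(1)[OF VW(2)]]]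
        by simp
    qed blast
    have "res G (\<Union>\<U>) V d (\<alpha> (\<Union>\<U>) d x) = s V" if "V \<in> \<U>" for V
      using D(4)[OF U _ _ x(1), of V] \<U> that x(2) t(2) by auto
    moreover have "\<alpha> (\<Union>\<U>) d x \<in> gcarrier (sec G (\<Union>\<U>)) d" using x(1) by (simp add: D(7)[OF U])
    ultimately show "\<exists>x\<in>gcarrier (sec G (\<Union>\<U>)) d. \<forall>V\<in>\<U>. res G (\<Union>\<U>) V d x = s V" by blast
  qed
  moreover have "graded_module (sec C U) (sec G U)" if U: "openin X U" for U
  proof -
    have A: "graded_comm_algebra (sec C U)" by (rule algebra_sheafD(3)[OF C U])
    have mF: "graded_module (sec C U) (sec F U)" by (rule module_sheafD(3)[OF F U])
    note a = D(5)[OF U]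
    note b = graded_moduleD(2)[OF mF]
    have "rbilinear (grade (sec C U) i) (grade (sec G U) j) (grade (sec G U) (i + j)) (gact (sec G U) i j)" for i j
      unfolding rbilinear_def
    proof (intro conjI ballI)
      fix f assume f: "f \<in> gcarrier (sec C U) i"
      show "rlinear (grade (sec G U) j) (grade (sec G U) (i + j)) (gact (sec G U) i j f)"
        by (rule rlinear_transport[OF rF[OF U] D(1,7)[OF U] rbilinearD(1)[OF b f] D(1)[OF U] a[OF f]])
    next
      fix y assume "y \<in> gcarrier (sec G U) j"
      then obtain x where x: "y = \<alpha> U j x" "x \<in> gcarrier (sec F U) j" by (auto simp: D(7)[OF U])
      show "rlinear (grade (sec C U) i) (grade (sec G U) (i + j)) (\<lambda>f. gact (sec G U) i j f y)"
        unfolding x(1)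
        by (rule rlinear_transport[OF gca_rmodule[OF A] rlinear_id _ rbilinearD(2)[OF b x(2)] D(1)[OF U] a[OF _ x(2)]])
          auto
    qed
    moreover have "gact (sec G U) (i + j) k (gmult (sec C U) i j f g) y
        = gact (sec G U) i (j + k) f (gact (sec G U) j k g y)"
      if f: "f \<in> gcarrier (sec C U) i" and g: "g \<in> gcarrier (sec C U) j" and y: "y \<in> gcarrier (sec G U) k" for i j k f g y
    proof -
      obtain x where x: "y = \<alpha> U k x" "x \<in> gcarrier (sec F U) k" using y by (auto simp: D(7)[OF U])
      have "gmult (sec C U) i j f g \<in> gcarrier (sec C U) (i + j)"
        by (rule rbilinearD(3)[OF graded_comm_algebraD(2)[OF A] f g])
      from a[OF this x(2)] show ?thesis
        using a[OF g x(2)] a[OF f act[OF U g x(2)]] graded_moduleD(3)[OF mF f g x(2)] x(1)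
        by (simp add: add.assoc)
    qed
    moreover have "gact (sec G U) 0 i (gone (sec C U)) y = y" if y: "y \<in> gcarrier (sec G U) i" for i y
    proof -
      obtain x where x: "y = \<alpha> U i x" "x \<in> gcarrier (sec F U) i" using y by (auto simp: D(7)[OF U])
      show ?thesis
        using a[OF graded_comm_algebraD(5)[OF A] x(2)] graded_moduleD(4)[OF mF x(2)] x(1) by simp
    qed
    ultimately show ?thesis
      using presheaf_gvs[OF pG U] by (simp add: graded_module_def)
  qed
  moreover have "res G U V (i + j) (gact (sec G U) i j f y)
             = gact (sec G V) i j (res C U V i f) (res G U V j y)"
    if U: "openin X U" and V: "openin X V" "V \<subseteq> U" and f: "f \<in> gcarrier (sec C U) i"
      and y: "y \<in> gcarrier (sec G U) j" for U V i j f y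
  proof -
    obtain x where x: "y = \<alpha> U j x" "x \<in> gcarrier (sec F U) j" using y by (auto simp: D(7)[OF U])
    show ?thesis
      using D(5)[OF U f x(2)] D(4)[OF U V act[OF U f x(2)]] D(4)[OF U V x(2)]
        D(5)[OF V(1) presheaf_res_closed[OF algebra_sheafD(2)[OF C] U V f] res[OF U V x(2)]]
        module_sheafD(4)[OF F U V f x(2)] x(1) by simp
  qed
  ultimately show ?thesis by (simp add: module_sheaf_def)
qed

lemma sheaf_copy_iso:
  assumes F: "module_sheaf X C F" and G: "module_sheaf X C G" and \<alpha>: "sheaf_copy X C F G \<alpha>"
  shows "mod_iso X C F G \<alpha>"
proof -
  note D = sheaf_copyD[OF \<alpha>]
  define \<beta> where "\<beta> U d = inv_into (gcarrier (sec F U) d) (\<alpha> U d)" for U d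
  have \<beta>\<alpha>: "\<beta> U d (\<alpha> U d x) = x" if "openin X U" "x \<in> gcarrier (sec F U) d" for U d x
    unfolding \<beta>_def using D(2)[OF that(1), of d] that(2) by (simp add: bij_betw_def)
  have \<alpha>\<beta>: "\<alpha> U d (\<beta> U d y) = y" "\<beta> U d y \<in> gcarrier (sec F U) d"
    if "openin X U" "y \<in> gcarrier (sec G U) d" for U d y
  proof -
    have "y \<in> \<alpha> U d ` gcarrier (sec F U) d" using that D(7) by blast
    then show "\<alpha> U d (\<beta> U d y) = y" "\<beta> U d y \<in> gcarrier (sec F U) d"
      unfolding \<beta>_def by (auto intro: f_inv_into_f inv_into_into)
  qed
  have lin: "rlinear (grade (sec G U) d) (grade (sec F U) d) (\<beta> U d)" if U: "openin X U" for U d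
    by (rule rlinear_transport[OF module_sheaf_rmodule[OF F U] D(1,7)[OF U] rlinear_id rlinear_id \<beta>\<alpha>[OF U]])
  have res: "res F U V d (\<beta> U d y) = \<beta> V d (res G U V d y)"
    if U: "openin X U" and V: "openin X V" "V \<subseteq> U" and y: "y \<in> gcarrier (sec G U) d" for U V d y
  proof (rule D(6)[OF V(1), where d = d])
    have rG: "res G U V d y \<in> gcarrier (sec G V) d"
      by (rule presheaf_res_closed[OF module_sheafD(2)[OF G] U V y])
    show "res F U V d (\<beta> U d y) \<in> gcarrier (sec F V) d"
      by (rule presheaf_res_closed[OF module_sheafD(2)[OF F] U V \<alpha>\<beta>(2)[OF U y]])
    show "\<beta> V d (res G U V d y) \<in> gcarrier (sec F V) d" by (rule \<alpha>\<beta>(2)[OF V(1) rG])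
    show "\<alpha> V d (res F U V d (\<beta> U d y)) = \<alpha> V d (\<beta> V d (res G U V d y))"
      using D(4)[OF U V \<alpha>\<beta>(2)[OF U y]] \<alpha>\<beta>(1)[OF U y] \<alpha>\<beta>(1)[OF V(1) rG] by simp
  qed
  have act: "\<beta> U (i + j) (gact (sec G U) i j f y) = gact (sec F U) i j f (\<beta> U j y)"
    if U: "openin X U" and f: "f \<in> gcarrier (sec C U) i" and y: "y \<in> gcarrier (sec G U) j" for U i j f y
    using \<beta>\<alpha>[OF U module_sheaf_act_closed[OF F U f \<alpha>\<beta>(2)[OF U y]]] D(5)[OF U f \<alpha>\<beta>(2)[OF U y]]
      \<alpha>\<beta>(1)[OF U y] by simp
  have "mod_hom X C G F \<beta>"
    using lin res act by (simp add: mod_hom_def psh_hom_def)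
  moreover have "mutually_inverse X F G \<alpha> \<beta>"
    using \<alpha>\<beta> \<beta>\<alpha> by (simp add: mutually_inverse_def)
  ultimately show ?thesis using \<alpha> by (auto simp: mod_iso_def sheaf_copy_def)
qed

lemma sheaf_copy_comp:
  assumes "sheaf_copy X C F G \<alpha>" "sheaf_copy X C G H \<beta>"
  shows "sheaf_copy X C F H (\<lambda>U d x. \<beta> U d (\<alpha> U d x))"
proof -
  note A = sheaf_copyD[OF assms(1)] and B = sheaf_copyD[OF assms(2)]
  have c: "\<alpha> U d x \<in> gcarrier (sec G U) d" if "openin X U" "x \<in> gcarrier (sec F U) d" for U d x
    using that A(7) by blast
  have "rlinear (grade (sec F U) d) (grade (sec H U) d) (\<lambda>x. \<beta> U d (\<alpha> U d x))" if "openin X U" for U d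
    by (rule rlinear_comp[OF A(1) B(1)]) (use that in auto)
  moreover have "bij_betw (\<lambda>x. \<beta> U d (\<alpha> U d x)) (gcarrier (sec F U) d) (gcarrier (sec H U) d)"
    if "openin X U" for U d
    using bij_betw_trans[OF A(2)[OF that] B(2)[OF that], of d] by (simp add: comp_def)
  ultimately show ?thesis
    using A(3,4,5) B(3,4,5) c by (simp add: sheaf_copy_def mod_hom_def psh_hom_def)
qed


section \<open>Jets of order 0\<close>

text \<open>The action of functions on sections as a linear map on the tensor product, \<open>g \<otimes> y \<mapsto> g \<cdot> y\<close>.\<close>

definition act_map :: "'a galg \<Rightarrow> ('a,'b) gmod \<Rightarrow> int \<Rightarrow> ('a,'b) free_tensor set \<Rightarrow> 'b" where
  "act_map A Q d = tensor_lift A Q d (grade Q d) (\<lambda>i. gact Q i (d - i))"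

text \<open>A graded module \<open>Q\<close> over \<open>A\<close>, and the tensor product of \<open>A\<close> and \<open>Q\<close> over the reals.\<close>

locale graded_module_tensor =
  fixes A :: "'a galg" and Q :: "('a,'b) gmod"
  assumes alg: "graded_comm_algebra A" and mod: "graded_module A Q"
begin

sublocale tensor_product A Q
  using graded_comm_algebraD(1)[OF alg] graded_moduleD(1)[OF mod] by unfold_locales

lemma act_closed: "f \<in> gcarrier A i \<Longrightarrow> y \<in> gcarrier Q j \<Longrightarrow> gact Q i j f y \<in> gcarrier Q (i + j)"
  by (rule rbilinearD(3)[OF graded_moduleD(2)[OF mod]])

lemma mult_closed: "f \<in> gcarrier A i \<Longrightarrow> g \<in> gcarrier A j \<Longrightarrow> gmult A i j f g \<in> gcarrier A (i + j)"
  by (rule rbilinearD(3)[OF graded_comm_algebraD(2)[OF alg]])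

lemma act_map:
  shows act_map_linear: "rlinear (gtensor A Q d) (grade Q d) (act_map A Q d)"
    and act_map_tens: "g \<in> gcarrier A i \<Longrightarrow> y \<in> gcarrier Q (d - i) \<Longrightarrow>
          act_map A Q d (tens A Q d i g y) = gact Q i (d - i) g y"
proof -
  have "rbilinear (grade A i) (grade Q (d - i)) (grade Q d) (gact Q i (d - i))" for i
    using graded_moduleD(2)[OF mod, of i "d - i"] by simp
  from tensor_lift[OF rmod_Q this]
  show "rlinear (gtensor A Q d) (grade Q d) (act_map A Q d)"
    and "g \<in> gcarrier A i \<Longrightarrow> y \<in> gcarrier Q (d - i) \<Longrightarrow>
          act_map A Q d (tens A Q d i g y) = gact Q i (d - i) g y"
    unfolding act_map_def by blast+
qed

text \<open>The tensor \<open>1 \<otimes> y\<close>.\<close>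

abbreviation unit_tens :: "int \<Rightarrow> 'b \<Rightarrow> ('a,'b) free_tensor set" where
  "unit_tens d y \<equiv> tens A Q d 0 (gone A) y"

lemma one_closed: "gone A \<in> gcarrier A 0"
  by (rule graded_comm_algebraD(5)[OF alg])

lemma unit_tens_linear: "rlinear (grade Q d) (gtensor A Q d) (unit_tens d)"
  using tens_linear_right[OF one_closed, of d] by simp

lemma act_map_unit_tens: "y \<in> gcarrier Q d \<Longrightarrow> act_map A Q d (unit_tens d y) = y"
  using act_map_tens[OF one_closed, of y d] graded_moduleD(4)[OF mod] by simp

lemma act_map_left_act:
  assumes f: "f \<in> gcarrier A p" and x: "x \<in> carrier (gtensor A Q d)"
  shows "act_map A Q (p + d) (left_act A Q p d f x) = gact Q p d f (act_map A Q d x)"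
proof (rule gtensor_linear_eqI[OF rmod_Q _ _ _ x])
  show "rlinear (gtensor A Q d) (grade Q (p + d)) (\<lambda>x. act_map A Q (p + d) (left_act A Q p d f x))"
    by (rule rlinear_comp[OF left_act_linear[OF alg Q f] act_map_linear])
  show "rlinear (gtensor A Q d) (grade Q (p + d)) (\<lambda>x. gact Q p d f (act_map A Q d x))"
    by (rule rlinear_comp[OF act_map_linear rbilinearD(1)[OF graded_moduleD(2)[OF mod] f]])
  fix i g y assume g: "g \<in> gcarrier A i" and y: "y \<in> gcarrier Q (d - i)"
  show "act_map A Q (p + d) (left_act A Q p d f (tens A Q d i g y))
      = gact Q p d f (act_map A Q d (tens A Q d i g y))"
    using left_act_tens[OF alg Q f g y] act_map_tens[OF mult_closed[OF f g], of y "p + d"] y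
      act_map_tens[OF g y] graded_moduleD(3)[OF mod f g y] by simp
qed

lemma jet_delta_tens:
  assumes f: "f \<in> gcarrier A p" and g: "g \<in> gcarrier A i" and y: "y \<in> gcarrier Q (d - p - i)"
  shows "jet_delta A Q p (d - p) f (tens A Q (d - p) i g y) =
    tens A Q d (p + i) (gmult A p i f g) y
      \<ominus>\<^bsub>gtensor A Q d\<^esub> koszul p i \<odot>\<^bsub>gtensor A Q d\<^esub> tens A Q d i g (gact Q p (d - p - i) f y)"
  using left_act_tens[OF alg Q f g y] right_act_tens[OF alg mod f g y]
  by (simp add: jet_delta_def)

lemma delta_tensors_1:
  "delta_tensors A Q (Suc 0) d = {jet_delta A Q p (d - p) f (tens A Q (d - p) i g y) | p f i g y.
     f \<in> gcarrier A p \<and> g \<in> gcarrier A i \<and> y \<in> gcarrier Q (d - p - i)}"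
  by simp blast

text \<open>The action identifies \<open>f \<triangleright> (g \<otimes> y)\<close> with \<open>f \<blacktriangleright> (g \<otimes> y)\<close>, by graded commutativity.\<close>

lemma jet_delta_closed_and_act_zero:
  assumes f: "f \<in> gcarrier A p" and g: "g \<in> gcarrier A i" and y: "y \<in> gcarrier Q (d - p - i)"
  shows "jet_delta A Q p (d - p) f (tens A Q (d - p) i g y) \<in> carrier (gtensor A Q d)"
    and "act_map A Q d (jet_delta A Q p (d - p) f (tens A Q (d - p) i g y)) = \<zero>\<^bsub>grade Q d\<^esub>"
proof -
  have y': "y \<in> gcarrier Q (d - (p + i))" using y by (simp add: algebra_simps)
  have fy: "gact Q p (d - p - i) f y \<in> gcarrier Q (d - i)" using act_closed[OF f y] by (simp add: algebra_simps)
  let ?s = "tens A Q d (p + i) (gmult A p i f g) y" and ?t = "tens A Q d i g (gact Q p (d - p - i) f y)"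
  have s: "?s \<in> carrier (gtensor A Q d)" by (rule tens_closed[OF mult_closed[OF f g] y'])
  have t: "?t \<in> carrier (gtensor A Q d)" by (rule tens_closed[OF g fy])
  note eq = jet_delta_tens[OF f g y]
  show "jet_delta A Q p (d - p) f (tens A Q (d - p) i g y) \<in> carrier (gtensor A Q d)"
    unfolding eq using s t by (simp add: rmodule_gtensor)
  let ?k = "d - p - i"
  have gf: "gmult A i p g f \<in> gcarrier A (p + i)" using mult_closed[OF g f] by (simp add: add.commute)
  have "act_map A Q d ?s = gact Q (p + i) ?k (gmult A p i f g) y"
    using act_map_tens[OF mult_closed[OF f g] y'] by (simp add: diff_diff_eq)
  also have "\<dots> = koszul p i \<odot>\<^bsub>grade Q d\<^esub> gact Q (p + i) ?k (gmult A i p g f) y"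
    using graded_comm_algebraD(4)[OF alg f g]
      rlinearD(3)[OF rbilinearD(2)[OF graded_moduleD(2)[OF mod] y] gf, of "koszul p i"] by simp
  also have "gact Q (p + i) ?k (gmult A i p g f) y = gact Q i (d - i) g (gact Q p ?k f y)"
    using graded_moduleD(3)[OF mod g f y] by (simp add: add.commute)
  also have "\<dots> = act_map A Q d ?t" using act_map_tens[OF g fy] by simp
  finally have st: "act_map A Q d ?s = koszul p i \<odot>\<^bsub>grade Q d\<^esub> act_map A Q d ?t" .
  show "act_map A Q d (jet_delta A Q p (d - p) f (tens A Q (d - p) i g y)) = \<zero>\<^bsub>grade Q d\<^esub>"
    unfolding eq using rlinear_minus[OF rmodule_gtensor rmod_Q act_map_linear s, of "koszul p i \<odot>\<^bsub>gtensor A Q d\<^esub> ?t"]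
      rlinearD[OF act_map_linear] s t st
    by (simp add: rmodule_gtensor rmodule_diff_eq_zero rmod_Q)
qed

lemma delta_tensors_subset: "delta_tensors A Q (Suc 0) d \<subseteq> carrier (gtensor A Q d)"
  using jet_delta_closed_and_act_zero(1) unfolding delta_tensors_1 by blast

lemma jet_rels_submodule: "submodule (jet_rels A Q 0 d) real_ring (gtensor A Q d)"
  unfolding jet_rels_def using delta_tensors_subset by (intro rspan_submodule[OF rmodule_gtensor]) simp

text \<open>Conversely \<open>g \<otimes> y - 1 \<otimes> (g \<cdot> y)\<close> is \<open>\<delta>\<^sub>g (1 \<otimes> y)\<close>. So the relations for jets of order 0 are exactly the
  kernel of the action.\<close>

lemma jet_rels_0: "jet_rels A Q 0 d = {x \<in> carrier (gtensor A Q d). act_map A Q d x = \<zero>\<^bsub>grade Q d\<^esub>}"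
proof
  let ?G = "gtensor A Q d"
  interpret G: Module.module real_ring ?G by (rule rmodule_gtensor)
  show "jet_rels A Q 0 d \<subseteq> {x \<in> carrier ?G. act_map A Q d x = \<zero>\<^bsub>grade Q d\<^esub>}"
    unfolding jet_rels_def
  proof (rule rspan_least[OF rlinear_kernel_submodule[OF rmodule_gtensor rmod_Q act_map_linear]])
    show "delta_tensors A Q (0 + 1) d \<subseteq> {x \<in> carrier ?G. act_map A Q d x = \<zero>\<^bsub>grade Q d\<^esub>}"
      using jet_delta_closed_and_act_zero delta_tensors_1 by fastforce
  qed
  let ?e = "\<lambda>x. unit_tens d (act_map A Q d x)"
  have e: "rlinear ?G ?G (\<lambda>x. x \<ominus>\<^bsub>?G\<^esub> ?e x)"
    by (intro rlinear_diff rmodule_gtensor rlinear_id rlinear_comp[OF act_map_linear unit_tens_linear])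
  have "pure_tensors d \<subseteq> {x \<in> carrier ?G. x \<ominus>\<^bsub>?G\<^esub> ?e x \<in> jet_rels A Q 0 d}"
  proof
    fix t assume "t \<in> pure_tensors d"
    then obtain i g y where t: "t = tens A Q d i g y" and g: "g \<in> gcarrier A i" and y: "y \<in> gcarrier Q (d - i)"
      by (auto simp: pure_tensors_def)
    have gy: "gact Q i (d - i) g y \<in> gcarrier Q d" using act_closed[OF g y] by simp
    have "gmult A i 0 g (gone A) = g"
      using graded_comm_algebraD(4)[OF alg g one_closed] graded_comm_algebraD(6)[OF alg g]
        rmodule_smult(3)[OF rmod_P g] by simp
    moreover have "unit_tens d (gact Q i (d - i) g y) \<in> carrier ?G"
      using rlinearD(1)[OF unit_tens_linear gy] .
    ultimately have "t \<ominus>\<^bsub>?G\<^esub> ?e t = jet_delta A Q i (d - i) g (tens A Q (d - i) 0 (gone A) y)"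
      using jet_delta_tens[OF g one_closed, of y d] y act_map_tens[OF g y] rmodule_smult(3)[OF rmodule_gtensor]
      by (simp add: t)
    also have "\<dots> \<in> delta_tensors A Q (Suc 0) d"
      unfolding delta_tensors_1 using g y one_closed by fastforce
    finally show "t \<in> {x \<in> carrier ?G. x \<ominus>\<^bsub>?G\<^esub> ?e x \<in> jet_rels A Q 0 d}"
      using tens_closed[OF g y] by (simp add: t jet_rels_def rspan_base)
  qed
  then have "carrier ?G \<subseteq> {x \<in> carrier ?G. x \<ominus>\<^bsub>?G\<^esub> ?e x \<in> jet_rels A Q 0 d}"
    using rspan_least[OF rlinear_vimage_submodule[OF rmodule_gtensor rmodule_gtensor e jet_rels_submodule]]
    by (simp add: gtensor_span[symmetric])
  then have rel: "x \<ominus>\<^bsub>?G\<^esub> ?e x \<in> jet_rels A Q 0 d" if "x \<in> carrier ?G" for x using that by blast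
  show "{x \<in> carrier ?G. act_map A Q d x = \<zero>\<^bsub>grade Q d\<^esub>} \<subseteq> jet_rels A Q 0 d"
  proof clarify
    fix x assume x: "x \<in> carrier ?G" "act_map A Q d x = \<zero>\<^bsub>grade Q d\<^esub>"
    then have "x \<ominus>\<^bsub>?G\<^esub> ?e x = x"
      using rlinear_zero[OF rmod_Q rmodule_gtensor unit_tens_linear, of d] by (simp add: G.minus_eq)
    then show "x \<in> jet_rels A Q 0 d" using rel[OF x(1)] by simp
  qed
qed

lemma jet_coset_eq_iff:
  assumes "x \<in> carrier (gtensor A Q d)" "y \<in> carrier (gtensor A Q d)"
  shows "jet_rels A Q 0 d +>\<^bsub>gtensor A Q d\<^esub> x = jet_rels A Q 0 d +>\<^bsub>gtensor A Q d\<^esub> y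
    \<longleftrightarrow> act_map A Q d x = act_map A Q d y"
  using coset_eq_iff[OF rmodule_gtensor jet_rels_submodule assms] assms
    rlinear_minus[OF rmodule_gtensor rmod_Q act_map_linear assms] rlinearD(1)[OF act_map_linear]
  by (simp add: jet_rels_0 rmodule_gtensor rmodule_diff_eq_zero rmod_Q)

lemma jet_coset_unit_tens:
  assumes "x \<in> carrier (gtensor A Q d)"
  shows "jet_rels A Q 0 d +>\<^bsub>gtensor A Q d\<^esub> x
    = jet_rels A Q 0 d +>\<^bsub>gtensor A Q d\<^esub> unit_tens d (act_map A Q d x)"
proof -
  have "act_map A Q d x \<in> gcarrier Q d" using assms rlinearD(1)[OF act_map_linear] by blast
  then show ?thesis
    using jet_coset_eq_iff[OF assms rlinearD(1)[OF unit_tens_linear]] act_map_unit_tens by simp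
qed

end

text \<open>A presheaf jet of order 0 is thus determined by its image under the action: it is the class of
  \<open>1 \<otimes> \<psi>\<close> for exactly one section \<open>\<psi>\<close>.\<close>

theorem pJet_0_copy:
  assumes C: "algebra_sheaf X C" and E: "module_sheaf X C E"
  shows "sheaf_copy X C E (pJet C E 0) (\<lambda>U d. pjet_class C E 0 U d 0 (gone (sec C U)))"
proof -
  let ?J = "pJet C E 0"
  let ?R = "\<lambda>U d. jet_rels (sec C U) (sec E U) 0 d" and ?G = "\<lambda>U d. gtensor (sec C U) (sec E U) d"
  let ?\<Phi> = "\<lambda>U d. pjet_class C E 0 U d 0 (gone (sec C U))"
  have loc: "graded_module_tensor (sec C U) (sec E U)" if "openin X U" for U
    using algebra_sheafD(3)[OF C that] module_sheafD(3)[OF E that] by unfold_locales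
  have J: "grade (sec ?J U) d = mquot (?G U d) (?R U d)" for U d
    by (simp add: pJet_def tensor_psh_def tensor_module_def gmod_quot_def)
  have U_facts: "rlinear (grade (sec E U) d) (grade (sec ?J U) d) (?\<Phi> U d)"
      "bij_betw (?\<Phi> U d) (gcarrier (sec E U) d) (gcarrier (sec ?J U) d)"
      "?\<Phi> U d \<zero>\<^bsub>grade (sec E U) d\<^esub> = \<zero>\<^bsub>grade (sec ?J U) d\<^esub>"
    if U: "openin X U" for U d
  proof -
    interpret graded_module_tensor "sec C U" "sec E U" by (rule loc[OF U])
    note M = rmodule_gtensor[of d] and W = jet_rels_submodule[of d]
    show "rlinear (grade (sec E U) d) (grade (sec ?J U) d) (?\<Phi> U d)"
      unfolding pjet_class_def J by (rule rlinear_comp[OF unit_tens_linear rlinear_coset[OF M W]])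
    show "?\<Phi> U d \<zero>\<^bsub>grade (sec E U) d\<^esub> = \<zero>\<^bsub>grade (sec ?J U) d\<^esub>"
      unfolding pjet_class_def J mquot_zero[OF M W]
      using rlinear_zero[OF rmod_Q M unit_tens_linear] coset_zero[OF M W] by simp
    show "bij_betw (?\<Phi> U d) (gcarrier (sec E U) d) (gcarrier (sec ?J U) d)"
      unfolding bij_betw_def
    proof
      show "inj_on (?\<Phi> U d) (gcarrier (sec E U) d)"
        unfolding pjet_class_def inj_on_def
        using jet_coset_eq_iff rlinearD(1)[OF unit_tens_linear] act_map_unit_tens by simp
      show "?\<Phi> U d ` gcarrier (sec E U) d = gcarrier (sec ?J U) d"
        unfolding J mquot_carrier[OF M W] pjet_class_def
        using jet_coset_unit_tens rlinearD(1)[OF unit_tens_linear] rlinearD(1)[OF act_map_linear] by blast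
    qed
  qed
  have act: "?\<Phi> U (p + d) (gact (sec E U) p d f \<psi>) = gact (sec ?J U) p d f (?\<Phi> U d \<psi>)"
    if U: "openin X U" and f: "f \<in> gcarrier (sec C U) p" and \<psi>: "\<psi> \<in> gcarrier (sec E U) d" for U p d f \<psi>
  proof -
    interpret graded_module_tensor "sec C U" "sec E U" by (rule loc[OF U])
    note lin = left_act_linear[OF alg Q f, of d]
    have one: "unit_tens d \<psi> \<in> carrier (?G U d)" by (rule rlinearD(1)[OF unit_tens_linear \<psi>])
    have fone: "left_act (sec C U) (sec E U) p d f (unit_tens d \<psi>) \<in> carrier (?G U (p + d))"
      by (rule rlinearD(1)[OF lin one])
    have zero: "gact (sec E U) p d f \<zero>\<^bsub>grade (sec E U) d\<^esub> = \<zero>\<^bsub>grade (sec E U) (p + d)\<^esub>"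
      by (rule rlinear_zero[OF rmod_Q rmod_Q rbilinearD(1)[OF graded_moduleD(2)[OF mod] f]])
    have ker: "left_act (sec C U) (sec E U) p d f w \<in> ?R U (p + d)" if "w \<in> ?R U d" for w
      using that rlinearD(1)[OF lin] act_map_left_act[OF f] zero unfolding jet_rels_0 by simp
    have "gact (sec ?J U) p d f (?\<Phi> U d \<psi>)
        = ?R U (p + d) +>\<^bsub>?G U (p + d)\<^esub> left_act (sec C U) (sec E U) p d f (unit_tens d \<psi>)"
      using quot_map_coset[OF rmodule_gtensor rmodule_gtensor jet_rels_submodule jet_rels_submodule lin ker one]
      by (simp add: pJet_def tensor_psh_def tensor_module_def gmod_quot_def pjet_class_def)
    then show ?thesis
      unfolding jet_coset_unit_tens[OF fone] act_map_left_act[OF f one] act_map_unit_tens[OF \<psi>]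
      by (simp add: pjet_class_def)
  qed
  have res: "res ?J U V d (?\<Phi> U d \<psi>) = ?\<Phi> V d (res E U V d \<psi>)"
    if U: "openin X U" and V: "openin X V" "V \<subseteq> U" and \<psi>: "\<psi> \<in> gcarrier (sec E U) d" for U V d \<psi>
  proof -
    interpret U: graded_module_tensor "sec C U" "sec E U" by (rule loc[OF U])
    interpret V: graded_module_tensor "sec C V" "sec E V" by (rule loc[OF V(1)])
    let ?r = "tens_map (sec C V) (sec E V) d (res C U V) (res E U V)"
    note rC = presheaf_res[OF algebra_sheafD(2)[OF C] U V] and rE = presheaf_res[OF module_sheafD(2)[OF E] U V]
    note tm = tens_map[OF U.tensor_product_axioms V.tensor_product_axioms rC rE]
    note lin = tm(1)[of d]
    have eq: "act_map (sec C V) (sec E V) d (?r x) = res E U V d (act_map (sec C U) (sec E U) d x)"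
      if x: "x \<in> carrier (?G U d)" for x
    proof (rule U.gtensor_linear_eqI[OF V.rmod_Q rlinear_comp[OF lin V.act_map_linear]
          rlinear_comp[OF U.act_map_linear rE] _ x])
      fix i g y assume g: "g \<in> gcarrier (sec C U) i" and y: "y \<in> gcarrier (sec E U) (d - i)"
      show "act_map (sec C V) (sec E V) d (?r (tens (sec C U) (sec E U) d i g y))
          = res E U V d (act_map (sec C U) (sec E U) d (tens (sec C U) (sec E U) d i g y))"
        using tm(2)[OF g y] V.act_map_tens[OF rlinearD(1)[OF rC g] rlinearD(1)[OF rE y]]
          U.act_map_tens[OF g y] module_sheafD(4)[OF E U V g y] by simp
    qed
    have one: "U.unit_tens d \<psi> \<in> carrier (?G U d)" by (rule rlinearD(1)[OF U.unit_tens_linear \<psi>])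
    have ker: "?r w \<in> ?R V d" if "w \<in> ?R U d" for w
      using that rlinearD(1)[OF lin] eq rlinear_zero[OF U.rmod_Q V.rmod_Q rE]
      unfolding U.jet_rels_0 V.jet_rels_0 by simp
    have "res ?J U V d (?\<Phi> U d \<psi>) = ?R V d +>\<^bsub>?G V d\<^esub> ?r (U.unit_tens d \<psi>)"
      using quot_map_coset[OF U.rmodule_gtensor V.rmodule_gtensor U.jet_rels_submodule V.jet_rels_submodule
          lin ker one]
      by (simp add: pJet_def tensor_psh_def pjet_class_def)
    also have "?r (U.unit_tens d \<psi>) = V.unit_tens d (res E U V d \<psi>)"
      using tm(2)[OF U.one_closed, of \<psi> d] \<psi> algebra_sheafD(4)[OF C U V] by simp
    finally show ?thesis by (simp add: pjet_class_def)
  qed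
  show ?thesis
    using U_facts act res by (simp add: sheaf_copy_def mod_hom_def psh_hom_def)
qed


section \<open>Geometrization\<close>

lemma ideal_power_subset:
  assumes A: "graded_comm_algebra A" and I: "\<And>d. I d \<subseteq> gcarrier A d"
  shows "ideal_power A I q d \<subseteq> gcarrier A d"
proof (induction q arbitrary: d)
  case (Suc q)
  have "gmult A p (d - p) f g \<in> gcarrier A d"
    if "f \<in> I p" "g \<in> ideal_power A I q (d - p)" for p f g
  proof -
    have "f \<in> gcarrier A p" "g \<in> gcarrier A (d - p)" using that I Suc.IH by blast+
    from rbilinearD(3)[OF graded_comm_algebraD(2)[OF A] this] show ?thesis by simp
  qed
  then show ?case unfolding ideal_power.simps by (intro rspan_subset[OF gca_rmodule[OF A]]) blast
qed simp

text \<open>Invisibility is preserved by identifications of sheaves.\<close>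

lemma invisible_transport:
  assumes C: "algebra_sheaf X C" and F: "module_sheaf X C F" and G: "module_sheaf X C G"
    and \<alpha>: "sheaf_copy X C F G \<alpha>" and U: "openin X U"
    and inv: "invisible n X C U (sec F U) d = {\<zero>\<^bsub>grade (sec F U) d\<^esub>}"
  shows "invisible n X C U (sec G U) d = {\<zero>\<^bsub>grade (sec G U) d\<^esub>}"
proof -
  have rF: "rmodule (grade (sec F U) d)" and rG: "rmodule (grade (sec G U) d)" for d
    using module_sheaf_rmodule[OF F U] module_sheaf_rmodule[OF G U] by auto
  obtain \<beta> where \<beta>: "mod_hom X C G F \<beta>" and inverse: "mutually_inverse X F G \<alpha> \<beta>"
    using sheaf_copy_iso[OF F G \<alpha>] by (auto simp: mod_iso_def)
  note b = mod_homD[OF \<beta> U]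
  have A: "graded_comm_algebra (sec C U)" by (rule algebra_sheafD(3)[OF C U])
  have "y = \<zero>\<^bsub>grade (sec G U) d\<^esub>" if y: "y \<in> invisible n X C U (sec G U) d" for y
  proof -
    have yG: "y \<in> gcarrier (sec G U) d" using y by (simp add: invisible_def)
    have "\<beta> U d y \<in> invisible n X C U (sec F U) d"
      unfolding invisible_def
    proof (intro CollectI conjI allI ballI)
      show "\<beta> U d y \<in> gcarrier (sec F U) d" by (rule rlinearD(1)[OF b(1) yG])
      fix q a assume a: "a \<in> U"
      let ?I = "ideal_power (sec C U) (vanishing_ideal n X C U a) q"
      have I: "?I p \<subseteq> gcarrier (sec C U) p" for p
        by (rule ideal_power_subset[OF A]) (auto simp: vanishing_ideal_def)
      show "\<beta> U d y \<in> ideal_times_module ?I (sec F U) d"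
        unfolding ideal_times_module_def
      proof (rule rspan_map[OF rG rF b(1)])
        show "y \<in> rspan (grade (sec G U) d) {gact (sec G U) p (d - p) f x |p f x.
            f \<in> ?I p \<and> x \<in> gcarrier (sec G U) (d - p)}"
          using y a by (simp add: invisible_def ideal_times_module_def)
        fix s assume "s \<in> {gact (sec G U) p (d - p) f x |p f x. f \<in> ?I p \<and> x \<in> gcarrier (sec G U) (d - p)}"
        then obtain p f x where s: "s = gact (sec G U) p (d - p) f x" and f: "f \<in> ?I p"
          and x: "x \<in> gcarrier (sec G U) (d - p)" by blast
        have "\<beta> U d s = gact (sec F U) p (d - p) f (\<beta> U (d - p) x)"
          using b(3)[OF subsetD[OF I f] x] s by simp
        then show "\<beta> U d s \<in> rspan (grade (sec F U) d) {gact (sec F U) p (d - p) f x |p f x.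
            f \<in> ?I p \<and> x \<in> gcarrier (sec F U) (d - p)}"
          using f rlinearD(1)[OF b(1) x] by (intro rspan_base) blast
      qed (use I module_sheaf_act_closed[OF F U] module_sheaf_act_closed[OF G U] in fastforce)+
    qed
    then have "\<beta> U d y = \<zero>\<^bsub>grade (sec F U) d\<^esub>" using inv by simp
    then show ?thesis
      using inverse U yG sheaf_copyD(3)[OF \<alpha> U] unfolding mutually_inverse_def by metis
  qed
  moreover have "\<zero>\<^bsub>grade (sec G U) d\<^esub> \<in> rspan (grade (sec G U) d) S" for S
    by (auto simp: rspan_def rsubmodule_simps(2)[OF rG])
  ultimately show ?thesis using rG by (auto simp: invisible_def ideal_times_module_def)
qed

text \<open>Geometrization does not change a sheaf without invisible sections.\<close>

theorem Geo_copy: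
  assumes F: "module_sheaf X C F"
    and inv: "\<And>U d. openin X U \<Longrightarrow> invisible n X C U (sec F U) d = {\<zero>\<^bsub>grade (sec F U) d\<^esub>}"
  shows "sheaf_copy X C F (Geo n X C F) (geo_class n X C F)"
proof -
  let ?I = "\<lambda>U d. invisible n X C U (sec F U) d" and ?M = "\<lambda>U d. grade (sec F U) d"
  have M: "rmodule (?M U d)" if "openin X U" for U d using module_sheaf_rmodule[OF F that] .
  have W: "submodule (?I U d) real_ring (?M U d)" if "openin X U" for U d
    using rsubmodule_zero[OF M[OF that]] inv[OF that] by simp
  have G: "grade (sec (Geo n X C F) U) d = mquot (?M U d) (?I U d)" for U d
    by (simp add: Geo_def gmod_quot_def)
  have "rlinear (?M U d) (grade (sec (Geo n X C F) U) d) (geo_class n X C F U d)"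
    and "bij_betw (geo_class n X C F U d) (gcarrier (sec F U) d) (gcarrier (sec (Geo n X C F) U) d)"
    and "geo_class n X C F U d \<zero>\<^bsub>?M U d\<^esub> = \<zero>\<^bsub>grade (sec (Geo n X C F) U) d\<^esub>"
    if U: "openin X U" for U d
  proof -
    show "rlinear (?M U d) (grade (sec (Geo n X C F) U) d) (geo_class n X C F U d)"
      unfolding G geo_class_def by (rule rlinear_coset[OF M[OF U] W[OF U]])
    show "geo_class n X C F U d \<zero>\<^bsub>?M U d\<^esub> = \<zero>\<^bsub>grade (sec (Geo n X C F) U) d\<^esub>"
      unfolding G geo_class_def mquot_zero[OF M[OF U] W[OF U]] by (rule coset_zero[OF M[OF U] W[OF U]])
    have "x = y" if "x \<in> carrier (?M U d)" "y \<in> carrier (?M U d)"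
      "?I U d +>\<^bsub>?M U d\<^esub> x = ?I U d +>\<^bsub>?M U d\<^esub> y" for x y
      using coset_eq_iff[OF M[OF U] W[OF U] that(1,2)] that(3) inv[OF U]
        rmodule_diff_eq_zero[OF M[OF U] that(1,2)] by simp
    then show "bij_betw (geo_class n X C F U d) (gcarrier (sec F U) d) (gcarrier (sec (Geo n X C F) U) d)"
      unfolding bij_betw_def inj_on_def G mquot_carrier[OF M[OF U] W[OF U]] geo_class_def by blast
  qed
  moreover have "geo_class n X C F U (p + d) (gact (sec F U) p d f x)
      = gact (sec (Geo n X C F) U) p d f (geo_class n X C F U d x)"
    if U: "openin X U" and f: "f \<in> gcarrier (sec C U) p" and x: "x \<in> gcarrier (sec F U) d" for U p d f x
  proof -
    have lin: "rlinear (?M U d) (?M U (p + d)) (gact (sec F U) p d f)"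
      by (rule rbilinearD(1)[OF graded_moduleD(2)[OF module_sheafD(3)[OF F U]] f])
    have "gact (sec F U) p d f w \<in> ?I U (p + d)" if "w \<in> ?I U d" for w
      using that inv[OF U] rlinear_zero[OF M[OF U] M[OF U] lin] by simp
    from quot_map_coset[OF M[OF U] M[OF U] W[OF U] W[OF U] lin this x]
    show ?thesis by (simp add: Geo_def gmod_quot_def geo_class_def)
  qed
  moreover have "res (Geo n X C F) U V d (geo_class n X C F U d x) = geo_class n X C F V d (res F U V d x)"
    if U: "openin X U" and V: "openin X V" "V \<subseteq> U" and x: "x \<in> gcarrier (sec F U) d" for U V d x
  proof -
    note lin = presheaf_res[OF module_sheafD(2)[OF F] U V, of d]
    have "res F U V d w \<in> ?I V d" if "w \<in> ?I U d" for w
      using that inv[OF U] inv[OF V(1)] rlinear_zero[OF M[OF U] M[OF V(1)] lin] by simp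
    from quot_map_coset[OF M[OF U] M[OF V(1)] W[OF U] W[OF V(1)] lin this x]
    show ?thesis by (simp add: Geo_def geo_class_def)
  qed
  ultimately show ?thesis by (simp add: sheaf_copy_def mod_hom_def psh_hom_def)
qed


section \<open>Sheafification of a sheaf\<close>

lemma germ_self:
  assumes "openin X U" "m \<in> U" "x \<in> gcarrier (sec F U) d"
  shows "(U, x) \<in> germ X F d U x m"
  using assms unfolding germ_def by blast

lemma germ_memD:
  assumes "(V, y) \<in> germ X F d U x m"
  obtains W where "openin X V" "m \<in> V" "y \<in> gcarrier (sec F V) d" "openin X W" "m \<in> W" "W \<subseteq> U \<inter> V"
    "res F U W d x = res F V W d y"
  using assms unfolding germ_def by blast

lemma germ_eqI:
  assumes F: "presheaf X F" and U: "openin X U" "x \<in> gcarrier (sec F U) d"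
    and V: "openin X V" "y \<in> gcarrier (sec F V) d"
    and W: "openin X W" "m \<in> W" "W \<subseteq> U" "W \<subseteq> V" and eq: "res F U W d x = res F V W d y"
  shows "germ X F d U x m = germ X F d V y m"
proof -
  have "germ X F d V1 x1 m \<subseteq> germ X F d V2 x2 m"
    if V1: "openin X V1" "x1 \<in> gcarrier (sec F V1) d" and V2: "openin X V2" "x2 \<in> gcarrier (sec F V2) d"
      and W: "W \<subseteq> V1" "W \<subseteq> V2" and eq: "res F V1 W d x1 = res F V2 W d x2" for V1 x1 V2 x2
  proof clarify
    fix T z assume "(T, z) \<in> germ X F d V1 x1 m"
    then obtain S where T: "openin X T" "m \<in> T" "z \<in> gcarrier (sec F T) d"
      and S: "openin X S" "m \<in> S" "S \<subseteq> V1 \<inter> T" "res F V1 S d x1 = res F T S d z" by (rule germ_memD)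
    let ?R = "S \<inter> W"
    have R: "openin X ?R" "m \<in> ?R" "?R \<subseteq> V2 \<inter> T" using S \<open>openin X W\<close> \<open>m \<in> W\<close> W by auto
    have "res F V2 ?R d x2 = res F W ?R d (res F V2 W d x2)"
      using presheaf_res_res[OF F V2(1) \<open>openin X W\<close> R(1) Int_lower2 W(2) V2(2)] by simp
    also have "\<dots> = res F V1 ?R d x1"
      using presheaf_res_res[OF F V1(1) \<open>openin X W\<close> R(1) Int_lower2 W(1) V1(2)] eq by simp
    also have "\<dots> = res F S ?R d (res F V1 S d x1)"
      using presheaf_res_res[OF F V1(1) S(1) R(1) Int_lower1 _ V1(2)] S(3) by simp
    also have "\<dots> = res F T ?R d z"
      using presheaf_res_res[OF F T(1) S(1) R(1) Int_lower1 _ T(3)] S(3,4) by simp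
    finally show "(T, z) \<in> germ X F d V2 x2 m"
      unfolding germ_def using T R by blast
  qed
  from this[OF U V W(3,4) eq] this[OF V U W(4,3) eq[symmetric]] show ?thesis by blast
qed

lemma germ_res:
  assumes F: "presheaf X F" and U: "openin X U" "x \<in> gcarrier (sec F U) d"
    and V: "openin X V" "V \<subseteq> U" "m \<in> V"
  shows "germ X F d V (res F U V d x) m = germ X F d U x m"
  using germ_eqI[OF F V(1) presheaf_res_closed[OF F U(1) V(1,2) U(2)] U V(1,3) order_refl V(2)]
    presheaf_res_id[OF F V(1) presheaf_res_closed[OF F U(1) V(1,2) U(2)]] by simp

lemma germ_eqD:
  assumes "openin X V" "m \<in> V" "y \<in> gcarrier (sec F V) d" and "germ X F d U x m = germ X F d V y m"
  obtains W where "openin X W" "m \<in> W" "W \<subseteq> U" "W \<subseteq> V" "res F U W d x = res F V W d y"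
proof -
  have "(V, y) \<in> germ X F d U x m" using germ_self[OF assms(1-3)] assms(4) by simp
  then show ?thesis by (rule germ_memD) (use that in blast)
qed

lemma Union_constant:
  assumes "\<And>g. g \<in> S \<Longrightarrow> g = c" "c \<in> S"
  shows "\<Union>S = c"
  using assms by blast

text \<open>An operation \<open>T\<close> on sections that commutes with restrictions is computed on germs by any
  representative over a set satisfying \<open>R\<close>.\<close>

lemma germ_operation:
  assumes F: "presheaf X F" and U: "openin X U" "R U" "m \<in> U" and x: "x \<in> gcarrier (sec F U) d"
    and T: "\<And>W z. openin X W \<Longrightarrow> R W \<Longrightarrow> z \<in> gcarrier (sec F W) d \<Longrightarrow> T W z \<in> gcarrier (sec F W) e"
    and res: "\<And>W V z. openin X W \<Longrightarrow> R W \<Longrightarrow> openin X V \<Longrightarrow> V \<subseteq> W \<Longrightarrow> z \<in> gcarrier (sec F W) d \<Longrightarrow>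
           res F W V e (T W z) = T V (res F W V d z)"
  shows "\<Union>{germ X F e W (T W z) m | W z. R W \<and> (W, z) \<in> germ X F d U x m} = germ X F e U (T U x) m"
proof (rule Union_constant)
  let ?S = "{germ X F e W (T W z) m | W z. R W \<and> (W, z) \<in> germ X F d U x m}"
  show "germ X F e U (T U x) m \<in> ?S" using germ_self[OF U(1,3) x] U(2) by blast
  fix g assume "g \<in> ?S"
  then obtain W z where g: "g = germ X F e W (T W z) m" and R: "R W" and z: "(W, z) \<in> germ X F d U x m" by blast
  from z obtain V where W: "openin X W" "m \<in> W" "z \<in> gcarrier (sec F W) d"
    and V: "openin X V" "m \<in> V" "V \<subseteq> U \<inter> W" "res F U V d x = res F W V d z" by (rule germ_memD)
  have VU: "V \<subseteq> U" "V \<subseteq> W" using V by auto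
  have "res F W V e (T W z) = res F U V e (T U x)"
    using res[OF W(1) R V(1) VU(2) W(3)] res[OF U(1,2) V(1) VU(1) x] V(4) by simp
  then show "g = germ X F e U (T U x) m"
    unfolding g by (rule germ_eqI[OF F W(1) T[OF W(1) R W(3)] U(1) T[OF U(1,2) x] V(1,2) VU(2,1)])
qed

text \<open>A sheaf is canonically its own sheafification: injectivity is separation, and surjectivity is gluing
  of local sections with the given germs.\<close>

theorem sheafify_copy:
  assumes C: "algebra_sheaf X C" and F: "module_sheaf X C F"
  shows "sheaf_copy X C F (sheafify X C F) (sff X F)"
proof -
  let ?S = "sheafify X C F"
  have pF: "presheaf X F" and sF: "sheaf X F" using module_sheafD[OF F] by auto
  note res = presheaf_res_closed[OF pF] and rr = presheaf_res_res[OF pF]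
  have r: "rmodule (grade (sec F U) d)" if "openin X U" for U d using module_sheaf_rmodule[OF F that] .
  have S: "grade (sec ?S U) d = sheafify_grade X F U d" for U d by (simp add: sheafify_def)
  have carr: "sff X F U d x \<in> carrier (sheafify_grade X F U d)"
    if "openin X U" "x \<in> gcarrier (sec F U) d" for U d x
    using that by (auto simp: sheafify_grade_def sff_def intro!: exI[of _ U])
  have lin: "rlinear (grade (sec F U) d) (grade (sec ?S U) d) (sff X F U d)" if U: "openin X U" for U d
  proof (rule rlinearI)
    fix x y k assume x: "x \<in> gcarrier (sec F U) d"
    then show "sff X F U d x \<in> gcarrier (sec ?S U) d" using carr[OF U] by (simp add: S)
    show "sff X F U d (k \<odot>\<^bsub>grade (sec F U) d\<^esub> x) = k \<odot>\<^bsub>grade (sec ?S U) d\<^esub> sff X F U d x"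
    proof
      fix m
      have "\<Union>{germ X F d W (k \<odot>\<^bsub>grade (sec F W) d\<^esub> z) m | W z. True \<and> (W, z) \<in> germ X F d U x m}
          = germ X F d U (k \<odot>\<^bsub>grade (sec F U) d\<^esub> x) m" if "m \<in> U"
        by (rule germ_operation[OF pF U _ that x])
          (simp_all add: r rlinearD(3)[OF presheaf_res[OF pF]])
      then show "sff X F U d (k \<odot>\<^bsub>grade (sec F U) d\<^esub> x) m = (k \<odot>\<^bsub>grade (sec ?S U) d\<^esub> sff X F U d x) m"
        by (cases "m \<in> U") (simp_all add: S sheafify_grade_def sff_def)
    qed
    assume y: "y \<in> gcarrier (sec F U) d"
    show "sff X F U d (x \<oplus>\<^bsub>grade (sec F U) d\<^esub> y) = sff X F U d x \<oplus>\<^bsub>grade (sec ?S U) d\<^esub> sff X F U d y"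
    proof
      fix m
      let ?T = "{germ X F d W (z \<oplus>\<^bsub>grade (sec F W) d\<^esub> w) m | W z w.
        (W, z) \<in> sff X F U d x m \<and> (W, w) \<in> sff X F U d y m}"
      have "\<Union>?T = sff X F U d (x \<oplus>\<^bsub>grade (sec F U) d\<^esub> y) m"
      proof (cases "m \<in> U")
        case True
        show ?thesis
        proof (rule Union_constant)
          show "sff X F U d (x \<oplus>\<^bsub>grade (sec F U) d\<^esub> y) m \<in> ?T"
            using germ_self[OF U True x] germ_self[OF U True y] True by (auto simp: sff_def)
          fix g assume "g \<in> ?T"
          then obtain W z w where g: "g = germ X F d W (z \<oplus>\<^bsub>grade (sec F W) d\<^esub> w) m"
            and z: "(W, z) \<in> germ X F d U x m" and w: "(W, w) \<in> germ X F d U y m"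
            using True by (auto simp: sff_def)
          from z obtain V where W: "openin X W" "m \<in> W" "z \<in> gcarrier (sec F W) d"
            and V: "openin X V" "m \<in> V" "V \<subseteq> U \<inter> W" "res F U V d x = res F W V d z" by (rule germ_memD)
          from w obtain V' where w: "w \<in> gcarrier (sec F W) d"
            and V': "openin X V'" "m \<in> V'" "V' \<subseteq> U \<inter> W" "res F U V' d y = res F W V' d w" by (rule germ_memD)
          let ?R = "V \<inter> V'"
          have R: "openin X ?R" "m \<in> ?R" "?R \<subseteq> U" "?R \<subseteq> W" and VU: "V \<subseteq> U" "V \<subseteq> W" "V' \<subseteq> U" "V' \<subseteq> W"
            using V V' by auto
          have eqx: "res F U ?R d x = res F W ?R d z"
            using rr[OF U V(1) R(1) Int_lower1 VU(1) x] rr[OF W(1) V(1) R(1) Int_lower1 VU(2) W(3)] V(4) by simp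
          have eqy: "res F U ?R d y = res F W ?R d w"
            using rr[OF U V'(1) R(1) Int_lower2 VU(3) y] rr[OF W(1) V'(1) R(1) Int_lower2 VU(4) w] V'(4) by simp
          have "germ X F d W (z \<oplus>\<^bsub>grade (sec F W) d\<^esub> w) m = germ X F d U (x \<oplus>\<^bsub>grade (sec F U) d\<^esub> y) m"
            using W w x y r U eqx eqy rlinearD(2)[OF presheaf_res[OF pF U R(1) R(3)] x y]
              rlinearD(2)[OF presheaf_res[OF pF W(1) R(1) R(4)] W(3) w]
            by (intro germ_eqI[OF pF W(1) _ U _ R(1,2,4,3)]) auto
          then show "g = sff X F U d (x \<oplus>\<^bsub>grade (sec F U) d\<^esub> y) m" using g True by (simp add: sff_def)
        qed
      qed (simp add: sff_def)
      then show "sff X F U d (x \<oplus>\<^bsub>grade (sec F U) d\<^esub> y) m = (sff X F U d x \<oplus>\<^bsub>grade (sec ?S U) d\<^esub> sff X F U d y) m"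
        by (simp add: S sheafify_grade_def)
    qed
  qed
  have zero: "sff X F U d \<zero>\<^bsub>grade (sec F U) d\<^esub> = \<zero>\<^bsub>grade (sec ?S U) d\<^esub>" for U d
    by (simp add: S sheafify_grade_def sff_def)
  have bij: "bij_betw (sff X F U d) (gcarrier (sec F U) d) (gcarrier (sec ?S U) d)" if U: "openin X U" for U d
  proof (rule bij_betwI')
    fix x y assume x: "x \<in> gcarrier (sec F U) d" and y: "y \<in> gcarrier (sec F U) d"
    show "(sff X F U d x = sff X F U d y) = (x = y)"
    proof
      assume eq: "sff X F U d x = sff X F U d y"
      show "x = y"
      proof (rule sheaf_eqI[OF sF U x y])
        fix m assume m: "m \<in> U"
        then have "germ X F d U x m = germ X F d U y m" using eq by (simp add: sff_def fun_eq_iff) metis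
        then show "\<exists>W. openin X W \<and> m \<in> W \<and> W \<subseteq> U \<and> res F U W d x = res F U W d y"
          using germ_eqD[OF U m y] by metis
      qed
    qed simp
  next
    show "sff X F U d x \<in> gcarrier (sec ?S U) d" if "x \<in> gcarrier (sec F U) d" for x
      using carr[OF U that] by (simp add: S)
  next
    fix s assume s: "s \<in> gcarrier (sec ?S U) d"
    let ?P = "\<lambda>V x. x \<in> gcarrier (sec F V) d \<and> (\<forall>m\<in>V. s m = germ X F d V x m)"
    \<comment> \<open>the open sets on which the family \<open>s\<close> comes from a single section\<close>
    let ?\<U> = "{V. openin X V \<and> V \<subseteq> U \<and> (\<exists>x. ?P V x)}"
    have s_out: "s m = {}" if "m \<notin> U" for m using s that by (simp add: S sheafify_grade_def)
    have ex: "\<exists>V\<in>?\<U>. m \<in> V" if m: "m \<in> U" for m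
    proof -
      have "\<forall>m\<in>U. \<exists>V x. openin X V \<and> m \<in> V \<and> V \<subseteq> U \<and> x \<in> gcarrier (sec F V) d \<and>
           (\<forall>m'\<in>V. s m' = germ X F d V x m')"
        using s by (simp add: S sheafify_grade_def)
      then obtain V x where "openin X V" "m \<in> V" "V \<subseteq> U" "?P V x" using m by meson
      then show ?thesis by blast
    qed
    have cover: "\<Union>?\<U> = U"
    proof (rule subset_antisym)
      show "\<Union>?\<U> \<subseteq> U" by (rule Union_least) simp
      show "U \<subseteq> \<Union>?\<U>" using ex by (intro subsetI) (erule bexE[OF ex], rule UnionI)
    qed
    define t where "t V = (SOME x. ?P V x)" for V
    have t: "?P V (t V)" if "V \<in> ?\<U>" for V
    proof -
      from that have "\<exists>x. ?P V x" by blast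
      then show ?thesis unfolding t_def by (rule someI_ex)
    qed
    obtain x where x: "x \<in> gcarrier (sec F (\<Union>?\<U>)) d" "\<And>V. V \<in> ?\<U> \<Longrightarrow> res F (\<Union>?\<U>) V d x = t V"
    proof (rule sheaf_glue[OF sF, of ?\<U> t d])
      show "openin X V" "t V \<in> gcarrier (sec F V) d" if "V \<in> ?\<U>" for V using that t[OF that] by blast+
      fix V W assume V: "V \<in> ?\<U>" and W: "W \<in> ?\<U>"
      have o: "openin X V" "openin X W" "openin X (V \<inter> W)" using V W by auto
      have tV: "t V \<in> gcarrier (sec F V) d" and tW: "t W \<in> gcarrier (sec F W) d" using t[OF V] t[OF W] by blast+
      show "res F V (V \<inter> W) d (t V) = res F W (V \<inter> W) d (t W)"
      proof (rule sheaf_eqI[OF sF o(3) res[OF o(1,3) Int_lower1 tV] res[OF o(2,3) Int_lower2 tW]])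
        fix m assume m: "m \<in> V \<inter> W"
        then have "germ X F d V (t V) m = germ X F d W (t W) m" using t[OF V] t[OF W] by (metis IntD1 IntD2)
        moreover have "m \<in> W" using m by blast
        ultimately obtain T where T: "openin X T" "m \<in> T" "T \<subseteq> V" "T \<subseteq> W" "res F V T d (t V) = res F W T d (t W)"
          using germ_eqD[OF o(2) _ tW] by metis
        then have TVW: "T \<subseteq> V \<inter> W" by blast
        have "res F (V \<inter> W) T d (res F V (V \<inter> W) d (t V)) = res F (V \<inter> W) T d (res F W (V \<inter> W) d (t W))"
          using rr[OF o(1,3) T(1) TVW Int_lower1 tV] rr[OF o(2,3) T(1) TVW Int_lower2 tW] T(5) by simp
        then show "\<exists>T. openin X T \<and> m \<in> T \<and> T \<subseteq> V \<inter> W \<and>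
            res F (V \<inter> W) T d (res F V (V \<inter> W) d (t V)) = res F (V \<inter> W) T d (res F W (V \<inter> W) d (t W))"
          using T(1,2) TVW by blast
      qed
    qed (rule that)
    have xU: "x \<in> gcarrier (sec F U) d" using x(1) unfolding cover .
    have "s = sff X F U d x"
    proof
      fix m
      show "s m = sff X F U d x m"
      proof (cases "m \<in> U")
        case True
        obtain V where V: "V \<in> ?\<U>" "m \<in> V" by (rule bexE[OF ex[OF True]])
        have "res F U V d x = t V" using x(2)[OF V(1)] unfolding cover .
        moreover have "openin X V" "V \<subseteq> U" using V(1) by simp_all
        ultimately have "germ X F d U x m = germ X F d V (t V) m"
          using germ_res[OF pF U xU _ _ V(2)] by simp
        then show ?thesis using t[OF V(1)] V(2) True by (simp add: sff_def)
      qed (simp add: sff_def s_out)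
    qed
    then show "\<exists>x\<in>gcarrier (sec F U) d. s = sff X F U d x" using xU by blast
  qed
  have act: "sff X F U (p + d) (gact (sec F U) p d f x) = gact (sec ?S U) p d f (sff X F U d x)"
    if U: "openin X U" and f: "f \<in> gcarrier (sec C U) p" and x: "x \<in> gcarrier (sec F U) d" for U p d f x
  proof
    fix m
    note rC = presheaf_res_closed[OF algebra_sheafD(2)[OF C]] presheaf_res_res[OF algebra_sheafD(2)[OF C]]
    have "\<Union>{germ X F (p + d) W (gact (sec F W) p d (res C U W p f) z) m | W z.
          W \<subseteq> U \<and> (W, z) \<in> germ X F d U x m}
        = germ X F (p + d) U (gact (sec F U) p d (res C U U p f) x) m" if "m \<in> U"
    proof (rule germ_operation[OF pF U order_refl that x])
      fix W z assume W: "openin X W" "W \<subseteq> U" and z: "z \<in> gcarrier (sec F W) d"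
      show "gact (sec F W) p d (res C U W p f) z \<in> gcarrier (sec F W) (p + d)"
        by (rule module_sheaf_act_closed[OF F W(1) rC(1)[OF U W f] z])
      fix V assume V: "openin X V" "V \<subseteq> W"
      show "res F W V (p + d) (gact (sec F W) p d (res C U W p f) z)
          = gact (sec F V) p d (res C U V p f) (res F W V d z)"
        using module_sheafD(4)[OF F W(1) V rC(1)[OF U W f] z] rC(2)[OF U W(1) V W(2) f] by simp
    qed
    then show "sff X F U (p + d) (gact (sec F U) p d f x) m = gact (sec ?S U) p d f (sff X F U d x) m"
      using presheaf_res_id[OF algebra_sheafD(2)[OF C] U f]
      by (cases "m \<in> U") (simp_all add: sheafify_def sff_def)
  qed
  have "res ?S U V d (sff X F U d x) = sff X F V d (res F U V d x)"
    if "openin X U" "openin X V" "V \<subseteq> U" "x \<in> gcarrier (sec F U) d" for U V d x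
    using that germ_res[OF pF that(1,4,2,3)] by (auto simp: sheafify_def sff_def fun_eq_iff subset_iff)
  then show ?thesis
    using lin zero bij act by (simp add: sheaf_copy_def mod_hom_def psh_hom_def)
qed


section \<open>The jet prolongation of order 0\<close>

lemma mod_hom_subtopology:
  assumes "openin X V" "mod_hom X C F G \<alpha>"
  shows "mod_hom (subtopology X V) C F G \<alpha>"
  using assms by (simp add: mod_hom_def psh_hom_def openin_open_subtopology)

lemma mod_hom_comp:
  assumes \<alpha>: "mod_hom X C F G \<alpha>" and \<beta>: "mod_hom X C G H \<beta>"
  shows "mod_hom X C F H (\<lambda>U d x. \<beta> U d (\<alpha> U d x))"
proof -
  note a = mod_homD[OF \<alpha>] and b = mod_homD[OF \<beta>]
  have "rlinear (grade (sec F U) d) (grade (sec H U) d) (\<lambda>x. \<beta> U d (\<alpha> U d x))" if "openin X U" for U d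
    by (rule rlinear_comp[OF a(1)[OF that] b(1)[OF that]])
  then show ?thesis
    using a(2,3) b(2,3) rlinearD(1)[OF a(1)] by (simp add: mod_hom_def psh_hom_def)
qed

text \<open>Local models of \<open>F\<close> are local models of every isomorphic \<open>G\<close>.\<close>

lemma mod_iso_local_transport:
  assumes V: "openin X V" and FG: "mod_iso X C F G \<alpha>" and FH: "mod_iso (subtopology X V) C F H \<tau>"
  obtains \<sigma> where "mod_iso (subtopology X V) C G H \<sigma>"
proof -
  let ?Y = "subtopology X V"
  obtain \<beta> where \<beta>: "mod_hom X C G F \<beta>" "mutually_inverse X F G \<alpha> \<beta>" using FG by (auto simp: mod_iso_def)
  obtain \<rho> where \<rho>: "mod_hom ?Y C H F \<rho>" "mutually_inverse ?Y F H \<tau> \<rho>" using FH by (auto simp: mod_iso_def)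
  have \<tau>: "mod_hom ?Y C F H \<tau>" and \<alpha>: "mod_hom ?Y C F G \<alpha>"
    using FG FH mod_hom_subtopology[OF V] by (auto simp: mod_iso_def)
  have \<beta>': "mod_hom ?Y C G F \<beta>" by (rule mod_hom_subtopology[OF V \<beta>(1)])
  have "mutually_inverse ?Y G H (\<lambda>U d x. \<tau> U d (\<beta> U d x)) (\<lambda>U d x. \<alpha> U d (\<rho> U d x))"
    using \<beta>(2) \<rho>(2) V rlinearD(1)[OF mod_homD(1)[OF \<beta>']] rlinearD(1)[OF mod_homD(1)[OF \<rho>(1)]]
    by (simp add: mutually_inverse_def openin_open_subtopology)
  with mod_hom_comp[OF \<beta>' \<tau>] mod_hom_comp[OF \<rho>(1) \<alpha>] show ?thesis
    by (intro that) (auto simp: mod_iso_def)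
qed

theorem proposition8p1:
  fixes n :: "int \<Rightarrow> nat" and X :: "'p topology" and C :: "('p,'a) alg_psh"
    and K :: "'k gvs" and E :: "('p,'a,'b) mod_psh"
  assumes "graded_manifold n X C"
    and "graded_vector_bundle X C K E"
  shows "module_sheaf_iso X C E (Jet n X C E 0) (jet_prolongation n X C E 0)
    \<and> graded_vector_bundle_iso X C K E K (Jet n X C E 0) (jet_prolongation n X C E 0)"
proof -
  let ?J = "pJet C E 0" and ?G = "gpJet n X C E 0"
  have C: "algebra_sheaf X C" using assms(1) by (simp add: graded_manifold_def)
  have E: "module_sheaf X C E" using assms(2) by (simp add: graded_vector_bundle_def)
  note cJ = pJet_0_copy[OF C E]
  have J: "module_sheaf X C ?J" by (rule module_sheaf_transport[OF C E cJ])
  have "invisible n X C U (sec ?J U) d = {\<zero>\<^bsub>grade (sec ?J U) d\<^esub>}" if "openin X U" for U d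
    by (rule invisible_transport[OF C E J cJ that invisible_bundle[OF assms that]])
  then have cG: "sheaf_copy X C ?J ?G (geo_class n X C ?J)"
    unfolding gpJet_def by (rule Geo_copy[OF J])
  have G: "module_sheaf X C ?G" by (rule module_sheaf_transport[OF C J cG])
  have "sheaf_copy X C ?G (Jet n X C E 0) (sff X ?G)"
    unfolding Jet_def by (rule sheafify_copy[OF C G])
  from sheaf_copy_comp[OF sheaf_copy_comp[OF cJ cG] this]
  have copy: "sheaf_copy X C E (Jet n X C E 0) (jet_prolongation n X C E 0)"
    by (simp add: jet_prolongation_def[abs_def])
  have Jet: "module_sheaf X C (Jet n X C E 0)" by (rule module_sheaf_transport[OF C E copy])
  have iso: "mod_iso X C E (Jet n X C E 0) (jet_prolongation n X C E 0)"
    by (rule sheaf_copy_iso[OF E Jet copy])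
  have "\<exists>V \<tau>. openin X V \<and> m \<in> V \<and> mod_iso (subtopology X V) C (Jet n X C E 0) (const_tensor C K) \<tau>"
    if m: "m \<in> topspace X" for m
  proof -
    obtain V \<tau> where "openin X V" "m \<in> V" "mod_iso (subtopology X V) C E (const_tensor C K) \<tau>"
      using assms(2) m by (auto simp: graded_vector_bundle_def)
    then show ?thesis using mod_iso_local_transport[OF _ iso] by metis
  qed
  then have "graded_vector_bundle X C K (Jet n X C E 0)"
    using Jet assms(2) by (auto simp: graded_vector_bundle_def)
  then show ?thesis
    using E Jet iso assms(2) by (simp add: module_sheaf_iso_def graded_vector_bundle_iso_def)
qed

end
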